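(* Let $\Theta_1,\Theta_2$ be two superchannels and $\varepsilon\in(0,1)$. Then the asymptotic Stein exponent over parallel strategies restricted to product states satisfies $$\liminf_{n\to\infty}\zeta^n_{cp}(\varepsilon,\Theta_1,\Theta_2)\;\ge\; D^{c\infty}(\Theta_1\|\Theta_2).$$
   Context: All systems are finite-dimensional; reference systems have arbitrary finite dimension; $\log$ is base 2; identity maps on systems not acted upon are omitted. Superchannel: $\Theta$ is given by channels $(\mathcal E_{C\to AS},\mathcal D_{BS\to D})$ and maps a channel $\mathcal N_{AR\to BR}$ to $(\Theta\otimes\mathrm{id}_R)(\mathcal N)=\mathcal D\circ\mathcal N\circ\mathcal E$, a channel from $CR$ to $DR$. $\Theta^{\otimes n}$ is the superchannel given by $(\mathcal E^{\otimes n},\mathcal D^{\otimes n})$. $D(\rho\|\sigma)$ is the quantum relative entropy ($+\infty$ if $\mathrm{supp}\,\rho\not\subseteq\mathrm{supp}\,\sigma$). Define $$D^{c\infty}(\Theta_1\|\Theta_2)=\lim_{n\to\infty}\frac1n\sup_{\rho,\mathcal N}D\big((\Theta_1^{\otimes n}\otimes\mathrm{id})(\mathcal N)(\rho_{CR}^{\otimes n})\,\big\|\,(\Theta_2^{\otimes n}\otimes\mathrm{id})(\mathcal N)(\rho_{CR}^{\otimes n})\big),$$ the supremum being over states $\rho_{CR}$ and joint channels $\mathcal N$ from $A^n$ together with all $n$ reference systems to $B^n$ together with reference. Parallel strategy with product states, $n$ copies: $\mathcal S=\{\rho_{CR},\mathcal N,\mathcal Q\}$ with the input state $\rho_{CR}^{\otimes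 n}$, an arbitrary joint channel $\mathcal N$ from $A^n$ and reference to $B^n$ and reference, and a binary POVM $\mathcal Q=\{Q_1,Q_2\}$; the output state is $\rho_i=(\Theta_i^{\otimes n}\otimes\mathrm{id})(\mathcal N)(\rho_{CR}^{\otimes n})$ when the superchannel is $\Theta_i$. Errors: $\alpha_n(\mathcal S)=\mathrm{Tr}(Q_2\rho_1)$, $\beta_n(\mathcal S)=\mathrm{Tr}(Q_1\rho_2)$, and $\zeta^n_{cp}(\varepsilon,\Theta_1,\Theta_2)=\sup_{\mathcal S}\{-\frac1n\log\beta_n(\mathcal S):\alpha_n(\mathcal S)\le\varepsilon\}$ over such strategies. *)

theory Defs
  imports "HOL-Analysis.Analysis"
begin

text \<open>
  A finite-dimensional system is given by the finite nonempty set of labels of a fixed orthonormal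
  basis, and an operator on it is the matrix in that basis. The joint system of \<open>I\<close> and \<open>J\<close> has
  label set \<open>I \<times> J\<close>, and \<open>n\<close> copies of \<open>I\<close> have as label set the lists of length \<open>n\<close> over \<open>I\<close>.
  Matrices are total functions on labels that vanish outside the label set, so that equality of
  functions is equality of operators.
\<close>

type_synonym 'i oper = "'i \<Rightarrow> 'i \<Rightarrow> complex"

definition system :: "'i set \<Rightarrow> bool" where
  "system I \<longleftrightarrow> finite I \<and> I \<noteq> {}"

definition words :: "'i set \<Rightarrow> nat \<Rightarrow> 'i list set" where
  "words I n = {xs. length xs = n \<and> set xs \<subseteq> I}"

definition opers :: "'i set \<Rightarrow> 'i oper set" where
  "opers I = {X. \<forall>i j. i \<notin> I \<or> j \<notin> I \<longrightarrow> X i j = 0}"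

definition id_op :: "'i set \<Rightarrow> 'i oper" where
  "id_op I = (\<lambda>i j. if i \<in> I \<and> i = j then 1 else 0)"

definition mult_op :: "'i set \<Rightarrow> 'i oper \<Rightarrow> 'i oper \<Rightarrow> 'i oper" where
  "mult_op I X Y = (\<lambda>i j. \<Sum>k\<in>I. X i k * Y k j)"

definition tr :: "'i set \<Rightarrow> 'i oper \<Rightarrow> complex" where
  "tr I X = (\<Sum>i\<in>I. X i i)"

definition psd :: "'i set \<Rightarrow> 'i oper \<Rightarrow> bool" where
  "psd I X \<longleftrightarrow> X \<in> opers I \<and>
     (\<forall>v :: 'i \<Rightarrow> complex. (\<Sum>i\<in>I. \<Sum>j\<in>I. cnj (v i) * X i j * v j) \<in> \<real>\<^sub>\<ge>\<^sub>0)"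

definition state :: "'i set \<Rightarrow> 'i oper \<Rightarrow> bool" where
  "state I \<rho> \<longleftrightarrow> psd I \<rho> \<and> tr I \<rho> = 1"


subsection \<open>Quantum relative entropy\<close>

definition kernel_op :: "'i set \<Rightarrow> 'i oper \<Rightarrow> ('i \<Rightarrow> complex) set" where
  "kernel_op I X = {v. (\<forall>i. i \<notin> I \<longrightarrow> v i = 0) \<and> (\<forall>i\<in>I. (\<Sum>j\<in>I. X i j * v j) = 0)}"

text \<open>The support is the orthogonal complement of the kernel.\<close>

definition supp_op :: "'i set \<Rightarrow> 'i oper \<Rightarrow> ('i \<Rightarrow> complex) set" where
  "supp_op I X = {v. (\<forall>i. i \<notin> I \<longrightarrow> v i = 0) \<and>
     (\<forall>w\<in>kernel_op I X. (\<Sum>i\<in>I. cnj (w i) * v i) = 0)}"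

text \<open>
  Functional calculus for Hermitian operators: if \<open>X = \<Sum>\<^sub>k d\<^sub>k |v\<^sub>k\<rangle>\<langle>v\<^sub>k|\<close> for an orthonormal basis
  \<open>(v\<^sub>k)\<close>, then \<open>f(X) = \<Sum>\<^sub>k f(d\<^sub>k) |v\<^sub>k\<rangle>\<langle>v\<^sub>k|\<close>, which does not depend on the decomposition. The basis
  vectors are numbered by the labels in \<open>I\<close>; this only uses that there are \<open>card I\<close> of them.
\<close>

definition orthonormal_basis :: "'i set \<Rightarrow> ('i \<Rightarrow> 'i \<Rightarrow> complex) \<Rightarrow> bool" where
  "orthonormal_basis I v \<longleftrightarrow> (\<forall>k\<in>I. \<forall>i. i \<notin> I \<longrightarrow> v k i = 0) \<and>
     (\<forall>k\<in>I. \<forall>l\<in>I. (\<Sum>i\<in>I. cnj (v k i) * v l i) = (if k = l then 1 else 0))"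

definition spectral_op :: "'i set \<Rightarrow> ('i \<Rightarrow> real) \<Rightarrow> ('i \<Rightarrow> 'i \<Rightarrow> complex) \<Rightarrow> 'i oper" where
  "spectral_op I d v = (\<lambda>i j. \<Sum>k\<in>I. complex_of_real (d k) * v k i * cnj (v k j))"

definition fun_calc :: "'i set \<Rightarrow> (real \<Rightarrow> real) \<Rightarrow> 'i oper \<Rightarrow> 'i oper" where
  "fun_calc I f X = (THE Y. \<exists>d v. orthonormal_basis I v \<and> X = spectral_op I d v \<and>
     Y = spectral_op I (\<lambda>k. f (d k)) v)"

text \<open>The logarithm is taken on the support.\<close>

definition log_op :: "'i set \<Rightarrow> 'i oper \<Rightarrow> 'i oper" where
  "log_op I X = fun_calc I (\<lambda>x. if x = 0 then 0 else log 2 x) X"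

definition rel_entropy :: "'i set \<Rightarrow> 'i oper \<Rightarrow> 'i oper \<Rightarrow> ereal" where
  "rel_entropy I \<rho> \<sigma> =
     (if supp_op I \<rho> \<subseteq> supp_op I \<sigma>
      then ereal (Re (tr I (mult_op I \<rho> (\<lambda>i j. log_op I \<rho> i j - log_op I \<sigma> i j))))
      else \<infinity>)"


subsection \<open>Channels\<close>

text \<open>
  \<open>ext_id E\<close> is \<open>E \<otimes> id\<close>: it sends \<open>\<Sum>\<^sub>r\<^sub>s X\<^sub>r\<^sub>s \<otimes> |r\<rangle>\<langle>s|\<close> to \<open>\<Sum>\<^sub>r\<^sub>s E(X\<^sub>r\<^sub>s) \<otimes> |r\<rangle>\<langle>s|\<close>.
\<close>

definition ext_id :: "('i oper \<Rightarrow> 'j oper) \<Rightarrow> ('i \<times> 'r) oper \<Rightarrow> ('j \<times> 'r) oper" where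
  "ext_id E X = (\<lambda>(j, r) (j', r'). E (\<lambda>i i'. X (i, r) (i', r')) j j')"

text \<open>Linear, trace preserving and completely positive maps; only the values on \<open>opers I\<close> matter.\<close>

definition channel :: "'i set \<Rightarrow> 'j set \<Rightarrow> ('i oper \<Rightarrow> 'j oper) \<Rightarrow> bool" where
  "channel I J E \<longleftrightarrow>
     (\<forall>X\<in>opers I. E X \<in> opers J) \<and>
     (\<forall>X\<in>opers I. \<forall>Y\<in>opers I. \<forall>a b.
        E (\<lambda>i i'. a * X i i' + b * Y i i') = (\<lambda>j j'. a * E X j j' + b * E Y j j')) \<and>
     (\<forall>X\<in>opers I. tr J (E X) = tr I X) \<and>
     (\<forall>(k::nat) X. psd (I \<times> {..<k}) X \<longrightarrow> psd (J \<times> {..<k}) (ext_id E X))"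

definition unit_op :: "'i \<Rightarrow> 'i \<Rightarrow> 'i oper" where
  "unit_op x x' = (\<lambda>i i'. if i = x \<and> i' = x' then 1 else 0)"

definition oper_pow :: "nat \<Rightarrow> 'i oper \<Rightarrow> 'i list oper" where
  "oper_pow n X = (\<lambda>xs xs'. if length xs = n \<and> length xs' = n
     then \<Prod>k<n. X (xs ! k) (xs' ! k) else 0)"

text \<open>
  \<open>E\<^sup>\<otimes>\<^sup>n\<close> for a map \<open>E\<close> with input system \<open>I\<close>: the linear map that sends
  \<open>|x\<^sub>1\<rangle>\<langle>x'\<^sub>1| \<otimes> \<dots> \<otimes> |x\<^sub>n\<rangle>\<langle>x'\<^sub>n|\<close> to \<open>E(|x\<^sub>1\<rangle>\<langle>x'\<^sub>1|) \<otimes> \<dots> \<otimes> E(|x\<^sub>n\<rangle>\<langle>x'\<^sub>n|)\<close>.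
\<close>

definition map_pow :: "'i set \<Rightarrow> nat \<Rightarrow> ('i oper \<Rightarrow> 'j oper) \<Rightarrow> 'i list oper \<Rightarrow> 'j list oper" where
  "map_pow I n E X = (\<lambda>ys ys'. if length ys = n \<and> length ys' = n
     then \<Sum>xs\<in>words I n. \<Sum>xs'\<in>words I n.
            X xs xs' * (\<Prod>k<n. E (unit_op (xs ! k) (xs' ! k)) (ys ! k) (ys' ! k))
     else 0)"

text \<open>The identification of \<open>(IJ)\<^sup>n\<close> with \<open>I\<^sup>n J\<^sup>n\<close>, in both directions.\<close>

definition unzip_op :: "('i \<times> 'j) list oper \<Rightarrow> ('i list \<times> 'j list) oper" where
  "unzip_op X = (\<lambda>(xs, ys) (xs', ys'). if length xs = length ys \<and> length xs' = length ys'
     then X (zip xs ys) (zip xs' ys') else 0)"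

definition zip_op :: "('i list \<times> 'j list) oper \<Rightarrow> ('i \<times> 'j) list oper" where
  "zip_op X = (\<lambda>zs zs'. X (map fst zs, map snd zs) (map fst zs', map snd zs'))"

definition swap_op :: "(('i \<times> 'j) \<times> 'k) oper \<Rightarrow> (('i \<times> 'k) \<times> 'j) oper" where
  "swap_op X = (\<lambda>((i, k), j) ((i', k'), j'). X ((i, j), k) ((i', j'), k'))"


subsection \<open>Superchannels\<close>

text \<open>
  A superchannel from channels \<open>A \<rightarrow> B\<close> to channels \<open>C \<rightarrow> D\<close> is given by a memory system \<open>S\<close>, an
  encoder \<open>C \<rightarrow> AS\<close> and a decoder \<open>BS \<rightarrow> D\<close>.
\<close>

record ('a, 'b, 'c, 'd, 's) super =
  mem :: "'s set"
  enc :: "'c oper \<Rightarrow> ('a \<times> 's) oper"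
  dec :: "('b \<times> 's) oper \<Rightarrow> 'd oper"

definition superchannel ::
  "'a set \<Rightarrow> 'b set \<Rightarrow> 'c set \<Rightarrow> 'd set \<Rightarrow> ('a, 'b, 'c, 'd, 's) super \<Rightarrow> bool" where
  "superchannel A B C D \<Theta> \<longleftrightarrow> system (mem \<Theta>) \<and>
     channel C (A \<times> mem \<Theta>) (enc \<Theta>) \<and> channel (B \<times> mem \<Theta>) D (dec \<Theta>)"

text \<open>
  \<open>(\<Theta> \<otimes> id)(N) = dec \<circ> N \<circ> enc\<close>. Here \<open>N\<close> acts on \<open>A\<close> and the reference, so the memory has to be
  swapped out of its way before and after.
\<close>

definition super_apply ::
  "('a, 'b, 'c, 'd, 's) super \<Rightarrow> (('a \<times> 'r) oper \<Rightarrow> ('b \<times> 'q) oper)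
     \<Rightarrow> ('c \<times> 'r) oper \<Rightarrow> ('d \<times> 'q) oper" where
  "super_apply \<Theta> N X =
     ext_id (dec \<Theta>) (swap_op (ext_id N (swap_op (ext_id (enc \<Theta>) X))))"

definition super_pow ::
  "'b set \<Rightarrow> 'c set \<Rightarrow> nat \<Rightarrow> ('a, 'b, 'c, 'd, 's) super
     \<Rightarrow> ('a list, 'b list, 'c list, 'd list, 's list) super" where
  "super_pow B C n \<Theta> =
     \<lparr> mem = words (mem \<Theta>) n,
       enc = (\<lambda>X. unzip_op (map_pow C n (enc \<Theta>) X)),
       dec = (\<lambda>X. map_pow (B \<times> mem \<Theta>) n (dec \<Theta>) (zip_op X)) \<rparr>"


subsection \<open>Parallel strategies with product states\<close>

text \<open>
  The input state \<open>\<rho>\<close> lives on \<open>CR\<close> with \<open>R = {..<r}\<close>. The channel \<open>N\<close> maps \<open>A\<^sup>n R\<^sup>n\<close> to \<open>B\<^sup>n\<close>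
  together with an output reference \<open>{..<q}\<close>; both reference dimensions \<open>r\<close> and \<open>q\<close> are arbitrary
  and part of the strategy.
\<close>

definition product_input :: "'a set \<Rightarrow> 'b set \<Rightarrow> 'c set \<Rightarrow> nat \<Rightarrow> nat \<Rightarrow> nat \<Rightarrow> ('c \<times> nat) oper
     \<Rightarrow> (('a list \<times> nat list) oper \<Rightarrow> ('b list \<times> nat) oper) \<Rightarrow> bool" where
  "product_input A B C n r q \<rho> N \<longleftrightarrow> state (C \<times> {..<r}) \<rho> \<and>
     channel (words A n \<times> words {..<r} n) (words B n \<times> {..<q}) N"

definition product_output :: "'b set \<Rightarrow> 'c set \<Rightarrow> nat \<Rightarrow> ('a, 'b, 'c, 'd, 's) super \<Rightarrow> ('c \<times> nat) oper
     \<Rightarrow> (('a list \<times> nat list) oper \<Rightarrow> ('b list \<times> nat) oper) \<Rightarrow> ('d list \<times> nat) oper" where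
  "product_output B C n \<Theta> \<rho> N = super_apply (super_pow B C n \<Theta>) N (unzip_op (oper_pow n \<rho>))"

definition D_cinf :: "'a set \<Rightarrow> 'b set \<Rightarrow> 'c set \<Rightarrow> 'd set
     \<Rightarrow> ('a, 'b, 'c, 'd, 's) super \<Rightarrow> ('a, 'b, 'c, 'd, 't) super \<Rightarrow> ereal" where
  "D_cinf A B C D \<Theta>1 \<Theta>2 = lim (\<lambda>n. ereal (1 / real n) *
     (SUP (r, q, \<rho>, N) \<in> {(r, q, \<rho>, N). product_input A B C n r q \<rho> N}.
        rel_entropy (words D n \<times> {..<q}) (product_output B C n \<Theta>1 \<rho> N)
                                         (product_output B C n \<Theta>2 \<rho> N)))"

definition binary_povm :: "'i set \<Rightarrow> 'i oper \<Rightarrow> 'i oper \<Rightarrow> bool" where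
  "binary_povm I Q1 Q2 \<longleftrightarrow> psd I Q1 \<and> psd I Q2 \<and> (\<lambda>i j. Q1 i j + Q2 i j) = id_op I"

definition neg_log2 :: "real \<Rightarrow> ereal" where
  "neg_log2 x = (if x = 0 then \<infinity> else ereal (- log 2 x))"

text \<open>The errors: \<open>\<alpha> = Tr(Q2 \<rho>1)\<close> and \<open>\<beta> = Tr(Q1 \<rho>2)\<close> with \<open>\<rho>1\<close>, \<open>\<rho>2\<close> the two output states.\<close>

definition \<alpha>_err where
  "\<alpha>_err B C D n \<Theta>1 q \<rho> N Q2 =
     Re (tr (words D n \<times> {..<q}) (mult_op (words D n \<times> {..<q}) Q2 (product_output B C n \<Theta>1 \<rho> N)))"

definition \<beta>_err where
  "\<beta>_err B C D n \<Theta>2 q \<rho> N Q1 =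
     Re (tr (words D n \<times> {..<q}) (mult_op (words D n \<times> {..<q}) Q1 (product_output B C n \<Theta>2 \<rho> N)))"

definition \<zeta>_cp :: "'a set \<Rightarrow> 'b set \<Rightarrow> 'c set \<Rightarrow> 'd set \<Rightarrow> nat \<Rightarrow> real
     \<Rightarrow> ('a, 'b, 'c, 'd, 's) super \<Rightarrow> ('a, 'b, 'c, 'd, 't) super \<Rightarrow> ereal" where
  "\<zeta>_cp A B C D n \<epsilon> \<Theta>1 \<Theta>2 =
     (SUP (r, q, \<rho>, N, Q1, Q2) \<in> {(r, q, \<rho>, N, Q1, Q2). product_input A B C n r q \<rho> N \<and>
            binary_povm (words D n \<times> {..<q}) Q1 Q2 \<and> \<alpha>_err B C D n \<Theta>1 q \<rho> N Q2 \<le> \<epsilon>}.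
        ereal (1 / real n) * neg_log2 (\<beta>_err B C D n \<Theta>2 q \<rho> N Q1))"

end

(*
  Fix the input state rho. Strategies of lengths m and n that use rho compose in parallel, and the outputs
  are then tensor products. Padding k copies of a strategy of length m with an arbitrary shorter one shows
  that the rate of every single strategy is a lower bound for the limit inferior of the optimal rates, so
  the limit in the regularised divergence exists and equals the supremum over all lengths.

  The same padded strategies are good for discrimination. If rho = sum d_k |v_k><v_k| and
  sigma = sum e_j |u_j><u_j| then D(rho||sigma) = E[log d] - E[log e], where d is averaged over the
  weights d_k and e over the weights <u_j|rho|u_j>. Both averages are additive under tensor products,
  and so are the variances, hence Chebyshev's inequality shows that almost all of the weight lies on the
  vectors v_k with d_k > 2^(E[log d] - delta), spanning a projection P, and on the vectors u_j with
  e_j < 2^(E[log e] + delta), spanning a projection Q. The test Q P Q has the required errors.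
*)
theory Submission
  imports Defs
begin

subsection \<open>The spectral theorem\<close>

text \<open>Optimal strategies of different lengths may use different input states, and a longer
  strategy has to use tensor powers of a single state. Superadditivity is therefore used with the
  input state held fixed, and the supremum over input states is taken only after each single rate
  has been compared with the limit inferior.

  What is passed through parallel composition is not the relative entropy but the pair
  \<open>m\<close>, \<open>V\<close> of \<open>pair_data\<close>. This pair is finite even when the
  relative entropy is infinite, and it adds exactly under tensor products. Since \<open>V\<close>
  grows linearly in the length n, the deviation delta may be taken proportional to n with a small
  factor; Chebyshev's bound then decays like 1/n, while the exponent per copy loses only that small
  factor.

  Two encodings shape the rest. The label sets of composed systems are products only up to
  bijections of lists and numbers, so tensor products are taken up to relabelling. Complete
  positivity is stated for references \<open>{..<k}\<close> only, so positivity with other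
  references, and positivity of composed channels, goes through Choi matrices and Schur
  products.\<close>

definition ip :: "'i set \<Rightarrow> ('i \<Rightarrow> complex) \<Rightarrow> ('i \<Rightarrow> complex) \<Rightarrow> complex" where
  "ip I x y = (\<Sum>i\<in>I. cnj (x i) * y i)"

definition orthonormal_on :: "'i set \<Rightarrow> 'k set \<Rightarrow> ('k \<Rightarrow> 'i \<Rightarrow> complex) \<Rightarrow> bool" where
  "orthonormal_on I K v \<longleftrightarrow> (\<forall>k\<in>K. \<forall>l\<in>K. ip I (v k) (v l) = (if k = l then 1 else 0))"

lemma ip_add_right: "ip I x (\<lambda>i. y i + z i) = ip I x y + ip I x z"
  by (simp add: ip_def algebra_simps sum.distrib)

lemma ip_diff_right: "ip I x (\<lambda>i. y i - z i) = ip I x y - ip I x z"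
  by (simp add: ip_def algebra_simps sum_subtractf)

lemma ip_scale_right: "ip I x (\<lambda>i. c * y i) = c * ip I x y"
  by (simp add: ip_def sum_distrib_left mult_ac)

lemma ip_sum_right: "ip I x (\<lambda>i. \<Sum>k\<in>K. c k * v k i) = (\<Sum>k\<in>K. c k * ip I x (v k))"
  unfolding ip_def sum_distrib_left by (subst sum.swap) (simp add: mult_ac)

lemma cnj_ip: "cnj (ip I x y) = ip I y x"
  by (simp add: ip_def mult.commute)

lemma ip_add_left: "ip I (\<lambda>i. y i + z i) x = ip I y x + ip I z x"
  by (simp add: ip_def algebra_simps sum.distrib)

lemma ip_scale_left: "ip I (\<lambda>i. c * y i) x = cnj c * ip I y x"
  by (simp add: ip_def sum_distrib_left mult_ac)

lemma ip_sum_left: "ip I (\<lambda>i. \<Sum>k\<in>K. c k * v k i) x = (\<Sum>k\<in>K. cnj (c k) * ip I (v k) x)"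
  unfolding ip_def cnj_sum sum_distrib_left sum_distrib_right
  by (subst sum.swap) (simp add: mult_ac)

lemma cnj_mult_self: "cnj z * z = of_real ((cmod z)\<^sup>2)"
  by (metis complex_norm_square mult.commute)

lemma ip_self: "ip I x x = of_real (\<Sum>i\<in>I. (cmod (x i))\<^sup>2)"
  by (simp add: ip_def cnj_mult_self)

lemma ip_self_nonneg: "0 \<le> Re (ip I x x)"
  by (simp add: ip_self sum_nonneg)

lemma ip_self_eq_0: "finite I \<Longrightarrow> Re (ip I x x) = 0 \<Longrightarrow> i \<in> I \<Longrightarrow> x i = 0"
  by (simp add: ip_self sum_nonneg_eq_0_iff)

lemma ip_delta_right: "finite I \<Longrightarrow> j \<in> I \<Longrightarrow> ip I x (\<lambda>i. if i = j then 1 else 0) = cnj (x j)"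
  by (simp add: ip_def if_distrib cong: if_cong)

text \<open>\<open>r\<close> is what remains of the standard basis vector at \<open>j\<close> after
  subtracting its projection onto the span of the \<open>v k\<close>. Summed over \<open>j\<close>,
  the squared norms of these residuals give \<open>card I - card K\<close>; this count yields both
  the extension and the completeness of orthonormal systems.\<close>

lemma residual:
  assumes I: "finite I" and K: "finite K" and on: "orthonormal_on I K v" and j: "j \<in> I"
  defines "r \<equiv> \<lambda>i. (if i = j then 1 else 0) - (\<Sum>k\<in>K. cnj (v k j) * v k i)"
  shows "\<And>k. k \<in> K \<Longrightarrow> ip I (v k) r = 0"
    and "ip I r r = of_real (1 - (\<Sum>k\<in>K. (cmod (v k j))\<^sup>2))"
proof -
  show o: "ip I (v k) r = 0" if k: "k \<in> K" for k
  proof -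
    have "(\<Sum>l\<in>K. cnj (v l j) * ip I (v k) (v l)) = (\<Sum>l\<in>K. if l = k then cnj (v l j) else 0)"
      using on k by (intro sum.cong) (auto simp: orthonormal_on_def)
    also have "\<dots> = cnj (v k j)" using K k by simp
    finally show ?thesis
      unfolding r_def ip_diff_right ip_sum_right ip_delta_right[OF I j] by simp
  qed
  have "ip I r r = ip I r (\<lambda>i. if i = j then 1 else 0) - (\<Sum>k\<in>K. cnj (v k j) * ip I r (v k))"
    by (subst (2) r_def) (simp only: ip_diff_right ip_sum_right)
  also have "(\<Sum>k\<in>K. cnj (v k j) * ip I r (v k)) = 0"
    using o by (intro sum.neutral) (metis cnj_ip complex_cnj_zero mult_zero_right)
  also have "ip I r (\<lambda>i. if i = j then 1 else 0) = cnj (r j)"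
    by (rule ip_delta_right[OF I j])
  also have "cnj (r j) = of_real (1 - (\<Sum>k\<in>K. (cmod (v k j))\<^sup>2))"
    unfolding r_def by (simp add: cnj_mult_self mult.commute[of "v _ _"])
  finally show "ip I r r = of_real (1 - (\<Sum>k\<in>K. (cmod (v k j))\<^sup>2))" by simp
qed

lemma orthonormal_on_sum:
  assumes "orthonormal_on I K v"
  shows "(\<Sum>j\<in>I. \<Sum>k\<in>K. (cmod (v k j))\<^sup>2) = card K"
proof -
  have "(\<Sum>j\<in>I. (cmod (v k j))\<^sup>2) = 1" if "k \<in> K" for k
  proof -
    have "complex_of_real (\<Sum>j\<in>I. (cmod (v k j))\<^sup>2) = of_real 1"
      using assms that unfolding ip_self[symmetric] by (simp add: orthonormal_on_def)
    then show ?thesis using of_real_eq_iff by blast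
  qed
  then show ?thesis by (subst sum.swap) simp
qed

text \<open>The residual norms have a positive sum, so some residual is nonzero. Normalised and cut
  off outside \<open>I\<close>, it is the new vector.\<close>

lemma orthonormal_extend:
  assumes I: "finite I" and K: "finite K" and on: "orthonormal_on I K v" and lt: "card K < card I"
  obtains x where "\<And>i. i \<notin> I \<Longrightarrow> x i = 0" "ip I x x = 1" "\<And>k. k \<in> K \<Longrightarrow> ip I (v k) x = 0"
proof -
  have "(\<Sum>j\<in>I. 1 - (\<Sum>k\<in>K. (cmod (v k j))\<^sup>2)) > 0"
    using lt by (simp add: sum_subtractf orthonormal_on_sum[OF on])
  then obtain j where j: "j \<in> I" "1 - (\<Sum>k\<in>K. (cmod (v k j))\<^sup>2) > 0"
    by (meson not_less sum_nonpos)
  define s where "s = 1 - (\<Sum>k\<in>K. (cmod (v k j))\<^sup>2)"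
  define r where "r = (\<lambda>i. (if i = j then 1 else 0) - (\<Sum>k\<in>K. cnj (v k j) * v k i))"
  define x where "x = (\<lambda>i. if i \<in> I then of_real (1 / sqrt s) * r i else 0)"
  have s: "s > 0" using j by (simp add: s_def)
  have x: "ip I y x = of_real (1 / sqrt s) * ip I y r" "ip I x y = of_real (1 / sqrt s) * ip I r y" for y
    by (simp_all add: ip_def x_def sum_distrib_left mult_ac)
  have "ip I x x = of_real (1 / sqrt s) * (of_real (1 / sqrt s) * ip I r r)"
    by (simp only: x)
  also have "ip I r r = of_real s"
    unfolding r_def s_def by (rule residual(2)[OF I K on j(1)])
  also have "of_real (1 / sqrt s) * (of_real (1 / sqrt s) * of_real s) = (of_real (1/sqrt s * (1/sqrt s * s)) :: complex)"
    by (simp only: of_real_mult)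
  also have "1/sqrt s * (1/sqrt s * s) = 1" using s by (simp add: field_simps)
  finally have "ip I x x = 1" by simp
  moreover have "ip I (v k) x = 0" if "k \<in> K" for k
    unfolding x r_def using residual(1)[OF I K on j(1) that] by simp
  moreover have "x i = 0" if "i \<notin> I" for i using that by (simp add: x_def)
  ultimately show ?thesis using that by blast
qed

text \<open>With equal cardinalities the nonnegative residual norms sum to zero, so each residual
  vanishes on \<open>I\<close>. This is the resolution of the identity.\<close>

lemma orthonormal_complete:
  assumes I: "finite I" and K: "finite K" and on: "orthonormal_on I K v" and eq: "card K = card I"
    and i: "i \<in> I" and j: "j \<in> I"
  shows "(\<Sum>k\<in>K. v k i * cnj (v k j)) = (if i = j then 1 else 0)"
proof -
  have nn: "0 \<le> 1 - (\<Sum>k\<in>K. (cmod (v k j))\<^sup>2)" if "j \<in> I" for j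
    using ip_self_nonneg[of I "\<lambda>i. (if i = j then 1 else 0) - (\<Sum>k\<in>K. cnj (v k j) * v k i)"]
    by (simp only: residual(2)[OF I K on that] Re_complex_of_real)
  have "(\<Sum>j\<in>I. 1 - (\<Sum>k\<in>K. (cmod (v k j))\<^sup>2)) = 0"
    using eq by (simp add: sum_subtractf orthonormal_on_sum[OF on])
  then have z: "1 - (\<Sum>k\<in>K. (cmod (v k j))\<^sup>2) = 0"
    using nn j I by (subst (asm) sum_nonneg_eq_0_iff) auto
  have "(if i = j then 1 else 0) - (\<Sum>k\<in>K. cnj (v k j) * v k i) = 0"
    using arg_cong[OF residual(2)[OF I K on j], of Re] unfolding Re_complex_of_real z
    by (rule ip_self_eq_0[OF I _ i])
  then show ?thesis by (simp add: mult.commute)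
qed

text \<open>Positivity of the quadratic form alone: unlike \<open>psd\<close> it says nothing about entries outside
  \<open>I\<close>, so it passes to pullbacks.\<close>

definition pd :: "'i set \<Rightarrow> 'i oper \<Rightarrow> bool" where
  "pd I X \<longleftrightarrow> (\<forall>v. (\<Sum>i\<in>I. \<Sum>j\<in>I. cnj (v i) * X i j * v j) \<in> \<real>\<^sub>\<ge>\<^sub>0)"

lemma pdD: "pd I X \<Longrightarrow> (\<Sum>i\<in>I. \<Sum>j\<in>I. cnj (v i) * X i j * v j) \<in> \<real>\<^sub>\<ge>\<^sub>0"
  by (simp add: pd_def)

lemma psd_pd: "psd I X \<longleftrightarrow> X \<in> opers I \<and> pd I X"
  by (simp add: psd_def pd_def)

lemma pd_cong: "(\<And>i j. i \<in> I \<Longrightarrow> j \<in> I \<Longrightarrow> X i j = Y i j) \<Longrightarrow> pd I X \<Longrightarrow> pd I Y"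
  by (simp add: pd_def)

text \<open>A quadratic form with real values is Hermitian. On vectors supported on \<open>i\<close>
  and \<open>j\<close>, the coefficients (1, 1) compare the imaginary parts of the two off-diagonal
  entries and (1, i) their real parts.\<close>

lemma pd_herm:
  assumes I: "finite I" and pd: "pd I X" and i: "i \<in> I" and j: "j \<in> I"
  shows "X j i = cnj (X i j)"
proof (cases "i = j")
  case True
  have "(\<Sum>k\<in>I. \<Sum>l\<in>I. cnj (if k = i then 1 else 0) * X k l * (if l = i then 1 else 0)) = X i i"
    using I i by (simp add: if_distrib[of cnj] if_distrib[of "\<lambda>x. x * _"] if_distrib[of "\<lambda>x. _ * x"] cong: if_cong)
  then have "X i i \<in> \<real>\<^sub>\<ge>\<^sub>0" using pdD[OF pd, of "\<lambda>k. if k = i then 1 else 0"] by simp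
  then show ?thesis using True by (auto simp: complex_eq_iff complex_nonneg_Reals_iff)
next
  case False
  have q: "cnj a * X i i * a + cnj b * X j j * b + cnj a * X i j * b + cnj b * X j i * a \<in> \<real>\<^sub>\<ge>\<^sub>0" for a b
  proof -
    define v where "v = (\<lambda>k. if k = i then a else if k = j then b else 0)"
    have "(\<Sum>k\<in>I. \<Sum>l\<in>I. cnj (v k) * X k l * v l) = (\<Sum>k\<in>{i,j}. \<Sum>l\<in>{i,j}. cnj (v k) * X k l * v l)"
    proof (rule sum.mono_neutral_cong_right)
      fix k assume "k \<in> {i,j}"
      show "(\<Sum>l\<in>I. cnj (v k) * X k l * v l) = (\<Sum>l\<in>{i,j}. cnj (v k) * X k l * v l)"
        using I i j by (intro sum.mono_neutral_right) (auto simp: v_def)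
    qed (use I i j in \<open>auto simp: v_def\<close>)
    also have "\<dots> = cnj a * X i i * a + cnj b * X j j * b + cnj a * X i j * b + cnj b * X j i * a"
      using False by (simp add: v_def)
    finally show ?thesis using pdD[OF pd, of v] by simp
  qed
  have "Im (X i i) = 0" "Im (X j j) = 0"
    using q[of 1 0] q[of 0 1] by (auto simp: complex_nonneg_Reals_iff)
  then show ?thesis
    using q[of 1 1] q[of 1 \<i>] by (auto simp: complex_eq_iff complex_nonneg_Reals_iff)
qed

section \<open>Rayleigh quotients and eigenvectors\<close>

definition ap :: "'i set \<Rightarrow> 'i oper \<Rightarrow> ('i \<Rightarrow> complex) \<Rightarrow> 'i \<Rightarrow> complex" where
  "ap I X x = (\<lambda>i. if i \<in> I then \<Sum>j\<in>I. X i j * x j else 0)"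

lemma ip_ap: "ip I x (ap I X y) = (\<Sum>i\<in>I. \<Sum>j\<in>I. cnj (x i) * X i j * y j)"
  by (simp add: ip_def ap_def sum_distrib_left mult_ac)

lemma ip_ap_herm:
  assumes "\<And>i j. i \<in> I \<Longrightarrow> j \<in> I \<Longrightarrow> X j i = cnj (X i j)"
  shows "ip I (ap I X x) y = ip I x (ap I X y)"
proof -
  have "ip I (ap I X x) y = (\<Sum>i\<in>I. \<Sum>j\<in>I. X j i * cnj (x j) * y i)"
    by (simp add: ip_def ap_def sum_distrib_right sum_distrib_left flip: assms cong: sum.cong)
  also have "\<dots> = ip I x (ap I X y)" unfolding ip_ap by (subst sum.swap) (simp add: mult_ac)
  finally show ?thesis .
qed

lemma ap_add: "ap I X (\<lambda>i. x i + c * y i) = (\<lambda>i. ap I X x i + c * ap I X y i)"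
  by (auto simp: ap_def fun_eq_iff algebra_simps sum.distrib sum_distrib_left)

lemma ap_scale: "ap I X (\<lambda>i. c * x i) = (\<lambda>i. c * ap I X x i)"
  by (auto simp: ap_def fun_eq_iff sum_distrib_left mult_ac)

text \<open>Vectors are functions on a whole type, so compactness refers to the product topology and
  comes from Tychonoff's theorem. Pinning the coordinates outside \<open>I\<close> to 0 makes every
  factor compact.\<close>

lemma compact_unit_box:
  "compact {x :: 'i \<Rightarrow> complex. \<forall>i. if i \<in> I then cmod (x i) \<le> 1 else x i = 0}"
proof -
  have "compactin (product_topology (\<lambda>i::'i. euclidean) UNIV)
      (PiE UNIV (\<lambda>i. if i \<in> I then cball (0::complex) 1 else {0}))"
    by (subst compactin_PiE) (auto simp: compactin_euclidean_iff)
  moreover have "PiE UNIV (\<lambda>i. if i \<in> I then cball (0::complex) 1 else {0}) =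
      {x :: 'i \<Rightarrow> complex. \<forall>i. if i \<in> I then cmod (x i) \<le> 1 else x i = 0}"
    by (force simp: PiE_def Pi_def split: if_splits)
  ultimately show ?thesis by (simp add: euclidean_product_topology flip: compactin_euclidean_iff)
qed

lemma continuous_on_ip: "continuous_on UNIV (\<lambda>x. ip I v x)"
  unfolding ip_def by (intro continuous_intros continuous_on_product_coordinates)

lemma continuous_on_quadratic_form:
  "continuous_on UNIV (\<lambda>x. Re (\<Sum>i\<in>I. \<Sum>j\<in>I. cnj (x i) * X i j * x j))"
  by (intro continuous_intros continuous_on_cnj continuous_on_product_coordinates)

text \<open>A maximiser of the Rayleigh quotient on the orthogonal complement of the eigenvectors found so
  far is again an eigenvector.\<close>

lemma eigenvector_extend:
  assumes I: "finite I" and K: "finite K" and on: "orthonormal_on I K v" and lt: "card K < card I"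
    and herm: "\<And>i j. i \<in> I \<Longrightarrow> j \<in> I \<Longrightarrow> X j i = cnj (X i j)"
    and eig: "\<And>k. k \<in> K \<Longrightarrow> ap I X (v k) = (\<lambda>i. complex_of_real (d k) * v k i)"
  obtains x c where "\<And>i. i \<notin> I \<Longrightarrow> x i = 0" "ip I x x = 1" "\<And>k. k \<in> K \<Longrightarrow> ip I (v k) x = 0"
    "ap I X x = (\<lambda>i. complex_of_real c * x i)"
proof -
  \<comment> \<open>The unit sphere in the orthogonal complement of the \<open>v k\<close>. The box
    provides a compact set in which the other conditions are closed, and the norm is written as the
    form of \<open>id_op I\<close> so that one continuity lemma serves both the norm and
    \<open>f\<close>.\<close>
  define W where "W = {x. (\<forall>i. if i \<in> I then cmod (x i) \<le> 1 else x i = 0)} \<inter>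
     ({x. Re (\<Sum>i\<in>I. \<Sum>j\<in>I. cnj (x i) * id_op I i j * x j) = 1} \<inter> (\<Inter>k\<in>K. {x. ip I (v k) x = 0}))"
  define f where "f x = Re (ip I x (ap I X x))" for x
  have id: "(\<Sum>i\<in>I. \<Sum>j\<in>I. cnj (x i) * id_op I i j * x j) = ip I x x" for x
    using I by (simp add: ip_def id_op_def if_distrib[of "\<lambda>x. x * _"] if_distrib[of "\<lambda>x. _ * x"] cong: if_cong)
  have WI: "x \<in> W" if "\<And>i. i \<notin> I \<Longrightarrow> x i = 0" "Re (ip I x x) = 1" "\<And>k. k \<in> K \<Longrightarrow> ip I (v k) x = 0" for x
  proof -
    have "(cmod (x i))\<^sup>2 \<le> 1" if "i \<in> I" for i
    proof -
      have "(cmod (x i))\<^sup>2 \<le> (\<Sum>i\<in>I. (cmod (x i))\<^sup>2)" using I that by (intro member_le_sum) auto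
      also have "\<dots> = 1" using \<open>Re (ip I x x) = 1\<close> by (simp add: ip_self)
      finally show ?thesis .
    qed
    then have "cmod (x i) \<le> 1" if "i \<in> I" for i using that by (simp add: abs_square_le_1)
    then show ?thesis using that by (simp add: W_def id)
  qed
  have cW: "compact W" unfolding W_def
  proof (rule compact_Int_closed[OF compact_unit_box], rule closed_Int)
    show "closed {x. Re (\<Sum>i\<in>I. \<Sum>j\<in>I. cnj (x i) * id_op I i j * x j) = 1}"
      by (intro closed_Collect_eq continuous_on_quadratic_form continuous_intros)
    show "closed (\<Inter>k\<in>K. {x. ip I (v k) x = 0})"
      by (intro closed_INT ballI closed_Collect_eq continuous_on_ip continuous_intros)
  qed
  have ne: "W \<noteq> {}"
  proof -
    obtain x where "\<And>i. i \<notin> I \<Longrightarrow> x i = 0" "ip I x x = 1" "\<And>k. k \<in> K \<Longrightarrow> ip I (v k) x = 0"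
      using orthonormal_extend[OF I K on lt] by blast
    then have "x \<in> W" by (intro WI) auto
    then show ?thesis by blast
  qed
  have "continuous_on W f"
    unfolding f_def ip_ap using continuous_on_quadratic_form continuous_on_subset by blast
  then obtain x where x: "x \<in> W" and mx: "\<And>y. y \<in> W \<Longrightarrow> f y \<le> f x"
    using continuous_attains_sup[OF cW ne] by blast
  have x0: "x i = 0" if "i \<notin> I" for i using x that by (auto simp: W_def)
  have x1: "Re (ip I x x) = 1" using x by (simp add: W_def id)
  then have x1': "ip I x x = 1" by (simp add: ip_self)
  have xv: "ip I (v k) x = 0" if "k \<in> K" for k using x that by (auto simp: W_def)
  define c where "c = f x"
  \<comment> \<open>The part of \<open>X x\<close> orthogonal to \<open>x\<close>, because
    \<open>c\<close> is the Rayleigh quotient of \<open>x\<close>. It is also orthogonal to every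
    \<open>v k\<close>, so moving \<open>x\<close> in the direction \<open>y\<close> and
    renormalising stays inside \<open>W\<close>.\<close>
  define y where "y = (\<lambda>i. ap I X x i - complex_of_real c * x i)"
  have y0: "y i = 0" if "i \<notin> I" for i using that by (simp add: y_def ap_def x0)
  have "cnj (ip I x (ap I X x)) = ip I x (ap I X x)"
    by (simp add: cnj_ip ip_ap_herm[OF herm])
  then have fx: "ip I x (ap I X x) = of_real c"
    by (simp add: c_def f_def complex_eq_iff)
  have xy: "ip I x y = 0" unfolding y_def ip_diff_right ip_scale_right fx x1' by simp
  then have yx: "ip I y x = 0" by (metis cnj_ip complex_cnj_zero)
  have yv: "ip I (v k) y = 0" if "k \<in> K" for k
  proof -
    have "ip I (v k) (ap I X x) = ip I (ap I X (v k)) x" by (simp add: ip_ap_herm[OF herm])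
    also have "\<dots> = 0" unfolding eig[OF that] ip_scale_left xv[OF that] by simp
    finally show ?thesis unfolding y_def ip_diff_right ip_scale_right xv[OF that] by simp
  qed
  define s where "s = Re (ip I y y)"
  have s0: "s \<ge> 0" by (simp add: s_def ip_self_nonneg)
  have ys: "ip I y y = of_real s" by (simp add: s_def ip_self)
  have yXx: "ip I y (ap I X x) = of_real s"
  proof -
    have "ip I y y = ip I y (ap I X x) - of_real c * ip I y x"
      by (subst (2) y_def) (simp only: ip_diff_right ip_scale_right)
    then show ?thesis using yx ys by simp
  qed
  have xXy: "ip I x (ap I X y) = of_real s"
  proof -
    have "ip I x (ap I X y) = cnj (ip I y (ap I X x))"
      unfolding cnj_ip by (simp add: ip_ap_herm[OF herm])
    then show ?thesis using yXx by simp
  qed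
  \<comment> \<open>Maximality of \<open>f x = c\<close> against the normalised vector
    \<open>x + t y\<close> reads \<open>c + 2 t s + t^2 f y \<le> c (1 + t^2 s)\<close>. Small
    \<open>t\<close> then forces \<open>s\<close>, the squared norm of \<open>y\<close>, to
    vanish.\<close>
  have key: "2 * s \<le> t * (c * s - f y)" if t: "t > 0" for t
  proof -
    define z where "z = (\<lambda>i. x i + complex_of_real t * y i)"
    define n where "n = 1 + t\<^sup>2 * s"
    have n: "n > 0" unfolding n_def using s0 by (simp add: add_pos_nonneg)
    have zz: "ip I z z = of_real n"
      unfolding z_def n_def ip_add_right ip_add_left ip_scale_right ip_scale_left xy yx ys x1'
      by (simp add: power2_eq_square)
    have fz: "f z = c + 2 * t * s + t\<^sup>2 * f y"
      unfolding f_def z_def ap_add ip_add_right ip_add_left ip_scale_right ip_scale_left yXx xXy fx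
      by (simp add: power2_eq_square algebra_simps)
    define w where "w = (\<lambda>i. complex_of_real (1 / sqrt n) * z i)"
    have a: "ap I X w = (\<lambda>i. complex_of_real (1 / sqrt n) * ap I X z i)"
      unfolding w_def by (rule ap_scale)
    have sq: "1 / sqrt n * (1 / sqrt n * r) = r / n" for r using n by (simp add: field_simps)
    have "w \<in> W"
    proof (rule WI)
      show "w i = 0" if "i \<notin> I" for i by (simp add: w_def z_def x0[OF that] y0[OF that])
      have "ip I w w = of_real (1 / sqrt n * (1 / sqrt n * n))"
        unfolding w_def ip_scale_right ip_scale_left zz complex_cnj_complex_of_real of_real_mult by simp
      then show "Re (ip I w w) = 1" unfolding sq using n by simp
      show "ip I (v k) w = 0" if "k \<in> K" for k
        unfolding w_def ip_scale_right z_def ip_add_right xv[OF that] yv[OF that] by simp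
    qed
    then have "f w \<le> c" using mx c_def by simp
    moreover have "f w = f z / n"
    proof -
      have "f w = 1 / sqrt n * (1 / sqrt n * f z)"
        unfolding f_def a unfolding w_def ip_scale_right ip_scale_left by simp
      then show ?thesis unfolding sq .
    qed
    ultimately have "f z \<le> c * n" using n by (simp add: field_simps)
    then have "t * (2 * s) \<le> t * (t * (c * s - f y))" unfolding fz n_def by (simp add: algebra_simps power2_eq_square)
    then show ?thesis using t by simp
  qed
  have "s = 0"
  proof (rule ccontr)
    assume "s \<noteq> 0"
    then have s: "s > 0" using s0 by simp
    \<comment> \<open>Positive and larger than the coefficient in \<open>key\<close>, so that
      \<open>t = s / e\<close> yields \<open>2 s \<le> s\<close>.\<close>
    define e where "e = \<bar>c * s - f y\<bar> + 1"
    have e: "e > 0" by (simp add: e_def)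
    have "2 * s \<le> s / e * (c * s - f y)" by (rule key) (use s e in simp)
    also have "\<dots> \<le> s / e * e" using s e by (intro mult_left_mono) (auto simp: e_def)
    also have "\<dots> = s" using e by simp
    finally show False using s by simp
  qed
  then have "y i = 0" for i using ip_self_eq_0[OF I, of y i] y0[of i] by (auto simp: s_def)
  then have "ap I X x = (\<lambda>i. of_real c * x i)" by (auto simp: y_def fun_eq_iff)
  then show ?thesis using that[of x c] x0 x1' xv by blast
qed

lemma orthonormal_basis_iff:
  "orthonormal_basis I v \<longleftrightarrow> (\<forall>k\<in>I. \<forall>i. i \<notin> I \<longrightarrow> v k i = 0) \<and> orthonormal_on I I v"
  by (simp add: orthonormal_basis_def orthonormal_on_def ip_def)

text \<open>Induction over the set \<open>K\<close> of labels that already number an eigenvector;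
  each further label receives the vector from \<open>eigenvector_extend\<close>. When all labels are
  used, completeness reassembles \<open>X\<close>.\<close>

lemma spectral_theorem:
  assumes I: "finite I" and X: "X \<in> opers I"
    and herm: "\<And>i j. i \<in> I \<Longrightarrow> j \<in> I \<Longrightarrow> X j i = cnj (X i j)"
  obtains d v where "orthonormal_basis I v" "X = spectral_op I d v"
proof -
  have "\<exists>v d. (\<forall>k\<in>K. \<forall>i. i \<notin> I \<longrightarrow> v k i = 0) \<and> orthonormal_on I K v \<and>
      (\<forall>k\<in>K. ap I X (v k) = (\<lambda>i. complex_of_real (d k) * v k i))" if "K \<subseteq> I" for K
    using finite_subset[OF that I] that
  proof (induction K)
    case empty
    then show ?case by (simp add: orthonormal_on_def)
  next
    case (insert a K)
    then obtain v d where v: "\<forall>k\<in>K. \<forall>i. i \<notin> I \<longrightarrow> v k i = 0" "orthonormal_on I K v"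
      "\<And>k. k \<in> K \<Longrightarrow> ap I X (v k) = (\<lambda>i. complex_of_real (d k) * v k i)" by auto
    have "card K < card I" using insert I by (intro psubset_card_mono) auto
    then obtain x c where x: "\<And>i. i \<notin> I \<Longrightarrow> x i = 0" "ip I x x = 1" "\<And>k. k \<in> K \<Longrightarrow> ip I (v k) x = 0"
      "ap I X x = (\<lambda>i. complex_of_real c * x i)"
      using eigenvector_extend[OF I insert(1) v(2) _ herm v(3)] by blast
    have x': "ip I x (v k) = 0" if "k \<in> K" for k using x(3)[OF that] by (metis cnj_ip complex_cnj_zero)
    show ?case
      using v x x' insert(2)
      by (intro exI[of _ "v(a := x)"] exI[of _ "d(a := c)"]) (auto simp: orthonormal_on_def)
  qed
  from this[of I] obtain v d where v: "\<forall>k\<in>I. \<forall>i. i \<notin> I \<longrightarrow> v k i = 0" "orthonormal_on I I v"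
      "\<And>k. k \<in> I \<Longrightarrow> ap I X (v k) = (\<lambda>i. complex_of_real (d k) * v k i)" by auto
  have "X i j = spectral_op I d v i j" for i j
  proof (cases "i \<in> I \<and> j \<in> I")
    case True
    have "spectral_op I d v i j = (\<Sum>k\<in>I. ap I X (v k) i * cnj (v k j))"
      using v(3) by (simp add: spectral_op_def)
    also have "\<dots> = (\<Sum>l\<in>I. X i l * (\<Sum>k\<in>I. v k l * cnj (v k j)))"
      using True by (simp add: ap_def sum_distrib_left sum_distrib_right mult_ac) (rule sum.swap)
    also have "\<dots> = (\<Sum>l\<in>I. if l = j then X i l else 0)"
      using orthonormal_complete[OF I I v(2)] True by (intro sum.cong) auto
    also have "\<dots> = X i j" using I True by simp
    finally show ?thesis by simp
  next
    case False
    then have "spectral_op I d v i j = 0" using v(1) by (auto simp: spectral_op_def intro!: sum.neutral)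
    moreover have "X i j = 0" using X False by (auto simp: opers_def)
    ultimately show ?thesis by simp
  qed
  then have "X = spectral_op I d v" by blast
  then show ?thesis using that v by (auto simp: orthonormal_basis_iff)
qed

section \<open>Expansions in an orthonormal basis and well-definedness of the functional
  calculus\<close>

lemma onb_vanish: "orthonormal_basis I v \<Longrightarrow> k \<in> I \<Longrightarrow> i \<notin> I \<Longrightarrow> v k i = 0"
  by (simp add: orthonormal_basis_def)

lemma onb_ip: "orthonormal_basis I v \<Longrightarrow> k \<in> I \<Longrightarrow> l \<in> I \<Longrightarrow> ip I (v k) (v l) = (if k = l then 1 else 0)"
  by (simp add: orthonormal_basis_def ip_def)

lemma onb_complete:
  assumes "finite I" "orthonormal_basis I v" "i \<in> I" "j \<in> I"
  shows "(\<Sum>k\<in>I. v k i * cnj (v k j)) = (if i = j then 1 else 0)"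
  using assms by (intro orthonormal_complete) (auto simp: orthonormal_basis_iff)

lemma onb_expand:
  assumes I: "finite I" and on: "orthonormal_basis I v" and y: "\<And>i. i \<notin> I \<Longrightarrow> y i = 0"
  shows "(\<Sum>k\<in>I. ip I (v k) y * v k i) = y i"
proof (cases "i \<in> I")
  case True
  have "(\<Sum>k\<in>I. ip I (v k) y * v k i) = (\<Sum>j\<in>I. y j * (\<Sum>k\<in>I. v k i * cnj (v k j)))"
    unfolding ip_def sum_distrib_left sum_distrib_right by (subst sum.swap) (simp add: mult_ac)
  also have "\<dots> = (\<Sum>j\<in>I. if j = i then y j else 0)"
    using onb_complete[OF I on] True by (intro sum.cong) auto
  also have "\<dots> = y i" using I True by simp
  finally show ?thesis .
next
  case False
  then show ?thesis using y onb_vanish[OF on] by simp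
qed

lemma parseval:
  assumes I: "finite I" and on: "orthonormal_basis I v"
  shows "(\<Sum>k\<in>I. ip I x (v k) * ip I (v k) y) = ip I x y"
proof -
  define z where "z = (\<lambda>i. if i \<in> I then y i else 0)"
  have z: "ip I w z = ip I w y" for w by (simp add: ip_def z_def)
  have "ip I x z = ip I x (\<lambda>i. \<Sum>k\<in>I. ip I (v k) z * v k i)"
    using onb_expand[OF I on, of z] by (simp add: z_def)
  also have "\<dots> = (\<Sum>k\<in>I. ip I x (v k) * ip I (v k) z)" unfolding ip_sum_right by (simp add: mult_ac)
  finally show ?thesis unfolding z by simp
qed

lemma parseval_norm:
  assumes I: "finite I" and on: "orthonormal_basis I v"
  shows "(\<Sum>k\<in>I. (cmod (ip I (v k) x))\<^sup>2) = Re (ip I x x)"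
proof -
  have "ip I x x = (\<Sum>k\<in>I. cnj (ip I (v k) x) * ip I (v k) x)"
    unfolding cnj_ip by (rule parseval[OF I on, symmetric])
  then have "ip I x x = of_real (\<Sum>k\<in>I. (cmod (ip I (v k) x))\<^sup>2)" by (simp add: cnj_mult_self)
  then show ?thesis by simp
qed

lemma ip_ap_sum:
  assumes "finite K" and "\<And>i j. i \<in> I \<Longrightarrow> j \<in> I \<Longrightarrow> X i j = (\<Sum>k\<in>K. c k * v k i * cnj (v k j))"
  shows "ip I x (ap I X y) = (\<Sum>k\<in>K. c k * ip I x (v k) * ip I (v k) y)"
proof -
  have "ip I x (ap I X y) = (\<Sum>i\<in>I. \<Sum>j\<in>I. \<Sum>k\<in>K. cnj (x i) * (c k * v k i * cnj (v k j)) * y j)"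
    unfolding ip_ap using assms by (simp add: sum_distrib_left sum_distrib_right)
  also have "\<dots> = (\<Sum>k\<in>K. \<Sum>i\<in>I. \<Sum>j\<in>I. cnj (x i) * (c k * v k i * cnj (v k j)) * y j)"
    by (subst sum.swap[of _ K I]) (subst sum.swap[of _ I K], simp)
  also have "\<dots> = (\<Sum>k\<in>K. c k * ip I x (v k) * ip I (v k) y)"
    unfolding ip_def by (simp add: sum_product sum_distrib_left mult_ac)
  finally show ?thesis .
qed

lemma ip_ap_spectral:
  "finite I \<Longrightarrow> ip I x (ap I (spectral_op I d v) y) = (\<Sum>k\<in>I. of_real (d k) * ip I x (v k) * ip I (v k) y)"
  by (rule ip_ap_sum) (auto simp: spectral_op_def)

lemma ip_eigenvector:
  assumes I: "finite I" and on: "orthonormal_basis I v" and k: "k \<in> I"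
  shows "ip I (v k) (ap I (spectral_op I d v) y) = of_real (d k) * ip I (v k) y"
    and "ip I y (ap I (spectral_op I d v) (v k)) = of_real (d k) * ip I y (v k)"
proof -
  have "ip I (v k) (ap I (spectral_op I d v) y) = (\<Sum>l\<in>I. if l = k then of_real (d k) * ip I (v k) y else 0)"
    unfolding ip_ap_spectral[OF I] using onb_ip[OF on k] by (intro sum.cong) auto
  then show "ip I (v k) (ap I (spectral_op I d v) y) = of_real (d k) * ip I (v k) y" using I k by simp
  have "ip I y (ap I (spectral_op I d v) (v k)) = (\<Sum>l\<in>I. if l = k then of_real (d k) * ip I y (v k) else 0)"
    unfolding ip_ap_spectral[OF I] using onb_ip[OF on _ k] by (intro sum.cong) auto
  then show "ip I y (ap I (spectral_op I d v) (v k)) = of_real (d k) * ip I y (v k)" using I k by simp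
qed

text \<open>The matrix element between \<open>v k\<close> and \<open>v' l\<close>, computed from
  either side, is \<open>d k\<close> or \<open>d' l\<close> times their inner product. So either the
  two vectors are orthogonal or \<open>d k = d' l\<close>, and in both cases the identity survives
  the application of \<open>f\<close>. This justifies the definite description in
  \<open>fun_calc\<close>.\<close>

lemma spectral_op_fun_unique:
  assumes I: "finite I" and on: "orthonormal_basis I v" "orthonormal_basis I v'"
    and eq: "spectral_op I d v = spectral_op I d' v'"
  shows "spectral_op I (\<lambda>k. f (d k)) v = spectral_op I (\<lambda>k. f (d' k)) v'"
proof (intro ext)
  fix i j
  have key: "of_real (f (d k)) * ip I (v k) (v' l) = of_real (f (d' l)) * ip I (v k) (v' l)"
    if "k \<in> I" "l \<in> I" for k l
  proof -
    have "of_real (d k) * ip I (v k) (v' l) = of_real (d' l) * ip I (v k) (v' l)"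
      unfolding ip_eigenvector(1)[OF I on(1) that(1), symmetric] eq
      by (rule ip_eigenvector(2)[OF I on(2) that(2)])
    then show ?thesis by auto
  qed
  have 1: "cnj (v k j) = (\<Sum>l\<in>I. ip I (v k) (v' l) * cnj (v' l j))" if "k \<in> I" for k
    using arg_cong[OF onb_expand[OF I on(2), of "v k" j], of cnj] onb_vanish[OF on(1) that]
    by (simp add: cnj_ip)
  have 2: "v' l i = (\<Sum>k\<in>I. ip I (v k) (v' l) * v k i)" if "l \<in> I" for l
    using onb_expand[OF I on(1), of "v' l" i] onb_vanish[OF on(2) that] by simp
  have "spectral_op I (\<lambda>k. f (d k)) v i j =
      (\<Sum>k\<in>I. \<Sum>l\<in>I. (of_real (f (d k)) * ip I (v k) (v' l)) * v k i * cnj (v' l j))"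
    unfolding spectral_op_def using 1 by (simp add: sum_distrib_left mult_ac)
  also have "\<dots> = (\<Sum>k\<in>I. \<Sum>l\<in>I. (of_real (f (d' l)) * ip I (v k) (v' l)) * v k i * cnj (v' l j))"
    by (intro sum.cong refl) (simp only: key)
  also have "\<dots> = (\<Sum>l\<in>I. \<Sum>k\<in>I. (of_real (f (d' l)) * ip I (v k) (v' l)) * v k i * cnj (v' l j))"
    by (rule sum.swap)
  also have "\<dots> = (\<Sum>l\<in>I. of_real (f (d' l)) * (\<Sum>k\<in>I. ip I (v k) (v' l) * v k i) * cnj (v' l j))"
    by (simp add: sum_distrib_left sum_distrib_right mult_ac)
  also have "\<dots> = spectral_op I (\<lambda>k. f (d' k)) v' i j"
    unfolding spectral_op_def using 2 by simp
  finally show "spectral_op I (\<lambda>k. f (d k)) v i j = spectral_op I (\<lambda>k. f (d' k)) v' i j" .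
qed

lemma fun_calc_spectral:
  assumes I: "finite I" and on: "orthonormal_basis I v"
  shows "fun_calc I f (spectral_op I d v) = spectral_op I (\<lambda>k. f (d k)) v"
  unfolding fun_calc_def
proof (rule the_equality)
  show "\<exists>d' v'. orthonormal_basis I v' \<and> spectral_op I d v = spectral_op I d' v' \<and>
      spectral_op I (\<lambda>k. f (d k)) v = spectral_op I (\<lambda>k. f (d' k)) v'" using on by blast
next
  fix Y assume "\<exists>d' v'. orthonormal_basis I v' \<and> spectral_op I d v = spectral_op I d' v' \<and>
      Y = spectral_op I (\<lambda>k. f (d' k)) v'"
  then obtain d' v' where "orthonormal_basis I v'" "spectral_op I d v = spectral_op I d' v'"
      "Y = spectral_op I (\<lambda>k. f (d' k)) v'" by blast
  then show "Y = spectral_op I (\<lambda>k. f (d k)) v" using spectral_op_fun_unique[OF I on, of v' d d' f] by simp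
qed

section \<open>Traces and relative entropy in spectral form\<close>

lemma tr_mult_commute: "tr I (mult_op I X Y) = tr I (mult_op I Y X)"
  unfolding tr_def mult_op_def by (subst sum.swap) (simp add: mult.commute)

lemma tr_mult_spectral:
  "tr I (mult_op I (spectral_op I d v) L) = (\<Sum>k\<in>I. of_real (d k) * ip I (v k) (ap I L (v k)))"
proof -
  have "tr I (mult_op I (spectral_op I d v) L) = (\<Sum>i\<in>I. \<Sum>j\<in>I. \<Sum>k\<in>I. of_real (d k) * (cnj (v k j) * L j i * v k i))"
    by (simp add: tr_def mult_op_def spectral_op_def sum_distrib_right sum_distrib_left mult_ac)
  also have "\<dots> = (\<Sum>i\<in>I. \<Sum>k\<in>I. \<Sum>j\<in>I. of_real (d k) * (cnj (v k j) * L j i * v k i))"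
    by (intro sum.cong refl sum.swap)
  also have "\<dots> = (\<Sum>k\<in>I. \<Sum>i\<in>I. \<Sum>j\<in>I. of_real (d k) * (cnj (v k j) * L j i * v k i))"
    by (rule sum.swap)
  also have "\<dots> = (\<Sum>k\<in>I. \<Sum>j\<in>I. \<Sum>i\<in>I. of_real (d k) * (cnj (v k j) * L j i * v k i))"
    by (intro sum.cong refl sum.swap)
  finally show ?thesis by (simp add: ip_ap sum_distrib_left)
qed

lemma tr_spectral:
  assumes "finite I" "orthonormal_basis I v"
  shows "tr I (spectral_op I d v) = of_real (\<Sum>k\<in>I. d k)"
proof -
  have "tr I (spectral_op I d v) = (\<Sum>k\<in>I. of_real (d k) * ip I (v k) (v k))"
    unfolding tr_def spectral_op_def ip_def sum_distrib_left by (subst sum.swap) (simp add: mult_ac)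
  then show ?thesis using onb_ip[OF assms(2)] by simp
qed

lemma state_spectral:
  assumes I: "finite I" and s: "state I \<rho>"
  obtains d v where "orthonormal_basis I v" "\<rho> = spectral_op I d v" "\<And>k. k \<in> I \<Longrightarrow> 0 \<le> d k" "sum d I = 1"
proof -
  have p: "pd I \<rho>" "\<rho> \<in> opers I" and t: "tr I \<rho> = 1" using s by (auto simp: state_def psd_pd)
  obtain d v where on: "orthonormal_basis I v" and r: "\<rho> = spectral_op I d v"
    using spectral_theorem[OF I p(2)] pd_herm[OF I p(1)] by metis
  have "0 \<le> d k" if k: "k \<in> I" for k
  proof -
    have "ip I (v k) (ap I \<rho> (v k)) = of_real (d k)"
      unfolding r ip_eigenvector(1)[OF I on k] using onb_ip[OF on k k] by simp
    then show ?thesis using pdD[OF p(1), of "v k"] by (simp add: ip_ap)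
  qed
  moreover have "sum d I = 1"
    using t unfolding r tr_spectral[OF I on] by (metis of_real_eq_1_iff)
  ultimately show ?thesis using that on r by blast
qed

text \<open>The diagonal entry <u_j|rho|u_j> of rho = \<open>spectral_op I d v\<close>: the
  probability of outcome \<open>j\<close> when rho is measured in the basis
  \<open>u\<close>.\<close>

definition overlap :: "'i set \<Rightarrow> ('i \<Rightarrow> real) \<Rightarrow> ('i \<Rightarrow> 'i \<Rightarrow> complex) \<Rightarrow> ('i \<Rightarrow> 'i \<Rightarrow> complex) \<Rightarrow> 'i \<Rightarrow> real" where
  "overlap I d v u j = (\<Sum>k\<in>I. d k * (cmod (ip I (u j) (v k)))\<^sup>2)"

lemma overlap_nonneg: "(\<And>k. k \<in> I \<Longrightarrow> 0 \<le> d k) \<Longrightarrow> 0 \<le> overlap I d v u j"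
  by (simp add: overlap_def sum_nonneg)

lemma sum_overlap:
  assumes I: "finite I" and on: "orthonormal_basis I v" "orthonormal_basis I u"
  shows "(\<Sum>j\<in>I. overlap I d v u j) = sum d I"
proof -
  have "(\<Sum>j\<in>I. overlap I d v u j) = (\<Sum>k\<in>I. d k * (\<Sum>j\<in>I. (cmod (ip I (u j) (v k)))\<^sup>2))"
    unfolding overlap_def sum_distrib_left by (rule sum.swap)
  also have "\<dots> = sum d I" unfolding parseval_norm[OF I on(2)] using onb_ip[OF on(1)] by simp
  finally show ?thesis .
qed

lemma kernel_op_spectral:
  assumes I: "finite I" and on: "orthonormal_basis I v"
  shows "w \<in> kernel_op I (spectral_op I d v) \<longleftrightarrow>
    (\<forall>i. i \<notin> I \<longrightarrow> w i = 0) \<and> (\<forall>k\<in>I. of_real (d k) * ip I (v k) w = 0)"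
proof -
  have ap: "(\<Sum>j\<in>I. spectral_op I d v i j * w j) = (\<Sum>k\<in>I. (of_real (d k) * ip I (v k) w) * v k i)" for i
    unfolding spectral_op_def ip_def sum_distrib_left sum_distrib_right
    by (subst sum.swap) (simp add: mult_ac)
  have "of_real (d k) * ip I (v k) w = 0"
    if "\<forall>i\<in>I. (\<Sum>j\<in>I. spectral_op I d v i j * w j) = 0" "k \<in> I" for k
  proof -
    have "ap I (spectral_op I d v) w = (\<lambda>_. 0)" using that by (auto simp: ap_def)
    then show ?thesis using ip_eigenvector(1)[OF I on that(2), of d w] by (simp add: ip_def)
  qed
  then show ?thesis unfolding kernel_op_def ap by (auto simp: ap intro!: sum.neutral)
qed

abbreviation lg :: "real \<Rightarrow> real" where
  "lg x \<equiv> (if x = 0 then 0 else log 2 x)"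

text \<open>Tr(rho log sigma) sees only the diagonal of rho in the eigenbasis \<open>u\<close>,
  which consists of the overlaps. As sums of nonnegative terms, overlaps vanish exactly when
  \<open>u j\<close> is orthogonal to all \<open>v k\<close> with \<open>d k \<noteq> 0\<close>,
  which turns the inclusion of supports into a condition on overlaps.\<close>

lemma rel_entropy_spectral:
  assumes I: "finite I" and on: "orthonormal_basis I v" "orthonormal_basis I u"
    and d: "\<And>k. k \<in> I \<Longrightarrow> 0 \<le> d k"
  shows "rel_entropy I (spectral_op I d v) (spectral_op I e u) =
    (if \<forall>j\<in>I. e j = 0 \<longrightarrow> overlap I d v u j = 0
     then ereal ((\<Sum>k\<in>I. d k * lg (d k)) - (\<Sum>j\<in>I. overlap I d v u j * lg (e j))) else \<infinity>)"
proof -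
  have ov: "overlap I d v u j = 0 \<longleftrightarrow> (\<forall>k\<in>I. d k = 0 \<or> ip I (u j) (v k) = 0)" for j
    unfolding overlap_def using I d by (subst sum_nonneg_eq_0_iff) auto
  have supp: "supp_op I (spectral_op I d v) \<subseteq> supp_op I (spectral_op I e u) \<longleftrightarrow>
      (\<forall>j\<in>I. e j = 0 \<longrightarrow> overlap I d v u j = 0)" (is "?L \<longleftrightarrow> ?R")
  proof
    assume L: ?L
    have "ip I (u j) (v k) = 0" if j: "j \<in> I" "e j = 0" and k: "k \<in> I" "d k \<noteq> 0" for j k
    proof -
      have "ip I w (v k) = 0" if "w \<in> kernel_op I (spectral_op I d v)" for w
      proof -
        have "ip I (v k) w = 0" using that k unfolding kernel_op_spectral[OF I on(1)] by auto
        then show ?thesis by (metis cnj_ip complex_cnj_zero)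
      qed
      then have "v k \<in> supp_op I (spectral_op I d v)"
        using onb_vanish[OF on(1) k(1)] unfolding supp_op_def ip_def by blast
      then have "v k \<in> supp_op I (spectral_op I e u)" using L by blast
      moreover have "u j \<in> kernel_op I (spectral_op I e u)"
        unfolding kernel_op_spectral[OF I on(2)] using onb_vanish[OF on(2) j(1)] onb_ip[OF on(2) _ j(1)] j(2) by auto
      ultimately show ?thesis unfolding supp_op_def ip_def by blast
    qed
    then show ?R unfolding ov by blast
  next
    assume R: ?R
    \<comment> \<open>Supports are orthogonal complements of kernels, so the reversed inclusion of
      kernels suffices.\<close>
    have "kernel_op I (spectral_op I e u) \<subseteq> kernel_op I (spectral_op I d v)"
    proof
      fix w assume w: "w \<in> kernel_op I (spectral_op I e u)"
      have "of_real (d k) * ip I (v k) w = 0" if k: "k \<in> I" for k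
      proof -
        have "of_real (d k) * ip I (v k) w = (\<Sum>j\<in>I. of_real (d k) * (ip I (v k) (u j) * ip I (u j) w))"
          by (simp add: parseval[OF I on(2)] flip: sum_distrib_left)
        also have "\<dots> = 0"
        proof (rule sum.neutral, rule ballI)
          fix j assume j: "j \<in> I"
          show "of_real (d k) * (ip I (v k) (u j) * ip I (u j) w) = 0"
          proof (cases "e j = 0")
            case True
            then have "d k = 0 \<or> ip I (u j) (v k) = 0" using R j k unfolding ov by blast
            then show ?thesis by (metis cnj_ip complex_cnj_zero mult_zero_left mult_zero_right of_real_0)
          next
            case False
            then show ?thesis using w j unfolding kernel_op_spectral[OF I on(2)] by auto
          qed
        qed
        finally show ?thesis .
      qed
      then show "w \<in> kernel_op I (spectral_op I d v)"
        using w unfolding kernel_op_spectral[OF I on(1)] kernel_op_spectral[OF I on(2)] by blast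
    qed
    then show ?L unfolding supp_op_def by blast
  qed
  have "Re (tr I (mult_op I (spectral_op I d v)
      (\<lambda>i j. log_op I (spectral_op I d v) i j - log_op I (spectral_op I e u) i j))) =
      (\<Sum>k\<in>I. d k * lg (d k)) - (\<Sum>j\<in>I. overlap I d v u j * lg (e j))" (is "Re ?t = _")
  proof -
    have L: "log_op I (spectral_op I d v) = spectral_op I (\<lambda>k. lg (d k)) v"
      "log_op I (spectral_op I e u) = spectral_op I (\<lambda>k. lg (e k)) u"
      unfolding log_op_def using fun_calc_spectral[OF I] on by blast+
    have "ip I (v k) (ap I (\<lambda>i j. spectral_op I (\<lambda>k. lg (d k)) v i j - spectral_op I (\<lambda>k. lg (e k)) u i j) (v k))
       = of_real (lg (d k) - (\<Sum>j\<in>I. lg (e j) * (cmod (ip I (u j) (v k)))\<^sup>2))" (is "?l = _") if k: "k \<in> I" for k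
    proof -
      have "?l = ip I (v k) (ap I (spectral_op I (\<lambda>k. lg (d k)) v) (v k)) - ip I (v k) (ap I (spectral_op I (\<lambda>k. lg (e k)) u) (v k))"
        unfolding ip_ap by (simp only: right_diff_distrib left_diff_distrib sum_subtractf)
      also have "ip I (v k) (ap I (spectral_op I (\<lambda>k. lg (d k)) v) (v k)) = of_real (lg (d k))"
        unfolding ip_eigenvector(1)[OF I on(1) k] onb_ip[OF on(1) k k] by simp
      also have "ip I (v k) (ap I (spectral_op I (\<lambda>k. lg (e k)) u) (v k)) =
         (\<Sum>j\<in>I. of_real (lg (e j)) * (cnj (ip I (u j) (v k)) * ip I (u j) (v k)))"
        unfolding ip_ap_spectral[OF I] cnj_ip by (simp only: mult.assoc)
      finally show ?thesis by (simp only: cnj_mult_self of_real_diff of_real_sum of_real_mult)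
    qed
    then have "?t = (\<Sum>k\<in>I. of_real (d k * (lg (d k) - (\<Sum>j\<in>I. lg (e j) * (cmod (ip I (u j) (v k)))\<^sup>2))))"
      unfolding L tr_mult_spectral by (simp only: of_real_mult cong: sum.cong)
    then have "Re ?t = (\<Sum>k\<in>I. d k * (lg (d k) - (\<Sum>j\<in>I. lg (e j) * (cmod (ip I (u j) (v k)))\<^sup>2)))"
      by (simp only: Re_complex_of_real flip: of_real_sum)
    also have "\<dots> = (\<Sum>k\<in>I. d k * lg (d k)) - (\<Sum>k\<in>I. \<Sum>j\<in>I. d k * (lg (e j) * (cmod (ip I (u j) (v k)))\<^sup>2))"
      by (simp only: right_diff_distrib sum_subtractf sum_distrib_left)
    also have "(\<Sum>k\<in>I. \<Sum>j\<in>I. d k * (lg (e j) * (cmod (ip I (u j) (v k)))\<^sup>2)) = (\<Sum>j\<in>I. overlap I d v u j * lg (e j))"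
      unfolding overlap_def sum_distrib_right by (subst sum.swap) (simp only: mult_ac)
    finally show ?thesis .
  qed
  then show ?thesis unfolding rel_entropy_def supp by (simp only:)
qed

subsection \<open>Spectral data of a pair of states\<close>

definition stat :: "'i set \<Rightarrow> ('i \<Rightarrow> real) \<Rightarrow> ('i \<Rightarrow> real) \<Rightarrow> real \<Rightarrow> real \<Rightarrow> bool" where
  "stat I P g m V \<longleftrightarrow> (\<forall>i\<in>I. 0 \<le> P i) \<and> sum P I = 1 \<and>
     (\<Sum>i\<in>I. P i * g i) = m \<and> (\<Sum>i\<in>I. P i * (g i - m)\<^sup>2) = V"

lemma stat_chebyshev:
  assumes "finite I" "stat I P g m V" "\<delta> > 0" and S: "S \<subseteq> I" "\<And>i. i \<in> S \<Longrightarrow> \<delta> \<le> \<bar>g i - m\<bar>"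
  shows "sum P S \<le> V / \<delta>\<^sup>2"
proof -
  have "sum P S * \<delta>\<^sup>2 = (\<Sum>i\<in>S. P i * \<delta>\<^sup>2)" by (simp add: sum_distrib_right)
  also have "\<dots> \<le> (\<Sum>i\<in>S. P i * (g i - m)\<^sup>2)"
  proof (intro sum_mono mult_left_mono)
    fix i assume "i \<in> S"
    then show "\<delta>\<^sup>2 \<le> (g i - m)\<^sup>2" using S assms(3) by (metis less_imp_le power2_abs power_mono)
  qed (use assms in \<open>auto simp: stat_def\<close>)
  also have "\<dots> \<le> (\<Sum>i\<in>I. P i * (g i - m)\<^sup>2)"
    using assms by (intro sum_mono2) (auto simp: stat_def)
  also have "\<dots> = V" using assms by (simp add: stat_def)
  finally show ?thesis using assms(3) by (simp add: field_simps)
qed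

text \<open>The mean \<open>m\<close> is a lower bound for the relative entropy. Since \<open>f\<close> need only dominate the logarithm
  of the eigenvalues of the second state and is arbitrary where they vanish, it comes arbitrarily close,
  also when the relative entropy is infinite.\<close>

definition pair_data :: "'i set \<Rightarrow> 'i oper \<Rightarrow> 'i oper \<Rightarrow> real \<Rightarrow> real \<Rightarrow> bool" where
  "pair_data I \<rho> \<sigma> m V \<longleftrightarrow> (\<exists>d v e u g f a b Va Vb.
     orthonormal_basis I v \<and> orthonormal_basis I u \<and>
     \<rho> = spectral_op I d v \<and> \<sigma> = spectral_op I e u \<and>
     (\<forall>k\<in>I. d k = 0 \<or> d k = 2 powr g k) \<and> (\<forall>j\<in>I. 0 \<le> e j \<and> e j \<le> 2 powr f j) \<and>
     stat I d g a Va \<and> stat I (overlap I d v u) f b Vb \<and> m = a - b \<and> V = Va + Vb)"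

lemma pair_dataI:
  assumes "orthonormal_basis I v" "orthonormal_basis I u"
    and "\<And>k. k \<in> I \<Longrightarrow> d k = 0 \<or> d k = 2 powr g k" "\<And>j. j \<in> I \<Longrightarrow> 0 \<le> e j \<and> e j \<le> 2 powr f j"
    and "stat I d g a Va" "stat I (overlap I d v u) f b Vb"
  shows "pair_data I (spectral_op I d v) (spectral_op I e u) (a - b) (Va + Vb)"
  unfolding pair_data_def
  by (rule exI[of _ d], rule exI[of _ v], rule exI[of _ e], rule exI[of _ u], rule exI[of _ g], rule exI[of _ f],
      rule exI[of _ a], rule exI[of _ b], rule exI[of _ Va], rule exI[of _ Vb]) (use assms in blast)

text \<open>The first mean is exact, since \<open>g\<close> is the logarithm of \<open>d\<close>
  wherever \<open>d\<close> is nonzero. In the second mean the logarithm of \<open>e\<close> is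
  replaced by an upper bound, which can only lower the difference. If the support condition fails,
  the right side is infinite.\<close>

lemma pair_data_le_rel_entropy:
  assumes I: "finite I" and pair: "pair_data I \<rho> \<sigma> m V"
  shows "ereal m \<le> rel_entropy I \<rho> \<sigma>"
proof -
  obtain d v e u g f a b Va Vb where on: "orthonormal_basis I v" "orthonormal_basis I u" and
     eq: "\<rho> = spectral_op I d v" "\<sigma> = spectral_op I e u" and
     dg: "\<forall>k\<in>I. d k = 0 \<or> d k = 2 powr g k" and ef: "\<forall>j\<in>I. 0 \<le> e j \<and> e j \<le> 2 powr f j" and
     st: "stat I d g a Va" "stat I (overlap I d v u) f b Vb" and m: "m = a - b"
    using pair unfolding pair_data_def by blast
  have d: "\<And>k. k \<in> I \<Longrightarrow> 0 \<le> d k" using st(1) by (simp add: stat_def)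
  have "(\<Sum>k\<in>I. d k * lg (d k)) = (\<Sum>k\<in>I. d k * g k)"
    using dg by (intro sum.cong) auto
  then have a: "(\<Sum>k\<in>I. d k * lg (d k)) = a" using st(1) by (simp add: stat_def)
  have b: "(\<Sum>j\<in>I. overlap I d v u j * lg (e j)) \<le> b" if h: "\<forall>j\<in>I. e j = 0 \<longrightarrow> overlap I d v u j = 0"
  proof -
    have "(\<Sum>j\<in>I. overlap I d v u j * lg (e j)) \<le> (\<Sum>j\<in>I. overlap I d v u j * f j)"
    proof (rule sum_mono)
      fix j assume j: "j \<in> I"
      show "overlap I d v u j * lg (e j) \<le> overlap I d v u j * f j"
      proof (cases "e j = 0")
        case False
        then have e: "0 < e j" "e j \<le> 2 powr f j" using ef j by (auto simp: less_le)
        then have "log 2 (e j) \<le> log 2 (2 powr f j)" by (subst log_le_cancel_iff) auto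
        then show ?thesis using False overlap_nonneg[of I d v u j, OF d] by (simp add: mult_left_mono)
      qed (use h j in auto)
    qed
    also have "\<dots> = b" using st(2) by (simp add: stat_def)
    finally show ?thesis .
  qed
  show ?thesis
    unfolding eq m using b by (subst rel_entropy_spectral[OF I on]) (auto simp: d(1) a)
qed

text \<open>\<open>p0\<close> is the weight of \<open>\<rho>\<close> on the kernel of
  \<open>\<sigma>\<close>. Giving the zero eigenvalues of \<open>\<sigma>\<close> the fictitious
  logarithm \<open>- M\<close> shifts the mean by \<open>M * p0\<close>. If the support condition
  holds, the mean is the relative entropy itself; otherwise \<open>p0 > 0\<close> and the mean can
  be made arbitrarily large.\<close>

lemma pair_data_exists:
  assumes I: "finite I" and s: "state I \<rho>" "state I \<sigma>" and x: "ereal x < rel_entropy I \<rho> \<sigma>"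
  obtains m V where "x < m" "pair_data I \<rho> \<sigma> m V"
proof -
  obtain d v where on: "orthonormal_basis I v" and r: "\<rho> = spectral_op I d v"
    and d: "\<And>k. k \<in> I \<Longrightarrow> 0 \<le> d k" "sum d I = 1" using state_spectral[OF I s(1)] by blast
  obtain e u where on': "orthonormal_basis I u" and r': "\<sigma> = spectral_op I e u"
    and e: "\<And>k. k \<in> I \<Longrightarrow> 0 \<le> e k" "sum e I = 1" using state_spectral[OF I s(2)] by blast
  define p where "p = overlap I d v u"
  have p: "\<And>j. 0 \<le> p j" "sum p I = 1"
    unfolding p_def using overlap_nonneg[of I d] d sum_overlap[OF I on on'] by auto
  define p0 where "p0 = (\<Sum>j\<in>I. if e j = 0 then p j else 0)"
  define h where "h = (\<Sum>k\<in>I. d k * lg (d k)) - (\<Sum>j\<in>I. p j * lg (e j))"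
  have p0: "0 \<le> p0" unfolding p0_def by (intro sum_nonneg) (simp add: p)
  have data: "\<exists>V. pair_data I \<rho> \<sigma> (h + M * p0) V" for M
  proof -
    define f where "f = (\<lambda>j. if e j = 0 then - M else log 2 (e j))"
    have "(\<Sum>j\<in>I. p j * f j) = (\<Sum>j\<in>I. p j * lg (e j)) - M * p0"
      unfolding p0_def sum_distrib_left sum_subtractf[symmetric] by (intro sum.cong) (auto simp: f_def)
    then have m: "h + M * p0 = (\<Sum>k\<in>I. d k * lg (d k)) - (\<Sum>j\<in>I. p j * f j)" by (simp add: h_def)
    have "0 \<le> e j \<and> e j \<le> 2 powr f j" if "j \<in> I" for j
      using e(1)[OF that] by (simp add: f_def)
    moreover have "d k = 0 \<or> d k = 2 powr lg (d k)" if "k \<in> I" for k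
      using d(1)[OF that] by simp
    moreover have st: "stat I d (\<lambda>k. lg (d k)) (\<Sum>k\<in>I. d k * lg (d k))
        (\<Sum>k\<in>I. d k * (lg (d k) - (\<Sum>k\<in>I. d k * lg (d k)))\<^sup>2)"
      using d unfolding stat_def by blast
    moreover have st': "stat I (overlap I d v u) f (\<Sum>j\<in>I. p j * f j) (\<Sum>j\<in>I. p j * (f j - (\<Sum>j\<in>I. p j * f j))\<^sup>2)"
      using p unfolding stat_def p_def by blast
    ultimately show ?thesis unfolding m r r' using pair_dataI[OF on on' _ _ st st'] by blast
  qed
  show ?thesis
  proof (cases "\<forall>j\<in>I. e j = 0 \<longrightarrow> p j = 0")
    case True
    then have "rel_entropy I \<rho> \<sigma> = ereal h"
      unfolding r r' h_def p_def by (subst rel_entropy_spectral[OF I on on']) (use d(1) in auto)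
    then show ?thesis using data[of 0] x that by force
  next
    case False
    then obtain j where j: "j \<in> I" "e j = 0" "p j \<noteq> 0" by blast
    have "p j \<le> p0" unfolding p0_def using member_le_sum[OF j(1), of "\<lambda>j. if e j = 0 then p j else 0"] I p j by auto
    then have "p0 > 0" using j(3) p(1)[of j] by simp
    \<comment> \<open>This \<open>M\<close> makes the mean equal to \<open>x + 1\<close>.\<close>
    then have "h + ((x - h + 1) / p0) * p0 > x" by simp
    then show ?thesis using data that by blast
  qed
qed

text \<open>The test is \<open>Q P Q\<close> where \<open>P\<close> projects on the typical eigenvectors of the first state and \<open>Q\<close> on the
  eigenvectors of the second state whose eigenvalues are not too large. Since \<open>P\<close> has small rank and \<open>Q\<close>
  bounds the eigenvalues, the second error is small; the first one is controlled by \<open>x\<^sup>2 \<ge> 2 x - 1\<close>.\<close>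

lemma one_shot_test:
  assumes I: "finite I" and pair: "pair_data I \<rho> \<sigma> m V" and \<delta>: "\<delta> > 0"
  obtains Q1 Q2 where "binary_povm I Q1 Q2"
    "Re (tr I (mult_op I Q2 \<rho>)) \<le> 2 * V / \<delta>\<^sup>2"
    "0 \<le> Re (tr I (mult_op I Q1 \<sigma>))" "Re (tr I (mult_op I Q1 \<sigma>)) \<le> 2 powr (2 * \<delta> - m)"
proof -
  obtain d v e u g f a b Va Vb where on: "orthonormal_basis I v" "orthonormal_basis I u" and
     eq: "\<rho> = spectral_op I d v" "\<sigma> = spectral_op I e u" and
     dg: "\<forall>k\<in>I. d k = 0 \<or> d k = 2 powr g k" and ef: "\<forall>j\<in>I. 0 \<le> e j \<and> e j \<le> 2 powr f j" and
     st: "stat I d g a Va" "stat I (overlap I d v u) f b Vb" and m: "m = a - b" "V = Va + Vb"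
    using pair unfolding pair_data_def by blast
  have d: "\<And>k. k \<in> I \<Longrightarrow> 0 \<le> d k" "sum d I = 1" using st(1) by (simp_all add: stat_def)
  \<comment> \<open>Zero eigenvalues are left out because \<open>g\<close> is arbitrary there.
    \<open>G\<close> cuts off the lower tail of \<open>g\<close>, which bounds the rank of P, and
    \<open>H\<close> the upper tail of \<open>f\<close>, which bounds the eigenvalues seen by
    Q.\<close>
  define G where "G = {k\<in>I. d k \<noteq> 0 \<and> a - \<delta> < g k}"
  define H where "H = {j\<in>I. f j < b + \<delta>}"
  have G: "finite G" "G \<subseteq> I" and H: "finite H" "H \<subseteq> I" using I by (auto simp: G_def H_def)
  \<comment> \<open>Each label in \<open>G\<close> carries weight above 2^(a - delta), and the total
    weight is 1.\<close>
  have cG: "real (card G) \<le> 2 powr (\<delta> - a)"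
  proof -
    have "real (card G) * 2 powr (a - \<delta>) = (\<Sum>k\<in>G. 2 powr (a - \<delta>))" by simp
    also have "\<dots> \<le> sum d G"
    proof (rule sum_mono)
      fix k assume "k \<in> G"
      then have "d k = 2 powr g k" "a - \<delta> < g k" using dg by (auto simp: G_def)
      then show "2 powr (a - \<delta>) \<le> d k" by simp
    qed
    also have "\<dots> \<le> sum d I" using I G d by (intro sum_mono2) auto
    finally have "real (card G) \<le> 1 / 2 powr (a - \<delta>)" using d(2) by (simp add: field_simps)
    then show ?thesis by (simp add: powr_minus_divide[symmetric])
  qed
  define q where "q k = (\<Sum>j\<in>H. (cmod (ip I (u j) (v k)))\<^sup>2)" for k
  \<comment> \<open>\<open>t l\<close> is the projection Q applied to \<open>v l\<close>, so
    \<open>T\<close>, the sum of |t_l><t_l| over \<open>G\<close>, is Q P Q.\<close>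
  define t where "t l = (\<lambda>i. \<Sum>j\<in>H. ip I (u j) (v l) * u j i)" for l
  define T where "T = (\<lambda>i j. \<Sum>l\<in>G. t l i * cnj (t l j))"
  define T' where "T' = (\<lambda>i j. id_op I i j - T i j)"
  have tv: "t l i = 0" if "i \<notin> I" "l \<in> G" for l i
    unfolding t_def using onb_vanish[OF on(2)] H that by (intro sum.neutral) auto
  have T_op: "T \<in> opers I" unfolding opers_def T_def using tv by (auto intro!: sum.neutral)
  have ipT: "ip I x (ap I T x) = of_real (\<Sum>l\<in>G. (cmod (ip I (t l) x))\<^sup>2)" for x
  proof -
    have "ip I x (ap I T x) = (\<Sum>l\<in>G. 1 * ip I x (t l) * ip I (t l) x)"
      by (rule ip_ap_sum) (use G in \<open>auto simp: T_def\<close>)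
    also have "\<dots> = (\<Sum>l\<in>G. cnj (ip I (t l) x) * ip I (t l) x)" by (simp add: cnj_ip)
    finally show ?thesis by (simp add: cnj_mult_self)
  qed
  \<comment> \<open>\<open>T\<close> is at most the identity: the inner product of
    \<open>t l\<close> with \<open>x\<close> is that of \<open>v l\<close> with the projected vector
    \<open>y\<close>, so Bessel's inequality bounds the sum by the squared norm of \<open>y\<close>,
    and projecting does not increase the norm.\<close>
  have bd: "(\<Sum>l\<in>G. (cmod (ip I (t l) x))\<^sup>2) \<le> Re (ip I x x)" for x
  proof -
    define y where "y = (\<lambda>i. \<Sum>j\<in>H. ip I (u j) x * u j i)"
    have ty: "ip I (t l) x = ip I (v l) y" for l
      unfolding t_def y_def ip_sum_left ip_sum_right by (simp add: cnj_ip mult.commute)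
    have uy: "ip I (u j) y = (if j \<in> H then ip I (u j) x else 0)" if "j \<in> I" for j
    proof -
      have "ip I (u j) y = (\<Sum>k\<in>H. if k = j then ip I (u j) x else 0)"
        unfolding y_def ip_sum_right using onb_ip[OF on(2) that] H by (intro sum.cong) auto
      then show ?thesis using H by simp
    qed
    have "(\<Sum>l\<in>G. (cmod (ip I (t l) x))\<^sup>2) \<le> (\<Sum>l\<in>I. (cmod (ip I (v l) y))\<^sup>2)"
      unfolding ty using I G by (intro sum_mono2) auto
    also have "\<dots> = (\<Sum>j\<in>I. (cmod (ip I (u j) y))\<^sup>2)"
      by (simp add: parseval_norm[OF I on(1)] parseval_norm[OF I on(2)])
    also have "\<dots> \<le> (\<Sum>j\<in>I. (cmod (ip I (u j) x))\<^sup>2)" using uy by (intro sum_mono) auto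
    also have "\<dots> = Re (ip I x x)" by (rule parseval_norm[OF I on(2)])
    finally show ?thesis .
  qed
  have idI: "ip I x (ap I (id_op I) x) = ip I x x" for x
    using I by (simp add: ip_def ap_def id_op_def if_distrib[of "\<lambda>x. x * _"] cong: if_cong)
  have ipT': "ip I x (ap I T' x) = of_real (Re (ip I x x) - (\<Sum>l\<in>G. (cmod (ip I (t l) x))\<^sup>2))" for x
  proof -
    have "ip I x (ap I T' x) = ip I x (ap I (id_op I) x) - ip I x (ap I T x)"
      unfolding ip_ap T'_def by (simp only: right_diff_distrib left_diff_distrib sum_subtractf)
    then show ?thesis unfolding idI ipT by (simp add: ip_self)
  qed
  have povm: "binary_povm I T T'"
    unfolding binary_povm_def psd_pd pd_def
  proof (intro conjI allI)
    fix x show "(\<Sum>i\<in>I. \<Sum>j\<in>I. cnj (x i) * T i j * x j) \<in> \<real>\<^sub>\<ge>\<^sub>0"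
      unfolding ip_ap[symmetric] ipT by (subst nonneg_Reals_of_real_iff) (simp add: sum_nonneg)
    show "(\<Sum>i\<in>I. \<Sum>j\<in>I. cnj (x i) * T' i j * x j) \<in> \<real>\<^sub>\<ge>\<^sub>0"
      unfolding ip_ap[symmetric] ipT' using bd[of x] by (subst nonneg_Reals_of_real_iff) simp
  next
    show "T \<in> opers I" by (rule T_op)
    show "T' \<in> opers I" using T_op by (auto simp: T'_def opers_def id_op_def)
  qed (simp add: T'_def)
  have tu: "ip I (t l) (u j) = (if j \<in> H then cnj (ip I (u j) (v l)) else 0)" if "j \<in> I" for l j
  proof -
    have "ip I (t l) (u j) = (\<Sum>k\<in>H. if k = j then cnj (ip I (u j) (v l)) else 0)"
      unfolding t_def ip_sum_left using onb_ip[OF on(2) _ that] H by (intro sum.cong) auto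
    then show ?thesis using H by simp
  qed
  have "tr I (mult_op I T \<sigma>) = of_real (\<Sum>j\<in>I. e j * (\<Sum>l\<in>G. (cmod (ip I (t l) (u j)))\<^sup>2))"
    unfolding eq tr_mult_commute[of I T] tr_mult_spectral ipT by (simp only: of_real_sum of_real_mult)
  then have \<beta>: "Re (tr I (mult_op I T \<sigma>)) = (\<Sum>j\<in>I. e j * (\<Sum>l\<in>G. (cmod (ip I (t l) (u j)))\<^sup>2))" by simp
  have \<beta>0: "0 \<le> Re (tr I (mult_op I T \<sigma>))"
    unfolding \<beta> using ef by (intro sum_nonneg mult_nonneg_nonneg) auto
  \<comment> \<open>Only \<open>j \<in> H\<close> contributes, and there \<open>e j\<close> is at
    most 2^(b + delta). Extending the remaining sum to all \<open>j\<close> turns it into the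
    squared norms of the \<open>v l\<close>, whose sum is \<open>card G\<close>.\<close>
  have "Re (tr I (mult_op I T \<sigma>)) \<le> (\<Sum>j\<in>I. 2 powr (b + \<delta>) * (\<Sum>l\<in>G. (cmod (ip I (u j) (v l)))\<^sup>2))"
    unfolding \<beta>
  proof (rule sum_mono)
    fix j assume j: "j \<in> I"
    show "e j * (\<Sum>l\<in>G. (cmod (ip I (t l) (u j)))\<^sup>2) \<le> 2 powr (b + \<delta>) * (\<Sum>l\<in>G. (cmod (ip I (u j) (v l)))\<^sup>2)"
    proof (cases "j \<in> H")
      case True
      have "e j \<le> 2 powr f j" using ef j by blast
      also have "\<dots> \<le> 2 powr (b + \<delta>)" using True by (simp add: H_def)
      finally have "e j \<le> 2 powr (b + \<delta>)" .
      then show ?thesis using True j by (simp add: tu mult_right_mono sum_nonneg)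
    next
      case False
      then show ?thesis using j by (simp add: tu sum_nonneg)
    qed
  qed
  also have "\<dots> = 2 powr (b + \<delta>) * (\<Sum>l\<in>G. \<Sum>j\<in>I. (cmod (ip I (u j) (v l)))\<^sup>2)"
    unfolding sum_distrib_left[symmetric] by (subst sum.swap) simp
  also have "(\<Sum>l\<in>G. \<Sum>j\<in>I. (cmod (ip I (u j) (v l)))\<^sup>2) = card G"
    unfolding parseval_norm[OF I on(2)] using onb_ip[OF on(1)] G by (simp add: subset_iff)
  also have "2 powr (b + \<delta>) * real (card G) \<le> 2 powr (b + \<delta>) * 2 powr (\<delta> - a)"
    using cG by (intro mult_left_mono) auto
  also have "\<dots> = 2 powr (2 * \<delta> - m)" unfolding powr_add[symmetric] m by (simp add: algebra_simps)
  finally have \<beta>1: "Re (tr I (mult_op I T \<sigma>)) \<le> 2 powr (2 * \<delta> - m)" .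
  have tvv: "ip I (t k) (v k) = of_real (q k)" for k
    unfolding t_def ip_sum_left q_def by (simp add: cnj_mult_self)
  have q01: "q k \<le> 1" "0 \<le> q k" if "k \<in> I" for k
  proof -
    have "q k \<le> (\<Sum>j\<in>I. (cmod (ip I (u j) (v k)))\<^sup>2)" unfolding q_def using I H by (intro sum_mono2) auto
    then show "q k \<le> 1" unfolding parseval_norm[OF I on(2)] using onb_ip[OF on(1) that that] by simp
    show "0 \<le> q k" unfolding q_def by (simp add: sum_nonneg)
  qed
  have "tr I (mult_op I T' \<rho>) = of_real (\<Sum>k\<in>I. d k * (1 - (\<Sum>l\<in>G. (cmod (ip I (t l) (v k)))\<^sup>2)))"
    unfolding eq tr_mult_commute[of I T'] tr_mult_spectral ipT'
    by (simp add: onb_ip[OF on(1)])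
  then have "Re (tr I (mult_op I T' \<rho>)) = (\<Sum>k\<in>I. d k * (1 - (\<Sum>l\<in>G. (cmod (ip I (t l) (v k)))\<^sup>2)))" by simp
  \<comment> \<open>For \<open>k \<in> G\<close> only the term \<open>l = k\<close> is kept; it
    equals \<open>(q k)^2\<close>, and \<open>1 - q^2 \<le> 2 (1 - q)\<close>. For the other labels
    \<open>d k\<close> itself is a bound. The second factor 2 merely lets both tails share the form
    \<open>2 * V / \<delta>^2\<close>.\<close>
  also have "\<dots> \<le> (\<Sum>k\<in>I. 2 * (d k * (1 - q k)) + 2 * (if k \<in> G then 0 else d k))"
  proof (rule sum_mono)
    fix k assume k: "k \<in> I"
    show "d k * (1 - (\<Sum>l\<in>G. (cmod (ip I (t l) (v k)))\<^sup>2)) \<le> 2 * (d k * (1 - q k)) + 2 * (if k \<in> G then 0 else d k)"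
    proof (cases "k \<in> G")
      case True
      have "(q k)\<^sup>2 = (cmod (ip I (t k) (v k)))\<^sup>2" unfolding tvv by simp
      also have "\<dots> \<le> (\<Sum>l\<in>G. (cmod (ip I (t l) (v k)))\<^sup>2)"
        using G True by (intro member_le_sum[of k G "\<lambda>l. (cmod (ip I (t l) (v k)))\<^sup>2"]) auto
      finally have "(q k)\<^sup>2 \<le> (\<Sum>l\<in>G. (cmod (ip I (t l) (v k)))\<^sup>2)" .
      moreover have "0 \<le> (1 - q k)\<^sup>2" by simp
      ultimately have "1 - (\<Sum>l\<in>G. (cmod (ip I (t l) (v k)))\<^sup>2) \<le> 2 * (1 - q k)"
        by (simp add: power2_eq_square algebra_simps)
      then have "d k * (1 - (\<Sum>l\<in>G. (cmod (ip I (t l) (v k)))\<^sup>2)) \<le> d k * (2 * (1 - q k))"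
        using d(1)[OF k] by (rule mult_left_mono)
      also have "\<dots> = 2 * (d k * (1 - q k))" by (rule mult.left_commute)
      finally show ?thesis using True by simp
    next
      case False
      have "d k * (1 - (\<Sum>l\<in>G. (cmod (ip I (t l) (v k)))\<^sup>2)) \<le> d k * 1"
        using d(1)[OF k] by (intro mult_left_mono) (auto simp: sum_nonneg)
      moreover have "0 \<le> d k * (1 - q k)" using d(1)[OF k] q01[OF k] by simp
      ultimately show ?thesis using False d(1)[OF k] by simp
    qed
  qed
  also have "\<dots> = 2 * (\<Sum>k\<in>I. d k * (1 - q k)) + 2 * (\<Sum>k\<in>I. if k \<in> G then 0 else d k)"
    by (simp only: sum.distrib sum_distrib_left)
  also have "(\<Sum>k\<in>I. if k \<in> G then 0 else d k) \<le> Va / \<delta>\<^sup>2"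
  proof -
    have "(\<Sum>k\<in>I. if k \<in> G then 0 else d k) = (\<Sum>k\<in>{k\<in>I. d k \<noteq> 0 \<and> k \<notin> G}. d k)"
      using I by (intro sum.mono_neutral_cong_right) auto
    also have "\<dots> \<le> Va / \<delta>\<^sup>2"
      by (rule stat_chebyshev[OF I st(1) \<delta>]) (auto simp: G_def)
    finally show ?thesis .
  qed
  also have "(\<Sum>k\<in>I. d k * (1 - q k)) \<le> Vb / \<delta>\<^sup>2"
  proof -
    \<comment> \<open>Both sides are Tr(rho Q), so the deficit is the weight of the overlaps outside
      \<open>H\<close>.\<close>
    have "(\<Sum>k\<in>I. d k * q k) = (\<Sum>j\<in>H. overlap I d v u j)"
      unfolding q_def overlap_def sum_distrib_left by (rule sum.swap)
    then have "(\<Sum>k\<in>I. d k * (1 - q k)) = 1 - (\<Sum>j\<in>H. overlap I d v u j)"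
      by (simp add: right_diff_distrib sum_subtractf d)
    also have "\<dots> = (\<Sum>j\<in>I. overlap I d v u j) - (\<Sum>j\<in>H. overlap I d v u j)"
      using st(2) by (simp add: stat_def)
    also have "\<dots> = (\<Sum>j\<in>I - H. overlap I d v u j)" using I H by (simp add: sum_diff)
    also have "\<dots> \<le> Vb / \<delta>\<^sup>2"
      by (rule stat_chebyshev[OF I st(2) \<delta>]) (auto simp: H_def)
    finally show ?thesis .
  qed
  finally have "Re (tr I (mult_op I T' \<rho>)) \<le> 2 * V / \<delta>\<^sup>2"
    unfolding m by (simp add: add_divide_distrib algebra_simps)
  then show ?thesis using that[OF povm _ \<beta>0 \<beta>1] by blast
qed

subsection \<open>Tensor products up to relabelling\<close>

text \<open>A label set that is a product only up to a bijection, presented by its two projections.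
  Words cut after \<open>m\<close> letters, words of pairs, and numbers below a product are all
  treated as composite systems in this way.\<close>

definition splitting :: "'k set \<Rightarrow> 'i set \<Rightarrow> 'j set \<Rightarrow> ('k \<Rightarrow> 'i) \<Rightarrow> ('k \<Rightarrow> 'j) \<Rightarrow> bool" where
  "splitting K I J f g \<longleftrightarrow> bij_betw (\<lambda>k. (f k, g k)) K (I \<times> J)"

definition tens :: "'k set \<Rightarrow> ('k \<Rightarrow> 'i) \<Rightarrow> ('k \<Rightarrow> 'j) \<Rightarrow> 'i oper \<Rightarrow> 'j oper \<Rightarrow> 'k oper" where
  "tens K f g X Y = (\<lambda>k l. if k \<in> K \<and> l \<in> K then X (f k) (f l) * Y (g k) (g l) else 0)"

definition tens_vec :: "'k set \<Rightarrow> ('k \<Rightarrow> 'i) \<Rightarrow> ('k \<Rightarrow> 'j) \<Rightarrow> ('i \<Rightarrow> 'i \<Rightarrow> complex) \<Rightarrow> ('j \<Rightarrow> 'j \<Rightarrow> complex)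
    \<Rightarrow> 'k \<Rightarrow> 'k \<Rightarrow> complex" where
  "tens_vec K f g v w = (\<lambda>k i. if i \<in> K then v (f k) (f i) * w (g k) (g i) else 0)"

lemma splitting_mem: "splitting K I J f g \<Longrightarrow> k \<in> K \<Longrightarrow> f k \<in> I \<and> g k \<in> J"
  unfolding splitting_def bij_betw_def by auto

lemma splitting_eq: "splitting K I J f g \<Longrightarrow> k \<in> K \<Longrightarrow> l \<in> K \<Longrightarrow> k = l \<longleftrightarrow> f k = f l \<and> g k = g l"
  unfolding splitting_def bij_betw_def inj_on_def by blast

lemma splitting_finite: "splitting K I J f g \<Longrightarrow> finite I \<Longrightarrow> finite J \<Longrightarrow> finite K"
  unfolding splitting_def by (metis bij_betw_finite finite_cartesian_product)

lemma splitting_sum: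
  assumes "splitting K I J f g"
  shows "(\<Sum>k\<in>K. F (f k) (g k)) = (\<Sum>i\<in>I. \<Sum>j\<in>J. F i j)"
  unfolding sum.cartesian_product
  using sum.reindex_bij_betw[OF assms[unfolded splitting_def], of "\<lambda>(i, j). F i j"] by simp

lemma splitting_sum_prod:
  fixes F :: "'i \<Rightarrow> 'a :: comm_semiring_0"
  assumes "splitting K I J f g"
  shows "(\<Sum>k\<in>K. F (f k) * G (g k)) = (\<Sum>i\<in>I. F i) * (\<Sum>j\<in>J. G j)"
  using splitting_sum[OF assms, of "\<lambda>i j. F i * G j"] by (simp add: sum_product)

lemma ip_tens_vec:
  assumes "splitting K I J f g"
  shows "ip K (tens_vec K f g v w k) (tens_vec K f g v' w' l) =
    ip I (v (f k)) (v' (f l)) * ip J (w (g k)) (w' (g l))"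
  unfolding ip_def splitting_sum_prod[OF assms, symmetric]
  by (intro sum.cong) (auto simp: tens_vec_def)

lemma orthonormal_basis_tens:
  assumes s: "splitting K I J f g" and on: "orthonormal_basis I v" "orthonormal_basis J w"
  shows "orthonormal_basis K (tens_vec K f g v w)"
proof -
  have "ip K (tens_vec K f g v w k) (tens_vec K f g v w l) = (if k = l then 1 else 0)"
    if "k \<in> K" "l \<in> K" for k l
    unfolding ip_tens_vec[OF s] splitting_eq[OF s that]
    using splitting_mem[OF s] that onb_ip[OF on(1)] onb_ip[OF on(2)] by simp
  then show ?thesis
    by (auto simp: orthonormal_basis_iff orthonormal_on_def tens_vec_def)
qed

lemma spectral_op_tens:
  assumes s: "splitting K I J f g"
  shows "tens K f g (spectral_op I d v) (spectral_op J e w) =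
    spectral_op K (\<lambda>k. d (f k) * e (g k)) (tens_vec K f g v w)"
proof (intro ext)
  fix i j
  show "tens K f g (spectral_op I d v) (spectral_op J e w) i j =
    spectral_op K (\<lambda>k. d (f k) * e (g k)) (tens_vec K f g v w) i j"
  proof (cases "i \<in> K \<and> j \<in> K")
    case True
    then show ?thesis
      unfolding tens_def spectral_op_def splitting_sum_prod[OF s, symmetric]
      by (simp add: tens_vec_def mult_ac)
  qed (auto simp: tens_def spectral_op_def tens_vec_def)
qed

lemma overlap_tens:
  assumes s: "splitting K I J f g"
  shows "overlap K (\<lambda>k. d (f k) * e (g k)) (tens_vec K f g v w) (tens_vec K f g v' w') j =
    overlap I d v v' (f j) * overlap J e w w' (g j)"
  unfolding overlap_def ip_tens_vec[OF s] splitting_sum_prod[OF s, symmetric]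
  by (simp add: norm_mult power_mult_distrib mult_ac)

text \<open>Sums of independent random variables: the cross term in the variance factors into the
  two centred means, which are zero.\<close>

lemma stat_tens:
  assumes s: "splitting K I J f g" and st: "stat I P a m V" "stat J Q b n W"
  shows "stat K (\<lambda>k. P (f k) * Q (g k)) (\<lambda>k. a (f k) + b (g k)) (m + n) (V + W)"
proof -
  have P: "\<forall>i\<in>I. 0 \<le> P i" "sum P I = 1" "(\<Sum>i\<in>I. P i * a i) = m" "(\<Sum>i\<in>I. P i * (a i - m)\<^sup>2) = V"
    using st(1) by (simp_all add: stat_def)
  have Q: "\<forall>i\<in>J. 0 \<le> Q i" "sum Q J = 1" "(\<Sum>i\<in>J. Q i * b i) = n" "(\<Sum>i\<in>J. Q i * (b i - n)\<^sup>2) = W"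
    using st(2) by (simp_all add: stat_def)
  have P0: "(\<Sum>i\<in>I. P i * (a i - m)) = 0" and Q0: "(\<Sum>i\<in>J. Q i * (b i - n)) = 0"
    by (simp_all add: right_diff_distrib sum_subtractf P Q flip: sum_distrib_right)
  have "(\<Sum>k\<in>K. P (f k) * Q (g k) * (a (f k) + b (g k))) =
     (\<Sum>k\<in>K. P (f k) * a (f k) * Q (g k)) + (\<Sum>k\<in>K. P (f k) * (Q (g k) * b (g k)))"
    unfolding sum.distrib[symmetric] by (intro sum.cong) (auto simp: algebra_simps)
  also have "\<dots> = m + n"
    unfolding splitting_sum_prod[OF s, of "\<lambda>i. P i * a i" Q] splitting_sum_prod[OF s, of P "\<lambda>j. Q j * b j"] P Q by simp
  finally have 1: "(\<Sum>k\<in>K. P (f k) * Q (g k) * (a (f k) + b (g k))) = m + n" .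
  have "(\<Sum>k\<in>K. P (f k) * Q (g k) * (a (f k) + b (g k) - (m + n))\<^sup>2) =
     (\<Sum>k\<in>K. P (f k) * (a (f k) - m)\<^sup>2 * Q (g k)) + (\<Sum>k\<in>K. P (f k) * (Q (g k) * (b (g k) - n)\<^sup>2))
     + 2 * (\<Sum>k\<in>K. P (f k) * (a (f k) - m) * (Q (g k) * (b (g k) - n)))"
    unfolding sum.distrib[symmetric] sum_distrib_left
    by (intro sum.cong) (auto simp: algebra_simps power2_eq_square)
  also have "\<dots> = V + W"
    unfolding splitting_sum_prod[OF s, of "\<lambda>i. P i * (a i - m)\<^sup>2" Q] splitting_sum_prod[OF s, of P "\<lambda>j. Q j * (b j - n)\<^sup>2"]
      splitting_sum_prod[OF s, of "\<lambda>i. P i * (a i - m)" "\<lambda>j. Q j * (b j - n)"] P0 Q0 P Q by simp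
  finally have 2: "(\<Sum>k\<in>K. P (f k) * Q (g k) * (a (f k) + b (g k) - (m + n))\<^sup>2) = V + W" .
  have 3: "(\<Sum>k\<in>K. P (f k) * Q (g k)) = 1" unfolding splitting_sum_prod[OF s] P Q by simp
  have 4: "\<forall>k\<in>K. 0 \<le> P (f k) * Q (g k)" using P(1) Q(1) splitting_mem[OF s] by simp
  show ?thesis unfolding stat_def using 1 2 3 4 by blast
qed

text \<open>Eigenvalues and overlaps multiply under tensor products, hence the exponents add, and so
  do means and variances. The exact additivity also covers pairs with infinite relative
  entropy.\<close>

lemma pair_data_tens:
  assumes s: "splitting K I J f g" and pair: "pair_data I \<rho> \<sigma> m V" "pair_data J \<rho>' \<sigma>' m' V'"
  shows "pair_data K (tens K f g \<rho> \<rho>') (tens K f g \<sigma> \<sigma>') (m + m') (V + V')"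
proof -
  obtain d v e u a h x y Va Vb where 1: "orthonormal_basis I v" "orthonormal_basis I u"
     "\<rho> = spectral_op I d v" "\<sigma> = spectral_op I e u"
     "\<forall>k\<in>I. d k = 0 \<or> d k = 2 powr a k" "\<forall>j\<in>I. 0 \<le> e j \<and> e j \<le> 2 powr h j"
     "stat I d a x Va" "stat I (overlap I d v u) h y Vb" "m = x - y" "V = Va + Vb"
    using pair(1) unfolding pair_data_def by blast
  obtain d' v' e' u' a' h' x' y' Va' Vb' where 2: "orthonormal_basis J v'" "orthonormal_basis J u'"
     "\<rho>' = spectral_op J d' v'" "\<sigma>' = spectral_op J e' u'"
     "\<forall>k\<in>J. d' k = 0 \<or> d' k = 2 powr a' k" "\<forall>j\<in>J. 0 \<le> e' j \<and> e' j \<le> 2 powr h' j"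
     "stat J d' a' x' Va'" "stat J (overlap J d' v' u') h' y' Vb'" "m' = x' - y'" "V' = Va' + Vb'"
    using pair(2) unfolding pair_data_def by blast
  have m: "m + m' = (x + x') - (y + y')" "V + V' = (Va + Va') + (Vb + Vb')" using 1 2 by simp_all
  show ?thesis
    unfolding 1(3,4) 2(3,4) m spectral_op_tens[OF s]
  proof (rule pair_dataI)
    show "orthonormal_basis K (tens_vec K f g v v')" "orthonormal_basis K (tens_vec K f g u u')"
      by (intro orthonormal_basis_tens[OF s] 1 2)+
    show "stat K (\<lambda>k. d (f k) * d' (g k)) (\<lambda>k. a (f k) + a' (g k)) (x + x') (Va + Va')"
      by (intro stat_tens[OF s] 1 2)
    show "stat K (overlap K (\<lambda>k. d (f k) * d' (g k)) (tens_vec K f g v v') (tens_vec K f g u u'))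
        (\<lambda>k. h (f k) + h' (g k)) (y + y') (Vb + Vb')"
      using stat_tens[OF s 1(8) 2(8)] unfolding overlap_tens[OF s] .
    fix k assume k: "k \<in> K"
    show "d (f k) * d' (g k) = 0 \<or> d (f k) * d' (g k) = 2 powr (a (f k) + a' (g k))"
      using splitting_mem[OF s k] 1(5) 2(5) by (metis mult_eq_0_iff powr_add)
    show "0 \<le> e (f k) * e' (g k) \<and> e (f k) * e' (g k) \<le> 2 powr (h (f k) + h' (g k))"
      using splitting_mem[OF s k] 1(6) 2(6) by (auto simp: powr_add intro!: mult_mono)
  qed
qed

subsection \<open>Positivity\<close>

text \<open>\<open>f\<close> may identify labels: the form at \<open>v\<close> equals the original
  form at the vector \<open>w\<close> that sums \<open>v\<close> over the fibres of
  \<open>f\<close>.\<close>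

lemma pd_pullback:
  assumes fin: "finite I" "finite J" and f: "f ` J \<subseteq> I" and pd: "pd I X"
  shows "pd J (\<lambda>k l. X (f k) (f l))"
  unfolding pd_def
proof
  fix v :: "_ \<Rightarrow> complex"
  define w where "w i = (\<Sum>k\<in>{k\<in>J. f k = i}. v k)" for i
  have in1: "(\<Sum>j\<in>I. X i j * w j) = (\<Sum>l\<in>J. X i (f l) * v l)" for i
  proof -
    have "(\<Sum>j\<in>I. X i j * w j) = (\<Sum>j\<in>I. \<Sum>l\<in>{l\<in>J. f l = j}. X i (f l) * v l)"
      unfolding w_def sum_distrib_left by (intro sum.cong) auto
    also have "\<dots> = (\<Sum>l\<in>J. X i (f l) * v l)"
      using sum.group[OF fin(2,1) f, of "\<lambda>l. X i (f l) * v l"] by simp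
    finally show ?thesis .
  qed
  have "(\<Sum>i\<in>I. \<Sum>j\<in>I. cnj (w i) * X i j * w j) = (\<Sum>i\<in>I. cnj (w i) * (\<Sum>j\<in>I. X i j * w j))"
    by (simp add: sum_distrib_left mult_ac)
  also have "\<dots> = (\<Sum>i\<in>I. \<Sum>k\<in>{k\<in>J. f k = i}. cnj (v k) * (\<Sum>l\<in>J. X (f k) (f l) * v l))"
    unfolding in1 by (intro sum.cong refl) (auto simp: w_def sum_distrib_right intro!: sum.cong)
  also have "\<dots> = (\<Sum>k\<in>J. cnj (v k) * (\<Sum>l\<in>J. X (f k) (f l) * v l))"
    by (rule sum.group[OF fin(2,1) f])
  also have "\<dots> = (\<Sum>k\<in>J. \<Sum>l\<in>J. cnj (v k) * X (f k) (f l) * v l)"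
    by (simp add: sum_distrib_left mult_ac)
  finally show "(\<Sum>k\<in>J. \<Sum>l\<in>J. cnj (v k) * X (f k) (f l) * v l) \<in> \<real>\<^sub>\<ge>\<^sub>0" using pdD[OF pd, of w] by simp
qed

lemma nonneg_Reals_sum: "(\<And>i. i \<in> I \<Longrightarrow> f i \<in> \<real>\<^sub>\<ge>\<^sub>0) \<Longrightarrow> (\<Sum>i\<in>I. f i) \<in> \<real>\<^sub>\<ge>\<^sub>0"
  by (induction I rule: infinite_finite_induct) auto

lemma pd_rank1: "pd I (\<lambda>i j. w i * cnj (w j))"
  unfolding pd_def
proof
  fix v :: "_ \<Rightarrow> complex"
  have "(\<Sum>i\<in>I. \<Sum>j\<in>I. cnj (v i) * (w i * cnj (w j)) * v j) = cnj (ip I w v) * ip I w v"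
    unfolding cnj_ip unfolding ip_def sum_product by (simp add: mult_ac)
  then show "(\<Sum>i\<in>I. \<Sum>j\<in>I. cnj (v i) * (w i * cnj (w j)) * v j) \<in> \<real>\<^sub>\<ge>\<^sub>0"
    by (simp add: cnj_mult_self)
qed

lemma pd_gram:
  assumes I: "finite I" and pd: "pd I X"
  obtains w where "\<And>i j. i \<in> I \<Longrightarrow> j \<in> I \<Longrightarrow> X i j = (\<Sum>a\<in>I. w a i * cnj (w a j))"
proof -
  \<comment> \<open>\<open>pd\<close> leaves the entries outside \<open>I\<close> free, whereas the
    spectral theorem requires them to vanish.\<close>
  define Y where "Y i j = (if i \<in> I \<and> j \<in> I then X i j else 0)" for i j
  have Y: "pd I Y" "Y \<in> opers I" using pd_cong[OF _ pd, of Y] by (auto simp: Y_def opers_def)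
  obtain d v where on: "orthonormal_basis I v" and r: "Y = spectral_op I d v"
    using spectral_theorem[OF I Y(2)] pd_herm[OF I Y(1)] by metis
  have d: "0 \<le> d k" if k: "k \<in> I" for k
  proof -
    have "ip I (v k) (ap I Y (v k)) = of_real (d k)"
      unfolding r ip_eigenvector(1)[OF I on k] using onb_ip[OF on k k] by simp
    then show ?thesis using pdD[OF Y(1), of "v k"] by (simp add: ip_ap)
  qed
  have "X i j = (\<Sum>a\<in>I. (of_real (sqrt (d a)) * v a i) * cnj (of_real (sqrt (d a)) * v a j))"
    if "i \<in> I" "j \<in> I" for i j
  proof -
    have "X i j = (\<Sum>a\<in>I. of_real (d a) * v a i * cnj (v a j))"
      using fun_cong[OF fun_cong[OF r, of i], of j] that by (simp add: Y_def spectral_op_def)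
    also have "\<dots> = (\<Sum>a\<in>I. of_real (sqrt (d a) * sqrt (d a)) * v a i * cnj (v a j))"
      using d by (intro sum.cong) auto
    finally show ?thesis by (simp only: of_real_mult complex_cnj_mult complex_cnj_complex_of_real mult_ac)
  qed
  then show ?thesis by (rule that[of "\<lambda>a i. of_real (sqrt (d a)) * v a i"])
qed

text \<open>The Schur product theorem. With \<open>X\<close> written as a Gram matrix of vectors
  \<open>w a\<close>, the form of the entrywise product at \<open>v\<close> is a sum of forms of
  \<open>Y\<close> at the vectors with entries \<open>v i * cnj (w a i)\<close>.\<close>

lemma pd_schur:
  assumes I: "finite I" and X: "pd I X" and Y: "pd I Y"
  shows "pd I (\<lambda>i j. X i j * Y i j)"
  unfolding pd_def
proof
  fix v :: "_ \<Rightarrow> complex"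
  obtain w where w: "\<And>i j. i \<in> I \<Longrightarrow> j \<in> I \<Longrightarrow> X i j = (\<Sum>a\<in>I. w a i * cnj (w a j))"
    using pd_gram[OF I X] by blast
  have "(\<Sum>i\<in>I. \<Sum>j\<in>I. cnj (v i) * (X i j * Y i j) * v j) =
     (\<Sum>i\<in>I. \<Sum>j\<in>I. \<Sum>a\<in>I. cnj (v i * cnj (w a i)) * Y i j * (v j * cnj (w a j)))"
    by (intro sum.cong refl) (simp add: w sum_distrib_left sum_distrib_right mult_ac)
  also have "\<dots> = (\<Sum>a\<in>I. \<Sum>i\<in>I. \<Sum>j\<in>I. cnj (v i * cnj (w a i)) * Y i j * (v j * cnj (w a j)))"
    by (subst sum.swap[of _ I]) (subst sum.swap[of _ I I], rule refl)
  also have "\<dots> \<in> \<real>\<^sub>\<ge>\<^sub>0"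
  proof (rule nonneg_Reals_sum)
    show "(\<Sum>i\<in>I. \<Sum>j\<in>I. cnj (v i * cnj (w a i)) * Y i j * (v j * cnj (w a j))) \<in> \<real>\<^sub>\<ge>\<^sub>0" for a
      by (rule pdD[OF Y])
  qed
  finally show "(\<Sum>i\<in>I. \<Sum>j\<in>I. cnj (v i) * (X i j * Y i j) * v j) \<in> \<real>\<^sub>\<ge>\<^sub>0" .
qed

lemma pd_prod:
  assumes I: "finite I" and S: "finite S" and X: "\<And>s. s \<in> S \<Longrightarrow> pd I (X s)"
  shows "pd I (\<lambda>i j. \<Prod>s\<in>S. X s i j)"
  using S X
proof (induction S)
  case empty
  then show ?case using pd_rank1[of I "\<lambda>_. 1"] by simp
next
  case (insert s S)
  then show ?case using pd_schur[OF I, of "X s"] by simp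
qed

lemma sum_Times: "(\<Sum>p\<in>A \<times> B. F p) = (\<Sum>a\<in>A. \<Sum>b\<in>B. F (a, b))"
  by (simp add: sum.cartesian_product)

text \<open>The form of the contracted matrix at \<open>v\<close> is that of \<open>Z\<close> at the
  vector that ignores the \<open>I\<close> component.\<close>

lemma pd_contract:
  assumes fin: "finite K" "finite I" and pd: "pd (K \<times> I) Z"
  shows "pd K (\<lambda>k k'. \<Sum>i\<in>I. \<Sum>i'\<in>I. Z (k, i) (k', i'))"
  unfolding pd_def
proof
  fix v :: "_ \<Rightarrow> complex"
  have "(\<Sum>p\<in>K \<times> I. \<Sum>q\<in>K \<times> I. cnj (v (fst p)) * Z p q * v (fst q)) =
      (\<Sum>k\<in>K. \<Sum>i\<in>I. \<Sum>k'\<in>K. \<Sum>i'\<in>I. cnj (v k) * Z (k, i) (k', i') * v k')"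
    by (simp add: sum_Times)
  also have "\<dots> = (\<Sum>k\<in>K. \<Sum>k'\<in>K. \<Sum>i\<in>I. \<Sum>i'\<in>I. cnj (v k) * Z (k, i) (k', i') * v k')"
    by (intro sum.cong refl sum.swap)
  finally show "(\<Sum>k\<in>K. \<Sum>k'\<in>K. cnj (v k) * (\<Sum>i\<in>I. \<Sum>i'\<in>I. Z (k, i) (k', i')) * v k') \<in> \<real>\<^sub>\<ge>\<^sub>0"
    using pdD[OF pd, of "\<lambda>p. v (fst p)"] by (simp add: sum_distrib_left sum_distrib_right)
qed

subsection \<open>Channels and their Choi matrices\<close>

lemma channel_opers: "channel I J E \<Longrightarrow> X \<in> opers I \<Longrightarrow> E X \<in> opers J"
  by (simp add: channel_def)

lemma channel_lin: "channel I J E \<Longrightarrow> X \<in> opers I \<Longrightarrow> Y \<in> opers I \<Longrightarrow>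
    E (\<lambda>i i'. a * X i i' + b * Y i i') = (\<lambda>j j'. a * E X j j' + b * E Y j j')"
  unfolding channel_def by blast

lemma channel_tr: "channel I J E \<Longrightarrow> X \<in> opers I \<Longrightarrow> tr J (E X) = tr I X"
  by (simp add: channel_def)

lemma channel_cp: "channel I J E \<Longrightarrow> psd (I \<times> {..<k::nat}) X \<Longrightarrow> psd (J \<times> {..<k}) (ext_id E X)"
  unfolding channel_def by blast

lemma opers_zero: "(\<lambda>_ _. 0) \<in> opers I"
  by (simp add: opers_def)

lemma unit_op_opers: "x \<in> I \<Longrightarrow> x' \<in> I \<Longrightarrow> unit_op x x' \<in> opers I"
  by (auto simp: opers_def unit_op_def)

lemma channel_zero: "channel I J E \<Longrightarrow> E (\<lambda>_ _. 0) = (\<lambda>_ _. 0)"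
  using channel_lin[of I J E "\<lambda>_ _. 0" "\<lambda>_ _. 0" 0 0] by (simp add: opers_zero)

lemma channel_sum:
  assumes E: "channel I J E" and S: "finite S" and X: "\<And>s. s \<in> S \<Longrightarrow> X s \<in> opers I"
  shows "E (\<lambda>i i'. \<Sum>s\<in>S. a s * X s i i') = (\<lambda>j j'. \<Sum>s\<in>S. a s * E (X s) j j')"
  using S X
proof (induction S)
  case empty
  then show ?case using channel_zero[OF E] by simp
next
  case (insert s S)
  have "(\<lambda>i i'. \<Sum>s\<in>S. a s * X s i i') \<in> opers I"
    using insert.prems by (auto simp: opers_def intro!: sum.neutral)
  from channel_lin[OF E insert.prems[of s] this, of "a s" 1] show ?case
    using insert by simp
qed

lemma channel_apply:
  assumes E: "channel I J E" and I: "finite I" and X: "X \<in> opers I"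
  shows "E X = (\<lambda>j j'. \<Sum>i\<in>I. \<Sum>i'\<in>I. X i i' * E (unit_op i i') j j')"
proof -
  have "X = (\<lambda>i i'. \<Sum>p\<in>I \<times> I. X (fst p) (snd p) * unit_op (fst p) (snd p) i i')"
  proof (intro ext)
    fix i i'
    have "(\<Sum>p\<in>I \<times> I. X (fst p) (snd p) * unit_op (fst p) (snd p) i i') =
        (\<Sum>p\<in>I \<times> I. if p = (i, i') then X i i' else 0)"
      by (intro sum.cong) (auto simp: unit_op_def)
    then show "X i i' = (\<Sum>p\<in>I \<times> I. X (fst p) (snd p) * unit_op (fst p) (snd p) i i')"
      using I X by (auto simp: opers_def)
  qed
  then have "E X = E (\<lambda>i i'. \<Sum>p\<in>I \<times> I. X (fst p) (snd p) * unit_op (fst p) (snd p) i i')"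
    by (rule arg_cong)
  also have "\<dots> = (\<lambda>j j'. \<Sum>p\<in>I \<times> I. X (fst p) (snd p) * E (unit_op (fst p) (snd p)) j j')"
    using I by (intro channel_sum[OF E]) (auto intro: unit_op_opers)
  finally show ?thesis by (simp add: sum_Times)
qed

definition choi :: "('i oper \<Rightarrow> 'j oper) \<Rightarrow> ('j \<times> 'i) oper" where
  "choi E = (\<lambda>p q. E (unit_op (snd p) (snd q)) (fst p) (fst q))"

text \<open>Complete positivity is available for numbered references only. So \<open>E\<close> is
  applied to half of a maximally entangled pair of \<open>I\<close> and \<open>{..<card I}\<close>,
  and the reference is renamed to \<open>I\<close> afterwards.\<close>

lemma channel_choi:
  assumes E: "channel I J E" and I: "finite I" and J: "finite J"
  shows "pd (J \<times> I) (choi E)"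
proof -
  define k where "k = card I"
  obtain h where h: "bij_betw h {..<k} I"
    using ex_bij_betw_nat_finite[OF I] by (auto simp: k_def lessThan_atLeast0)
  have hI: "h r \<in> I" if "r < k" for r using h that by (auto simp: bij_betw_def)
  \<comment> \<open>The unnormalised maximally entangled vector, with \<open>h\<close> matching the
    two bases.\<close>
  define w :: "_ \<times> nat \<Rightarrow> complex" where "w p = (if snd p < k \<and> fst p = h (snd p) then 1 else 0)" for p
  have "psd (I \<times> {..<k}) (\<lambda>p q. w p * cnj (w q))"
    unfolding psd_pd using pd_rank1 hI by (auto simp: opers_def w_def)
  then have "psd (J \<times> {..<k}) (ext_id E (\<lambda>p q. w p * cnj (w q)))" by (rule channel_cp[OF E])
  then have p: "pd (J \<times> {..<k}) (ext_id E (\<lambda>p q. w p * cnj (w q)))" by (simp add: psd_pd)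
  define g where "g = inv_into {..<k} h"
  have g: "g i < k" "h (g i) = i" if "i \<in> I" for i
    using that h inv_into_into[of i h "{..<k}"] f_inv_into_f[of i h "{..<k}"]
    by (auto simp: g_def bij_betw_def)
  have "pd (J \<times> I) (\<lambda>p q. ext_id E (\<lambda>p q. w p * cnj (w q)) (fst p, g (snd p)) (fst q, g (snd q)))"
    by (rule pd_pullback[OF _ _ _ p]) (use I J g in auto)
  then show ?thesis
  proof (rule pd_cong[rotated])
    fix p q assume "p \<in> J \<times> I" "q \<in> J \<times> I"
    then have "(\<lambda>i i'. w (i, g (snd p)) * cnj (w (i', g (snd q)))) = unit_op (snd p) (snd q)"
      using g by (auto simp: w_def unit_op_def fun_eq_iff)
    then show "ext_id E (\<lambda>p q. w p * cnj (w q)) (fst p, g (snd p)) (fst q, g (snd q)) = choi E p q"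
      by (simp add: ext_id_def choi_def)
  qed
qed

lemma channel_choi_tr:
  assumes E: "channel I J E" and I: "finite I" and i: "i \<in> I" "i' \<in> I"
  shows "(\<Sum>j\<in>J. E (unit_op i i') j j) = (if i = i' then 1 else 0)"
proof -
  have "tr I (unit_op i i') = (\<Sum>k\<in>I. if k = i then if i = i' then 1 else 0 else 0)"
    unfolding tr_def by (intro sum.cong) (auto simp: unit_op_def)
  then show ?thesis using channel_tr[OF E unit_op_opers[OF i]] I i by (simp add: tr_def)
qed

text \<open>Extending a map by a reference is a Schur product of pullbacks of the input and of the
  Choi matrix, followed by contracting the input labels. The reference may have any label
  type.\<close>

lemma pd_ext:
  assumes fin: "finite I" "finite J" "finite R" and X: "pd (I \<times> R) X" and c: "pd (J \<times> I) c"
  shows "pd (J \<times> R) (\<lambda>p q. \<Sum>i\<in>I. \<Sum>i'\<in>I. X (i, snd p) (i', snd q) * c (fst p, i) (fst q, i'))"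
proof -
  let ?f = "\<lambda>s. (snd s, snd (fst s))" and ?g = "\<lambda>s. (fst (fst s), snd s)"
  have "pd ((J \<times> R) \<times> I) (\<lambda>s t. X (?f s) (?f t) * c (?g s) (?g t))"
    by (intro pd_schur pd_pullback[OF _ _ _ X] pd_pullback[OF _ _ _ c]) (use fin in auto)
  from pd_contract[OF _ fin(1) this] show ?thesis using fin by simp
qed

text \<open>The constructive half of Choi's theorem: \<open>c\<close> is the kernel of
  \<open>E\<close> on matrix units, and a positive Choi matrix gives complete positivity.
  Relabellings, tensor products and tensor powers are shown to be channels through it.\<close>

lemma channelI:
  assumes fin: "finite I" "finite J"
    and E: "\<And>X. X \<in> opers I \<Longrightarrow> E X = (\<lambda>j j'. if j \<in> J \<and> j' \<in> J then \<Sum>i\<in>I. \<Sum>i'\<in>I. X i i' * c i i' j j' else 0)"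
    and pd: "pd (J \<times> I) (\<lambda>p q. c (snd p) (snd q) (fst p) (fst q))"
    and tp: "\<And>i i'. i \<in> I \<Longrightarrow> i' \<in> I \<Longrightarrow> (\<Sum>j\<in>J. c i i' j j) = (if i = i' then 1 else 0)"
  shows "channel I J E"
  unfolding channel_def
proof (intro conjI ballI allI impI)
  fix X Y :: "'a oper" and a b
  assume X: "X \<in> opers I"
  show "E X \<in> opers J" unfolding E[OF X] by (auto simp: opers_def)
  have "tr J (E X) = (\<Sum>j\<in>J. \<Sum>i\<in>I. \<Sum>i'\<in>I. X i i' * c i i' j j)"
    unfolding E[OF X] tr_def by simp
  also have "\<dots> = (\<Sum>i\<in>I. \<Sum>i'\<in>I. X i i' * (\<Sum>j\<in>J. c i i' j j))"
    unfolding sum_distrib_left by (subst sum.swap) (subst sum.swap[of _ J], rule refl)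
  also have "\<dots> = (\<Sum>i\<in>I. \<Sum>i'\<in>I. if i' = i then X i i else 0)"
    by (intro sum.cong refl) (auto simp: tp)
  finally show "tr J (E X) = tr I X" using fin by (simp add: tr_def)
  assume Y: "Y \<in> opers I"
  have XY: "(\<lambda>i i'. a * X i i' + b * Y i i') \<in> opers I" using X Y by (simp add: opers_def)
  show "E (\<lambda>i i'. a * X i i' + b * Y i i') = (\<lambda>j j'. a * E X j j' + b * E Y j j')"
    unfolding E[OF X] E[OF Y] E[OF XY]
    by (auto simp: fun_eq_iff sum_distrib_left sum.distrib algebra_simps)
next
  fix k :: nat and X assume X: "psd (I \<times> {..<k}) X"
  have sl: "(\<lambda>i i'. X (i, r) (i', r')) \<in> opers I" for r r'
    using X by (auto simp: psd_pd opers_def)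
  have ext: "ext_id E X = (\<lambda>p q. if fst p \<in> J \<and> fst q \<in> J
     then \<Sum>i\<in>I. \<Sum>i'\<in>I. X (i, snd p) (i', snd q) * c i i' (fst p) (fst q) else 0)"
    by (simp add: ext_id_def E[OF sl] split_def)
  show "psd (J \<times> {..<k}) (ext_id E X)"
    unfolding psd_pd
  proof
    show "ext_id E X \<in> opers (J \<times> {..<k})"
      using X unfolding ext by (auto simp: opers_def psd_pd intro!: sum.neutral)
    have "pd (J \<times> {..<k}) (\<lambda>p q. \<Sum>i\<in>I. \<Sum>i'\<in>I. X (i, snd p) (i', snd q) * c i i' (fst p) (fst q))"
      using pd_ext[OF fin _ _ pd, of "{..<k}" X] X by (simp add: psd_pd)
    then show "pd (J \<times> {..<k}) (ext_id E X)" by (rule pd_cong[rotated]) (auto simp: ext)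
  qed
qed

lemma channel_cong:
  assumes "channel I J E" "\<And>X. X \<in> opers I \<Longrightarrow> E' X = E X"
  shows "channel I J E'"
proof -
  have "psd (J \<times> {..<k}) (ext_id E' X)" if X: "psd (I \<times> {..<k}) X" for k :: nat and X
  proof -
    have "(\<lambda>i i'. X (i, r) (i', r')) \<in> opers I" for r r' using X by (auto simp: psd_pd opers_def)
    then have "ext_id E' X = ext_id E X" using assms(2) by (simp add: ext_id_def)
    then show ?thesis using channel_cp[OF assms(1) X] by simp
  qed
  moreover have "(\<lambda>i i'. a * X i i' + b * Y i i') \<in> opers I" if "X \<in> opers I" "Y \<in> opers I" for a b X Y
    using that by (simp add: opers_def)
  ultimately show ?thesis
    unfolding channel_def using assms(2) channel_opers[OF assms(1)] channel_tr[OF assms(1)] channel_lin[OF assms(1)]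
    by simp
qed

lemma channel_comp:
  assumes E: "channel I J E" and F: "channel J K F"
  shows "channel I K (\<lambda>X. F (E X))"
  unfolding channel_def
proof (intro conjI ballI allI impI)
  fix X Y :: "'a oper" and a b
  assume X: "X \<in> opers I"
  show "F (E X) \<in> opers K" by (intro channel_opers[OF F] channel_opers[OF E] X)
  show "tr K (F (E X)) = tr I X" using channel_tr[OF E X] channel_tr[OF F channel_opers[OF E X]] by simp
  assume Y: "Y \<in> opers I"
  show "F (E (\<lambda>i i'. a * X i i' + b * Y i i')) = (\<lambda>j j'. a * F (E X) j j' + b * F (E Y) j j')"
    unfolding channel_lin[OF E X Y] by (intro channel_lin[OF F] channel_opers[OF E] X Y)
next
  fix k :: nat and X assume X: "psd (I \<times> {..<k}) X"
  have "ext_id (\<lambda>X. F (E X)) X = ext_id F (ext_id E X)" by (simp add: ext_id_def)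
  then show "psd (K \<times> {..<k}) (ext_id (\<lambda>X. F (E X)) X)"
    using channel_cp[OF F channel_cp[OF E X]] by simp
qed

section \<open>Relabelling, preparation and tensor product channels\<close>

definition relabel :: "'k set \<Rightarrow> ('k \<Rightarrow> 'j) \<Rightarrow> 'j oper \<Rightarrow> 'k oper" where
  "relabel K g X = (\<lambda>k k'. if k \<in> K \<and> k' \<in> K then X (g k) (g k') else 0)"

lemma channel_relabel:
  assumes g: "bij_betw g K J" and J: "finite J"
  shows "channel J K (relabel K g)"
proof (rule channelI[where c = "\<lambda>j j' k k'. (if g k = j then 1 else 0) * (if g k' = j' then 1 else 0)"])
  show K: "finite K" "finite J" using g J bij_betw_finite by blast+
  have gJ: "g k \<in> J" if "k \<in> K" for k using g that by (auto simp: bij_betw_def)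
  show "relabel K g X = (\<lambda>k k'. if k \<in> K \<and> k' \<in> K then \<Sum>j\<in>J. \<Sum>j'\<in>J.
      X j j' * ((if g k = j then 1 else 0) * (if g k' = j' then 1 else 0)) else 0)" for X
    using J gJ by (auto simp: relabel_def fun_eq_iff if_distrib[of "\<lambda>x. _ * x"] cong: if_cong)
  show "pd (K \<times> J) (\<lambda>p q. (if g (fst p) = snd p then 1 else 0) * (if g (fst q) = snd q then 1 else 0))"
    using pd_rank1[of "K \<times> J" "\<lambda>p. if g (fst p) = snd p then 1 else 0"]
    by (simp add: if_distrib[of cnj] cong: if_cong)
  fix j j' assume j: "j \<in> J" "j' \<in> J"
  have "(\<Sum>k\<in>K. (if g k = j then 1 else 0) * (if g k = j' then 1 else 0)) =
      (\<Sum>i\<in>J. (if i = j then 1 else 0) * (if i = j' then 1 else (0::complex)))"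
    by (rule sum.reindex_bij_betw[OF g])
  then show "(\<Sum>k\<in>K. (if g k = j then 1 else 0) * (if g k = j' then 1 else 0)) = (if j = j' then 1 else (0::complex))"
    using J j by (simp add: if_distrib[of "\<lambda>x. x * _"] cong: if_cong)
qed

lemma channel_exists:
  assumes I: "finite I" and J: "finite J" "J \<noteq> {}"
  obtains E where "channel I J E"
proof -
  obtain j0 where j0: "j0 \<in> J" using J by blast
  \<comment> \<open>The channel that discards its input and prepares the basis state
    \<open>j0\<close>.\<close>
  define c :: "'a \<Rightarrow> 'a \<Rightarrow> 'b \<Rightarrow> 'b \<Rightarrow> complex" where
    "c i i' j j' = (if i = i' then 1 else 0) * ((if j = j0 then 1 else 0) * (if j' = j0 then 1 else 0))" for i i' j j'
  have "pd I (\<lambda>i i'. if i = i' then 1 else 0)"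
    unfolding pd_def
  proof
    fix v :: "_ \<Rightarrow> complex"
    have "(\<Sum>i\<in>I. \<Sum>j\<in>I. cnj (v i) * (if i = j then 1 else 0) * v j) = ip I v v"
      using I by (simp add: ip_def if_distrib[of "\<lambda>x. _ * x"] if_distrib[of "\<lambda>x. x * _"] cong: if_cong)
    then show "(\<Sum>i\<in>I. \<Sum>j\<in>I. cnj (v i) * (if i = j then 1 else 0) * v j) \<in> \<real>\<^sub>\<ge>\<^sub>0"
      by (simp only: ip_self nonneg_Reals_of_real_iff) (simp add: sum_nonneg)
  qed
  then have 1: "pd (J \<times> I) (\<lambda>p q. if snd p = snd q then 1 else 0)"
    by (rule pd_pullback[rotated 3]) (use I J in auto)
  have 2: "pd (J \<times> I) (\<lambda>p q. (if fst p = j0 then 1 else 0) * (if fst q = j0 then 1 else 0))"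
    using pd_rank1[of "J \<times> I" "\<lambda>p. if fst p = j0 then 1 else 0"]
    by (simp add: if_distrib[of cnj] cong: if_cong)
  have "channel I J (\<lambda>X j j'. if j \<in> J \<and> j' \<in> J then \<Sum>i\<in>I. \<Sum>i'\<in>I. X i i' * c i i' j j' else 0)"
  proof (rule channelI[OF I J(1) refl])
    show "pd (J \<times> I) (\<lambda>p q. c (snd p) (snd q) (fst p) (fst q))"
      unfolding c_def by (rule pd_schur[OF _ 1 2]) (use I J in auto)
    show "(\<Sum>j\<in>J. c i i' j j) = (if i = i' then 1 else 0)" for i i'
      using J j0 by (simp add: c_def if_distrib[of "\<lambda>x. x * _"] flip: sum_distrib_left cong: if_cong)
  qed
  then show ?thesis by (rule that)
qed

text \<open>The tensor product of two maps between relabelled composite systems. It is given on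
  matrix units because a general \<open>Z\<close> is not a product operator.\<close>

definition tens_chan :: "'k set \<Rightarrow> 'l set \<Rightarrow> ('k \<Rightarrow> 'i) \<Rightarrow> ('k \<Rightarrow> 'i') \<Rightarrow> ('l \<Rightarrow> 'j) \<Rightarrow> ('l \<Rightarrow> 'j')
    \<Rightarrow> ('i oper \<Rightarrow> 'j oper) \<Rightarrow> ('i' oper \<Rightarrow> 'j' oper) \<Rightarrow> 'k oper \<Rightarrow> 'l oper" where
  "tens_chan K L f g f' g' E E' Z = (\<lambda>l l'. if l \<in> L \<and> l' \<in> L then \<Sum>k\<in>K. \<Sum>k'\<in>K. Z k k' *
     (E (unit_op (f k) (f k')) (f' l) (f' l') * E' (unit_op (g k) (g k')) (g' l) (g' l')) else 0)"

text \<open>The Choi matrix is the Schur product of pullbacks of the two Choi matrices, and the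
  trace condition factors along the splitting.\<close>

lemma channel_tens_chan:
  assumes fin: "finite I" "finite I'" "finite J" "finite J'"
    and E: "channel I J E" "channel I' J' E'" and s: "splitting K I I' f g" "splitting L J J' f' g'"
  shows "channel K L (tens_chan K L f g f' g' E E')"
proof (rule channelI)
  show K: "finite K" "finite L" using splitting_finite s fin by blast+
  show "tens_chan K L f g f' g' E E' X = (\<lambda>l l'. if l \<in> L \<and> l' \<in> L then \<Sum>k\<in>K. \<Sum>k'\<in>K. X k k' *
     (E (unit_op (f k) (f k')) (f' l) (f' l') * E' (unit_op (g k) (g k')) (g' l) (g' l')) else 0)" for X
    by (rule tens_chan_def)
  let ?f = "\<lambda>p. (f' (fst p), f (snd p))" and ?g = "\<lambda>p. (g' (fst p), g (snd p))"
  have "pd (L \<times> K) (\<lambda>p q. choi E (?f p) (?f q) * choi E' (?g p) (?g q))"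
    by (intro pd_schur pd_pullback[OF _ _ _ channel_choi[OF E(1)]] pd_pullback[OF _ _ _ channel_choi[OF E(2)]])
      (use fin K splitting_mem[OF s(1)] splitting_mem[OF s(2)] in auto)
  then show "pd (L \<times> K) (\<lambda>p q. E (unit_op (f (snd p)) (f (snd q))) (f' (fst p)) (f' (fst q)) *
      E' (unit_op (g (snd p)) (g (snd q))) (g' (fst p)) (g' (fst q)))"
    by (simp add: choi_def)
  fix k k' assume k: "k \<in> K" "k' \<in> K"
  show "(\<Sum>l\<in>L. E (unit_op (f k) (f k')) (f' l) (f' l) * E' (unit_op (g k) (g k')) (g' l) (g' l)) =
      (if k = k' then 1 else 0)"
    unfolding splitting_sum_prod[OF s(2), of "\<lambda>j. E (unit_op (f k) (f k')) j j" "\<lambda>j. E' (unit_op (g k) (g k')) j j"] splitting_eq[OF s(1) k]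
    using splitting_mem[OF s(1)] k channel_choi_tr[OF E(1)] channel_choi_tr[OF E(2)] fin by simp
qed

lemma tens_chan_tens:
  assumes fin: "finite I" "finite I'"
    and E: "channel I J E" "channel I' J' E'" and s: "splitting K I I' f g" "splitting L J J' f' g'"
    and X: "X \<in> opers I" "X' \<in> opers I'"
  shows "tens_chan K L f g f' g' E E' (tens K f g X X') = tens L f' g' (E X) (E' X')"
proof -
  have "(\<Sum>k\<in>K. \<Sum>k'\<in>K. tens K f g X X' k k' *
       (E (unit_op (f k) (f k')) (f' l) (f' l') * E' (unit_op (g k) (g k')) (g' l) (g' l'))) =
     E X (f' l) (f' l') * E' X' (g' l) (g' l')" (is "?L = _") for l l'
  proof -
    let ?c = "\<lambda>i i'. X i i' * E (unit_op i i') (f' l) (f' l')"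
    let ?c' = "\<lambda>i i'. X' i i' * E' (unit_op i i') (g' l) (g' l')"
    have "?L = (\<Sum>k\<in>K. \<Sum>k'\<in>K. ?c (f k) (f k') * ?c' (g k) (g k'))"
      by (intro sum.cong refl) (simp add: tens_def)
    also have "\<dots> = (\<Sum>k\<in>K. (\<Sum>i'\<in>I. ?c (f k) i') * (\<Sum>i'\<in>I'. ?c' (g k) i'))"
      by (intro sum.cong refl splitting_sum_prod[OF s(1)])
    also have "\<dots> = (\<Sum>i\<in>I. \<Sum>i'\<in>I. ?c i i') * (\<Sum>i\<in>I'. \<Sum>i'\<in>I'. ?c' i i')"
      by (rule splitting_sum_prod[OF s(1)])
    finally show ?thesis unfolding channel_apply[OF E(1) fin(1) X(1)] channel_apply[OF E(2) fin(2) X(2)] .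
  qed
  then show ?thesis by (simp add: tens_chan_def tens_def fun_eq_iff)
qed

subsection \<open>Words\<close>

lemma words_finite: "finite I \<Longrightarrow> finite (words I n)"
  unfolding words_def using finite_lists_length_eq[of I n] by (simp add: conj_commute)

lemma words_nonempty: "I \<noteq> {} \<Longrightarrow> words I n \<noteq> {}"
proof -
  assume "I \<noteq> {}"
  then obtain i where "i \<in> I" by blast
  then have "replicate n i \<in> words I n" by (auto simp: words_def)
  then show ?thesis by blast
qed

lemma words_nth: "xs \<in> words I n \<Longrightarrow> k < n \<Longrightarrow> xs ! k \<in> I"
  by (auto simp: words_def)

lemma splitting_words_Suc: "splitting (words I (Suc n)) I (words I n) hd tl"
  unfolding splitting_def
  by (rule bij_betwI[where g = "\<lambda>(x, xs). x # xs"]) (auto simp: words_def length_Suc_conv)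

lemma splitting_words_add: "splitting (words I (m + n)) (words I m) (words I n) (take m) (drop m)"
  unfolding splitting_def
  by (rule bij_betwI[where g = "\<lambda>(xs, ys). xs @ ys"]) (auto simp: words_def dest: in_set_takeD in_set_dropD)

lemma splitting_words_zip:
  "splitting (words (I \<times> J) n) (words I n) (words J n) (map fst) (map snd)"
  unfolding splitting_def
  by (rule bij_betwI[where g = "\<lambda>(xs, ys). zip xs ys"])
    (auto simp: words_def zip_map_fst_snd subset_iff dest: set_zip_leftD set_zip_rightD)

lemma bij_betw_zip: "bij_betw (\<lambda>(xs, ys). zip xs ys) (words I n \<times> words J n) (words (I \<times> J) n)"
  by (rule bij_betwI[where g = "\<lambda>zs. (map fst zs, map snd zs)"])
    (auto simp: words_def zip_map_fst_snd subset_iff dest: set_zip_leftD set_zip_rightD)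

lemma sum_words_prod:
  fixes F :: "nat \<Rightarrow> 'i \<Rightarrow> 'b :: comm_semiring_1"
  shows "(\<Sum>xs\<in>words I n. \<Prod>k<n. F k (xs ! k)) = (\<Prod>k<n. \<Sum>x\<in>I. F k x)"
proof (induction n arbitrary: F)
  case 0
  have "words I 0 = {[]}" by (auto simp: words_def)
  then show ?case by simp
next
  case (Suc n)
  have "(\<Sum>xs\<in>words I (Suc n). \<Prod>k<Suc n. F k (xs ! k)) =
      (\<Sum>xs\<in>words I (Suc n). F 0 (hd xs) * (\<Prod>k<n. F (Suc k) (tl xs ! k)))"
    unfolding prod.lessThan_Suc_shift
    by (intro sum.cong refl) (auto simp: words_def length_Suc_conv)
  also have "\<dots> = (\<Sum>x\<in>I. F 0 x) * (\<Sum>xs\<in>words I n. \<Prod>k<n. F (Suc k) (xs ! k))"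
    by (rule splitting_sum_prod[OF splitting_words_Suc])
  also have "\<dots> = (\<Sum>x\<in>I. F 0 x) * (\<Prod>k<n. \<Sum>x\<in>I. F (Suc k) x)"
    by (simp only: Suc.IH[of "\<lambda>k. F (Suc k)"])
  finally show ?case by (simp only: prod.lessThan_Suc_shift)
qed

lemma channel_map_pow:
  assumes I: "finite I" and J: "finite J" and E: "channel I J E"
  shows "channel (words I n) (words J n) (map_pow I n E)"
proof (rule channelI)
  show "finite (words I n)" "finite (words J n)" using I J words_finite by blast+
  let ?c = "\<lambda>xs xs' ys ys'. \<Prod>k<n. E (unit_op (xs ! k) (xs' ! k)) (ys ! k) (ys' ! k)"
  show "map_pow I n E X = (\<lambda>ys ys'. if ys \<in> words J n \<and> ys' \<in> words J n
     then \<Sum>xs\<in>words I n. \<Sum>xs'\<in>words I n. X xs xs' * ?c xs xs' ys ys' else 0)" for X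
  proof (intro ext)
    fix ys ys'
    show "map_pow I n E X ys ys' = (if ys \<in> words J n \<and> ys' \<in> words J n
       then \<Sum>xs\<in>words I n. \<Sum>xs'\<in>words I n. X xs xs' * ?c xs xs' ys ys' else 0)"
    \<comment> \<open>\<open>map_pow\<close> tests lengths only. If some letter lies outside
      \<open>J\<close>, the factor at that position vanishes because \<open>E\<close> maps into
      \<open>opers J\<close>.\<close>
    proof (cases "length ys = n \<and> length ys' = n \<and> \<not> (ys \<in> words J n \<and> ys' \<in> words J n)")
      case True
      then obtain k where k: "k < n" "ys ! k \<notin> J \<or> ys' ! k \<notin> J"
        by (auto simp: words_def subset_iff in_set_conv_nth)
      have "?c xs xs' ys ys' = 0" if "xs \<in> words I n" "xs' \<in> words I n" for xs xs'
      proof (rule prod_zero)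
        have "E (unit_op (xs ! k) (xs' ! k)) \<in> opers J"
          by (intro channel_opers[OF E] unit_op_opers words_nth[OF that(1) k(1)] words_nth[OF that(2) k(1)])
        then show "\<exists>k\<in>{..<n}. E (unit_op (xs ! k) (xs' ! k)) (ys ! k) (ys' ! k) = 0"
          using k by (auto simp: opers_def intro!: bexI[of _ k])
      qed simp
      then show ?thesis using True by (simp add: map_pow_def del: prod_zero_iff)
    next
      case False
      then show ?thesis by (auto simp: map_pow_def words_def)
    qed
  qed
  have "pd (words J n \<times> words I n) (\<lambda>p q. \<Prod>k<n. choi E (fst p ! k, snd p ! k) (fst q ! k, snd q ! k))"
    by (intro pd_prod pd_pullback[OF _ _ _ channel_choi[OF E]])
      (use I J in \<open>auto simp: words_finite words_nth\<close>)
  then show "pd (words J n \<times> words I n) (\<lambda>p q. ?c (snd p) (snd q) (fst p) (fst q))"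
    by (simp add: choi_def)
  fix xs xs' assume xs: "xs \<in> words I n" "xs' \<in> words I n"
  have "(\<Sum>ys\<in>words J n. ?c xs xs' ys ys) = (\<Prod>k<n. \<Sum>y\<in>J. E (unit_op (xs ! k) (xs' ! k)) y y)"
    by (rule sum_words_prod)
  also have "\<dots> = (\<Prod>k<n. if xs ! k = xs' ! k then 1 else 0)"
    using xs by (intro prod.cong refl channel_choi_tr[OF E I]) (auto simp: words_nth)
  also have "\<dots> = (if xs = xs' then 1 else 0)"
  proof (cases "xs = xs'")
    case False
    then obtain k where "k < n" "xs ! k \<noteq> xs' ! k"
      using xs nth_equalityI[of xs xs'] by (auto simp: words_def)
    then have "(\<Prod>k<n. if xs ! k = xs' ! k then 1 else 0) = (0::complex)"
      by (intro prod_zero) auto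
    then show ?thesis using False by simp
  qed simp
  finally show "(\<Sum>ys\<in>words J n. ?c xs xs' ys ys) = (if xs = xs' then 1 else 0)" .
qed

text \<open>\<open>unzip_op\<close> tests only that lengths agree; for operators on words of pairs
  this is enough, because zipping lists with a foreign letter or a wrong length leaves the label
  set.\<close>

lemma unzip_op_relabel:
  assumes "X \<in> opers (words (I \<times> J) n)"
  shows "unzip_op X = relabel (words I n \<times> words J n) (\<lambda>(xs, ys). zip xs ys) X"
proof -
  have "X (zip xs ys) (zip xs' ys') = 0"
    if "length xs = length ys" "length xs' = length ys'"
      "\<not> ((xs, ys) \<in> words I n \<times> words J n \<and> (xs', ys') \<in> words I n \<times> words J n)" for xs ys xs' ys'
  proof -
    have "(zs, ws) \<in> words I n \<times> words J n" if "zip zs ws \<in> words (I \<times> J) n" "length zs = length ws" for zs ws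
    proof -
      have "fst ` set (zip zs ws) \<subseteq> I" "snd ` set (zip zs ws) \<subseteq> J" using that by (auto simp: words_def)
      then have "set zs \<subseteq> I" "set ws \<subseteq> J" using that(2) by (metis list.set_map map_fst_zip, metis list.set_map map_snd_zip that(2))
      then show ?thesis using that by (auto simp: words_def)
    qed
    then show ?thesis using assms that unfolding opers_def by blast
  qed
  moreover have "length xs = length ys" if "(xs, ys) \<in> words I n \<times> words J n" for xs ys
    using that by (auto simp: words_def)
  ultimately show ?thesis
    unfolding unzip_op_def relabel_def fun_eq_iff split_def by (metis (no_types, lifting) prod.collapse)
qed

lemma zip_op_relabel:
  assumes "X \<in> opers (words I n \<times> words J n)"
  shows "zip_op X = relabel (words (I \<times> J) n) (\<lambda>zs. (map fst zs, map snd zs)) X"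
proof -
  have "zs \<in> words (I \<times> J) n" if "(map fst zs, map snd zs) \<in> words I n \<times> words J n" for zs
    using that by (auto simp: words_def image_subset_iff)
  then have "X (map fst zs, map snd zs) (map fst zs', map snd zs') = 0"
    if "\<not> (zs \<in> words (I \<times> J) n \<and> zs' \<in> words (I \<times> J) n)" for zs zs'
    using assms that unfolding opers_def by blast
  then show ?thesis by (auto simp: zip_op_def relabel_def fun_eq_iff)
qed

lemma channel_unzip: "finite I \<Longrightarrow> finite J \<Longrightarrow> channel (words (I \<times> J) n) (words I n \<times> words J n) unzip_op"
  by (rule channel_cong[OF channel_relabel[OF bij_betw_zip]]) (simp_all add: words_finite unzip_op_relabel)

lemma channel_zip: "finite I \<Longrightarrow> finite J \<Longrightarrow> channel (words I n \<times> words J n) (words (I \<times> J) n) zip_op"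
  by (rule channel_cong[OF channel_relabel[OF splitting_words_zip[unfolded splitting_def]]])
    (simp_all add: words_finite zip_op_relabel)

lemma superchannel_pow:
  assumes fin: "finite A" "finite B" "finite C" "finite D" and \<Theta>: "superchannel A B C D \<Theta>"
  shows "superchannel (words A n) (words B n) (words C n) (words D n) (super_pow B C n \<Theta>)"
proof -
  have S: "finite (mem \<Theta>)" "mem \<Theta> \<noteq> {}" and E: "channel C (A \<times> mem \<Theta>) (enc \<Theta>)"
    and F: "channel (B \<times> mem \<Theta>) D (dec \<Theta>)" using \<Theta> by (auto simp: superchannel_def system_def)
  have "channel (words C n) (words A n \<times> words (mem \<Theta>) n) (\<lambda>X. unzip_op (map_pow C n (enc \<Theta>) X))"
    by (rule channel_comp[OF channel_map_pow[OF _ _ E] channel_unzip]) (use fin S in auto)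
  moreover have "channel (words B n \<times> words (mem \<Theta>) n) (words D n) (\<lambda>X. map_pow (B \<times> mem \<Theta>) n (dec \<Theta>) (zip_op X))"
    by (rule channel_comp[OF channel_zip channel_map_pow[OF _ _ F]]) (use fin S in auto)
  ultimately show ?thesis
    using S by (simp add: superchannel_def system_def super_pow_def words_finite words_nonempty)
qed

subsection \<open>States\<close>

lemma stateI: "X \<in> opers I \<Longrightarrow> pd I X \<Longrightarrow> tr I X = 1 \<Longrightarrow> state I X"
  by (simp add: state_def psd_pd)

lemma state_opers: "state I X \<Longrightarrow> X \<in> opers I"
  by (simp add: state_def psd_pd)

text \<open>Inside a superchannel the reference consists of memory words and further labels rather
  than numbers below some \<open>k\<close>, so positivity is taken from the Choi matrix.\<close>

lemma state_ext_id:
  assumes fin: "finite I" "finite J" "finite R" and E: "channel I J E" and X: "state (I \<times> R) X"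
  shows "state (J \<times> R) (ext_id E X)"
proof (rule stateI)
  have sl: "(\<lambda>i i'. X (i, r) (i', r')) \<in> opers I" for r r'
    using state_opers[OF X] by (auto simp: opers_def)
  have ext: "ext_id E X p q = (\<Sum>i\<in>I. \<Sum>i'\<in>I. X (i, snd p) (i', snd q) * choi E (fst p, i) (fst q, i'))" for p q
    by (simp add: ext_id_def channel_apply[OF E fin(1) sl] choi_def split_def)
  show "pd (J \<times> R) (ext_id E X)"
    using pd_ext[OF fin _ channel_choi[OF E fin(1,2)], of X] X ext[abs_def]
    by (simp add: state_def psd_pd)
  have "E (\<lambda>i i'. X (i, r) (i', r')) j j' = 0" if "\<not> ((j, r) \<in> J \<times> R \<and> (j', r') \<in> J \<times> R)" for j r j' r'
  proof (cases "r \<in> R \<and> r' \<in> R")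
    case True
    then show ?thesis using channel_opers[OF E sl, of r r'] that by (auto simp: opers_def)
  next
    case False
    then have "(\<lambda>i i'. X (i, r) (i', r')) = (\<lambda>_ _. 0)" using state_opers[OF X] by (auto simp: opers_def)
    then show ?thesis by (simp add: channel_zero[OF E])
  qed
  then show "ext_id E X \<in> opers (J \<times> R)" by (auto simp: opers_def ext_id_def)
  have "tr (J \<times> R) (ext_id E X) = (\<Sum>r\<in>R. tr J (E (\<lambda>i i'. X (i, r) (i', r))))"
    unfolding tr_def sum_Times ext_id_def by (subst sum.swap) simp
  also have "\<dots> = (\<Sum>r\<in>R. tr I (\<lambda>i i'. X (i, r) (i', r)))"
    by (simp only: channel_tr[OF E sl])
  also have "\<dots> = tr (I \<times> R) X"
    unfolding tr_def sum_Times by (rule sum.swap)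
  finally show "tr (J \<times> R) (ext_id E X) = 1" using X by (simp add: state_def)
qed

lemma state_channel:
  assumes fin: "finite I" "finite J" and E: "channel I J E" and X: "state I X"
  shows "state J (E X)"
proof (rule stateI)
  have o: "X \<in> opers I" by (rule state_opers[OF X])
  show "E X \<in> opers J" by (rule channel_opers[OF E o])
  show "tr J (E X) = 1" using channel_tr[OF E o] X by (simp add: state_def)
  \<comment> \<open>A one-dimensional reference reduces plain positivity to the extended
    form.\<close>
  have 1: "pd (I \<times> {()}) (\<lambda>p q. X (fst p) (fst q))"
    by (rule pd_pullback[of I _ _ X]) (use fin X in \<open>auto simp: state_def psd_pd\<close>)
  have "pd J (\<lambda>j j'. \<Sum>i\<in>I. \<Sum>i'\<in>I. X i i' * choi E (j, i) (j', i'))"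
    using pd_pullback[OF _ _ _ pd_ext[OF fin _ 1 channel_choi[OF E fin]], of J "\<lambda>j. (j, ())"] fin by (simp add: image_subset_iff)
  then show "pd J (E X)" by (simp add: channel_apply[OF E fin(1) o] choi_def)
qed

lemma state_swap:
  assumes fin: "finite I" "finite J" "finite K" and X: "state ((I \<times> J) \<times> K) X"
  shows "state ((I \<times> K) \<times> J) (swap_op X)"
proof -
  have b: "bij_betw (\<lambda>((i, k), j). ((i, j), k)) ((I \<times> K) \<times> J) ((I \<times> J) \<times> K)"
    by (rule bij_betwI[where g = "\<lambda>((i, j), k). ((i, k), j)"]) auto
  have "swap_op X = relabel ((I \<times> K) \<times> J) (\<lambda>((i, k), j). ((i, j), k)) X"
    using state_opers[OF X] by (auto simp: swap_op_def relabel_def opers_def fun_eq_iff)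
  moreover have "state ((I \<times> K) \<times> J) (relabel ((I \<times> K) \<times> J) (\<lambda>((i, k), j). ((i, j), k)) X)"
    by (rule state_channel[OF _ _ channel_relabel[OF b] X]) (use fin in auto)
  ultimately show ?thesis by simp
qed

lemma state_super_apply:
  assumes fin: "finite A" "finite B" "finite C" "finite D" "finite R" "finite Q"
    and \<Theta>: "superchannel A B C D \<Theta>" and N: "channel (A \<times> R) (B \<times> Q) N" and X: "state (C \<times> R) X"
  shows "state (D \<times> Q) (super_apply \<Theta> N X)"
proof -
  have S: "finite (mem \<Theta>)" and E: "channel C (A \<times> mem \<Theta>) (enc \<Theta>)"
    and F: "channel (B \<times> mem \<Theta>) D (dec \<Theta>)" using \<Theta> by (auto simp: superchannel_def system_def)
  show ?thesis unfolding super_apply_def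
    by (intro state_ext_id[OF _ _ _ F] state_swap[of B Q "mem \<Theta>"] state_ext_id[OF _ _ _ N]
        state_swap[of A "mem \<Theta>" R] state_ext_id[OF _ _ _ E] X) (use fin S in auto)
qed

lemma state_oper_pow:
  assumes I: "finite I" and X: "state I X"
  shows "state (words I n) (oper_pow n X)"
proof (rule stateI)
  have o: "X \<in> opers I" by (rule state_opers[OF X])
  show "oper_pow n X \<in> opers (words I n)"
    unfolding opers_def
  proof (rule CollectI, intro allI impI)
    fix xs ys assume h: "xs \<notin> words I n \<or> ys \<notin> words I n"
    show "oper_pow n X xs ys = 0"
    proof (cases "length xs = n \<and> length ys = n")
      case True
      then obtain k where "k < n" "xs ! k \<notin> I \<or> ys ! k \<notin> I"
        using h by (auto simp: words_def subset_iff in_set_conv_nth)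
      then have "\<exists>k\<in>{..<n}. X (xs ! k) (ys ! k) = 0" using o by (auto simp: opers_def)
      then have "(\<Prod>k<n. X (xs ! k) (ys ! k)) = 0" by (intro prod_zero) auto
      then show ?thesis by (simp add: oper_pow_def del: prod_zero_iff)
    qed (auto simp: oper_pow_def simp del: prod_zero_iff)
  qed
  have p: "pd I X" using X by (simp add: state_def psd_pd)
  have "pd (words I n) (\<lambda>xs ys. \<Prod>k<n. X (xs ! k) (ys ! k))"
    by (intro pd_prod pd_pullback[OF _ _ _ p]) (use I in \<open>auto simp: words_finite words_nth\<close>)
  then show "pd (words I n) (oper_pow n X)"
    by (rule pd_cong[rotated]) (auto simp: oper_pow_def words_def)
  have "tr (words I n) (oper_pow n X) = (\<Sum>xs\<in>words I n. \<Prod>k<n. X (xs ! k) (xs ! k))"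
    unfolding tr_def by (intro sum.cong) (auto simp: oper_pow_def words_def)
  also have "\<dots> = (\<Prod>k<n. tr I X)" unfolding tr_def by (rule sum_words_prod)
  finally show "tr (words I n) (oper_pow n X) = 1" using X by (simp add: state_def)
qed

lemma state_product_output:
  assumes fin: "finite A" "finite B" "finite C" "finite D"
    and \<Theta>: "superchannel A B C D \<Theta>" and N: "product_input A B C n r q \<rho> N"
  shows "state (words D n \<times> {..<q}) (product_output B C n \<Theta> \<rho> N)"
  unfolding product_output_def
proof (rule state_super_apply[OF _ _ _ _ _ _ superchannel_pow[OF fin \<Theta>]])
  have st: "state (words (C \<times> {..<r}) n) (oper_pow n \<rho>)"
    by (rule state_oper_pow) (use fin N in \<open>auto simp: product_input_def\<close>)
  show "state (words C n \<times> words {..<r} n) (unzip_op (oper_pow n \<rho>))"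
    by (rule state_channel[OF _ _ channel_unzip st]) (use fin in \<open>auto simp: words_finite\<close>)
  show "channel (words A n \<times> words {..<r} n) (words B n \<times> {..<q}) N"
    using N by (simp add: product_input_def)
qed (use fin in \<open>auto simp: words_finite\<close>)

subsection \<open>Parallel composition of strategies\<close>

text \<open>The condition concerns product operators only. That suffices because the inputs followed
  below are tensor powers, and it is preserved by composition.\<close>

definition tensor_map :: "'i set \<Rightarrow> 'i' set \<Rightarrow> 'k set \<Rightarrow> ('k \<Rightarrow> 'i) \<Rightarrow> ('k \<Rightarrow> 'i') \<Rightarrow> 'l set \<Rightarrow> ('l \<Rightarrow> 'j) \<Rightarrow> ('l \<Rightarrow> 'j')
    \<Rightarrow> ('i oper \<Rightarrow> 'j oper) \<Rightarrow> ('i' oper \<Rightarrow> 'j' oper) \<Rightarrow> ('k oper \<Rightarrow> 'l oper) \<Rightarrow> bool" where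
  "tensor_map I I' K f g L f' g' E E' E12 \<longleftrightarrow>
     (\<forall>X\<in>opers I. \<forall>Y\<in>opers I'. E12 (tens K f g X Y) = tens L f' g' (E X) (E' Y))"

lemma tensor_mapD: "tensor_map I I' K f g L f' g' E E' E12 \<Longrightarrow> X \<in> opers I \<Longrightarrow> Y \<in> opers I' \<Longrightarrow>
    E12 (tens K f g X Y) = tens L f' g' (E X) (E' Y)"
  by (simp add: tensor_map_def)

lemma tens_opers: "tens K f g X Y \<in> opers K"
  by (auto simp: opers_def tens_def)

lemma tens_zero: "tens K f g (\<lambda>_ _. 0) (\<lambda>_ _. 0) = (\<lambda>_ _. 0)"
  by (simp add: tens_def fun_eq_iff)

lemma tensor_map_comp:
  assumes "tensor_map I I' K f g L f' g' E E' E12" "tensor_map J J' L f' g' M f'' g'' F F' F12"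
    and "\<And>X. X \<in> opers I \<Longrightarrow> E X \<in> opers J" "\<And>X. X \<in> opers I' \<Longrightarrow> E' X \<in> opers J'"
  shows "tensor_map I I' K f g M f'' g'' (\<lambda>X. F (E X)) (\<lambda>X. F' (E' X)) (\<lambda>X. F12 (E12 X))"
  using assms by (simp add: tensor_map_def)

lemma ext_id_opers:
  assumes E: "channel I J E" and X: "X \<in> opers (I \<times> R)"
  shows "ext_id E X \<in> opers (J \<times> R)"
proof -
  have sl: "(\<lambda>i i'. X (i, r) (i', r')) \<in> opers I" for r r'
    using X by (auto simp: opers_def)
  have "E (\<lambda>i i'. X (i, r) (i', r')) j j' = 0" if "\<not> ((j, r) \<in> J \<times> R \<and> (j', r') \<in> J \<times> R)" for j r j' r'
  proof (cases "r \<in> R \<and> r' \<in> R")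
    case True
    then show ?thesis using channel_opers[OF E sl, of r r'] that by (auto simp: opers_def)
  next
    case False
    then have "(\<lambda>i i'. X (i, r) (i', r')) = (\<lambda>_ _. 0)" using X by (auto simp: opers_def)
    then show ?thesis by (simp add: channel_zero[OF E])
  qed
  then show "ext_id E X \<in> opers (J \<times> R)" by (auto simp: opers_def ext_id_def)
qed

lemma swap_op_opers: "X \<in> opers ((I \<times> J) \<times> K) \<Longrightarrow> swap_op X \<in> opers ((I \<times> K) \<times> J)"
  unfolding opers_def swap_op_def by fastforce

lemma ext_id_tens:
  assumes t: "tensor_map I I' K f g L f' g' E E' E12" and E: "channel I J E" "channel I' J' E'"
    and X: "X \<in> opers (I \<times> R)" "Y \<in> opers (I' \<times> R')"
  shows "ext_id E12 (tens (K \<times> M) (map_prod f h) (map_prod g k) X Y) =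
    tens (L \<times> M) (map_prod f' h) (map_prod g' k) (ext_id E X) (ext_id E' Y)"
proof -
  have sl: "(\<lambda>i i'. X (i, r) (i', r')) \<in> opers I" "(\<lambda>i i'. Y (i, s) (i', s')) \<in> opers I'" for r r' s s'
    using X by (auto simp: opers_def)
  \<comment> \<open>\<open>E12\<close> is not assumed linear; that it preserves 0 follows because 0
    is a product operator.\<close>
  have zero: "E12 (\<lambda>_ _. 0) = (\<lambda>_ _. 0)"
    using tensor_mapD[OF t opers_zero opers_zero]
    by (simp add: tens_zero channel_zero[OF E(1)] channel_zero[OF E(2)])
  have "E12 (\<lambda>i i'. tens (K \<times> M) (map_prod f h) (map_prod g k) X Y (i, r) (i', r')) l l' =
     tens (L \<times> M) (map_prod f' h) (map_prod g' k) (ext_id E X) (ext_id E' Y) (l, r) (l', r')" for l l' r r'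
  proof (cases "r \<in> M \<and> r' \<in> M")
    case True
    then have "(\<lambda>i i'. tens (K \<times> M) (map_prod f h) (map_prod g k) X Y (i, r) (i', r')) =
       tens K f g (\<lambda>i i'. X (i, h r) (i', h r')) (\<lambda>i i'. Y (i, k r) (i', k r'))"
      by (simp add: tens_def fun_eq_iff)
    then have "E12 (\<lambda>i i'. tens (K \<times> M) (map_prod f h) (map_prod g k) X Y (i, r) (i', r')) =
       tens L f' g' (E (\<lambda>i i'. X (i, h r) (i', h r'))) (E' (\<lambda>i i'. Y (i, k r) (i', k r')))"
      using tensor_mapD[OF t sl] by simp
    then show ?thesis using True by (simp add: tens_def ext_id_def)
  next
    case False
    then have "(\<lambda>i i'. tens (K \<times> M) (map_prod f h) (map_prod g k) X Y (i, r) (i', r')) = (\<lambda>_ _. 0)"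
      by (auto simp: tens_def fun_eq_iff)
    then show ?thesis using False zero by (auto simp: tens_def)
  qed
  then show ?thesis by (simp add: ext_id_def[of E12] fun_eq_iff)
qed

lemma swap_op_tens:
  "swap_op (tens ((K \<times> M) \<times> P) (map_prod (map_prod f h) k) (map_prod (map_prod f' h') k') X Y) =
    tens ((K \<times> P) \<times> M) (map_prod (map_prod f k) h) (map_prod (map_prod f' k') h') (swap_op X) (swap_op Y)"
  by (auto simp: swap_op_def tens_def fun_eq_iff)

text \<open>A product input remains a product through each of the five stages: encoder, swap,
  channel, swap, decoder.\<close>

lemma super_apply_tens:
  assumes \<Theta>: "superchannel A1 B1 C1 D1 \<Theta>1" "superchannel A2 B2 C2 D2 \<Theta>2"
    and N: "channel (A1 \<times> R1) (B1 \<times> Q1) N1" "channel (A2 \<times> R2) (B2 \<times> Q2) N2"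
    and enc: "tensor_map C1 C2 C fC gC (A \<times> S) (map_prod fA fS) (map_prod gA gS) (enc \<Theta>1) (enc \<Theta>2) (enc \<Theta>)"
    and dec: "tensor_map (B1 \<times> mem \<Theta>1) (B2 \<times> mem \<Theta>2) (B \<times> S) (map_prod fB fS) (map_prod gB gS) D fD gD
        (dec \<Theta>1) (dec \<Theta>2) (dec \<Theta>)"
    and tN: "tensor_map (A1 \<times> R1) (A2 \<times> R2) (A \<times> R) (map_prod fA fR) (map_prod gA gR)
        (B \<times> Q) (map_prod fB fQ) (map_prod gB gQ) N1 N2 N"
    and X: "X \<in> opers (C1 \<times> R1)" "Y \<in> opers (C2 \<times> R2)"
  shows "super_apply \<Theta> N (tens (C \<times> R) (map_prod fC fR) (map_prod gC gR) X Y) =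
    tens (D \<times> Q) (map_prod fD fQ) (map_prod gD gQ) (super_apply \<Theta>1 N1 X) (super_apply \<Theta>2 N2 Y)"
proof -
  have E: "channel C1 (A1 \<times> mem \<Theta>1) (enc \<Theta>1)" "channel C2 (A2 \<times> mem \<Theta>2) (enc \<Theta>2)"
    and F: "channel (B1 \<times> mem \<Theta>1) D1 (dec \<Theta>1)" "channel (B2 \<times> mem \<Theta>2) D2 (dec \<Theta>2)"
    using \<Theta> by (auto simp: superchannel_def)
  note o1 = swap_op_opers[OF ext_id_opers[OF E(1) X(1)]] swap_op_opers[OF ext_id_opers[OF E(2) X(2)]]
  note o2 = swap_op_opers[OF ext_id_opers[OF N(1) o1(1)]] swap_op_opers[OF ext_id_opers[OF N(2) o1(2)]]
  show ?thesis
    unfolding super_apply_def ext_id_tens[OF enc E X] swap_op_tens ext_id_tens[OF tN N o1] ext_id_tens[OF dec F o2] ..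
qed

section \<open>Splitting tensor powers along concatenation of words\<close>

lemma prod_lessThan_add: "(\<Prod>k<m + n. h k) = (\<Prod>k<m. h k) * (\<Prod>k<n. h (m + k :: nat))"
  for h :: "nat \<Rightarrow> 'b :: comm_monoid_mult"
  by (induction n) (simp_all add: mult_ac)

lemma oper_pow_add:
  assumes "X \<in> opers I"
  shows "oper_pow (m + n) X = tens (words I (m + n)) (take m) (drop m) (oper_pow m X) (oper_pow n X)"
proof (intro ext)
  fix xs ys
  show "oper_pow (m + n) X xs ys = tens (words I (m + n)) (take m) (drop m) (oper_pow m X) (oper_pow n X) xs ys"
  proof (cases "xs \<in> words I (m + n) \<and> ys \<in> words I (m + n)")
    case True
    then have "length xs = m + n" "length ys = m + n" by (auto simp: words_def)
    then show ?thesis using True by (simp add: oper_pow_def tens_def prod_lessThan_add)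
  next
    case False
    have "oper_pow (m + n) X xs ys = 0"
    proof (cases "length xs = m + n \<and> length ys = m + n")
      case True
      then obtain k where "k < m + n" "xs ! k \<notin> I \<or> ys ! k \<notin> I"
        using False by (auto simp: words_def subset_iff in_set_conv_nth)
      then have "\<exists>k\<in>{..<m + n}. X (xs ! k) (ys ! k) = 0" using assms by (auto simp: opers_def)
      then have "(\<Prod>k<m + n. X (xs ! k) (ys ! k)) = 0" by (intro prod_zero) auto
      then show ?thesis by (simp add: oper_pow_def del: prod_zero_iff)
    qed (auto simp: oper_pow_def simp del: prod_zero_iff)
    then show ?thesis using False by (auto simp: tens_def)
  qed
qed

text \<open>The kernel on \<open>m + n\<close> letters is the product of the kernels on the first
  \<open>m\<close> and the last \<open>n\<close>, so the double sum over words factors.\<close>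

lemma tensor_map_map_pow:
  assumes I: "finite I" and J: "finite J" and E: "channel I J E"
  shows "tensor_map (words I m) (words I n) (words I (m + n)) (take m) (drop m)
    (words J (m + n)) (take m) (drop m) (map_pow I m E) (map_pow I n E) (map_pow I (m + n) E)"
  unfolding tensor_map_def
proof (intro ballI ext)
  fix X Y :: "_ list oper" and zs zs'
  let ?T = "tens (words I (m + n)) (take m) (drop m) X Y"
  show "map_pow I (m + n) E ?T zs zs' =
     tens (words J (m + n)) (take m) (drop m) (map_pow I m E X) (map_pow I n E Y) zs zs'"
  proof (cases "zs \<in> words J (m + n) \<and> zs' \<in> words J (m + n)")
    case True
    then have len: "length zs = m + n" "length zs' = m + n" by (auto simp: words_def)
    define c where "c m xs xs' zs zs' = (\<Prod>k<m. E (unit_op (xs ! k) (xs' ! k)) (zs ! k) (zs' ! k))"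
      for m :: nat and xs xs' zs zs'
    have c: "c (m + n) xs xs' zs zs' = c m (take m xs) (take m xs') (take m zs) (take m zs')
        * c n (drop m xs) (drop m xs') (drop m zs) (drop m zs')" if "xs \<in> words I (m + n)" "xs' \<in> words I (m + n)" for xs xs'
      using that len by (simp add: c_def words_def prod_lessThan_add)
    let ?a = "\<lambda>xs xs'. X xs xs' * c m xs xs' (take m zs) (take m zs')"
    let ?b = "\<lambda>xs xs'. Y xs xs' * c n xs xs' (drop m zs) (drop m zs')"
    have "map_pow I (m + n) E ?T zs zs' =
       (\<Sum>xs\<in>words I (m + n). \<Sum>xs'\<in>words I (m + n). ?T xs xs' * c (m + n) xs xs' zs zs')"
      using len by (simp add: map_pow_def c_def)
    also have "\<dots> = (\<Sum>xs\<in>words I (m + n). \<Sum>xs'\<in>words I (m + n).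
        ?a (take m xs) (take m xs') * ?b (drop m xs) (drop m xs'))"
      by (intro sum.cong refl) (simp add: c tens_def)
    also have "\<dots> = (\<Sum>xs\<in>words I (m + n). (\<Sum>xs'\<in>words I m. ?a (take m xs) xs') * (\<Sum>xs'\<in>words I n. ?b (drop m xs) xs'))"
      by (intro sum.cong refl splitting_sum_prod[OF splitting_words_add])
    also have "\<dots> = (\<Sum>xs\<in>words I m. \<Sum>xs'\<in>words I m. ?a xs xs') * (\<Sum>xs\<in>words I n. \<Sum>xs'\<in>words I n. ?b xs xs')"
      by (rule splitting_sum_prod[OF splitting_words_add])
    finally show ?thesis using True len by (simp add: tens_def map_pow_def c_def)
  next
    case False
    have "map_pow I (m + n) E ?T \<in> opers (words J (m + n))"
      by (rule channel_opers[OF channel_map_pow[OF I J E] tens_opers])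
    then show ?thesis using False by (auto simp: tens_def opers_def)
  qed
qed

lemma tensor_map_unzip:
  "tensor_map (words (I \<times> J) m) (words (I \<times> J) n) (words (I \<times> J) (m + n)) (take m) (drop m)
    (words I (m + n) \<times> words J (m + n)) (map_prod (take m) (take m)) (map_prod (drop m) (drop m))
    unzip_op unzip_op unzip_op"
  unfolding tensor_map_def unzip_op_relabel[OF tens_opers]
proof (intro ballI ext)
  fix X Y :: "_ list oper" and p q
  have z: "zip (fst p) (snd p) \<in> words (I \<times> J) (m + n)" "length (fst p) = m + n" "length (snd p) = m + n"
    if "p \<in> words I (m + n) \<times> words J (m + n)" for p
    using that by (auto simp: words_def subset_iff dest: set_zip_leftD set_zip_rightD)
  show "relabel (words I (m + n) \<times> words J (m + n)) (\<lambda>(xs, ys). zip xs ys)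
      (tens (words (I \<times> J) (m + n)) (take m) (drop m) X Y) p q =
    tens (words I (m + n) \<times> words J (m + n)) (map_prod (take m) (take m)) (map_prod (drop m) (drop m))
      (unzip_op X) (unzip_op Y) p q"
    using z[of p] z[of q]
    by (auto simp: relabel_def tens_def unzip_op_def split_def take_zip drop_zip simp del: mem_Times_iff)
qed

lemma tensor_map_zip:
  "tensor_map (words I m \<times> words J m) (words I n \<times> words J n) (words I (m + n) \<times> words J (m + n))
    (map_prod (take m) (take m)) (map_prod (drop m) (drop m))
    (words (I \<times> J) (m + n)) (take m) (drop m) zip_op zip_op zip_op"
  unfolding tensor_map_def zip_op_relabel[OF tens_opers]
proof (intro ballI ext)
  fix X Y :: "(_ list \<times> _ list) oper" and zs zs'
  have z: "map fst zs \<in> words I (m + n) \<and> map snd zs \<in> words J (m + n)" if "zs \<in> words (I \<times> J) (m + n)" for zs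
    using splitting_mem[OF splitting_words_zip that] .
  show "relabel (words (I \<times> J) (m + n)) (\<lambda>zs. (map fst zs, map snd zs))
      (tens (words I (m + n) \<times> words J (m + n)) (map_prod (take m) (take m)) (map_prod (drop m) (drop m)) X Y) zs zs' =
    tens (words (I \<times> J) (m + n)) (take m) (drop m) (zip_op X) (zip_op Y) zs zs'"
    using z[of zs] z[of zs'] by (auto simp: relabel_def tens_def zip_op_def take_map drop_map)
qed

lemma splitting_prod:
  assumes "splitting K I J f g" "splitting K' I' J' f' g'"
  shows "splitting (K \<times> K') (I \<times> I') (J \<times> J') (map_prod f f') (map_prod g g')"
proof -
  have "bij_betw (map_prod (\<lambda>k. (f k, g k)) (\<lambda>k. (f' k, g' k))) (K \<times> K') ((I \<times> J) \<times> (I' \<times> J'))"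
    using assms unfolding splitting_def by (rule bij_betw_map_prod)
  moreover have "bij_betw (\<lambda>((i, j), (i', j')). ((i, i'), (j, j'))) ((I \<times> J) \<times> (I' \<times> J')) ((I \<times> I') \<times> (J \<times> J'))"
    by (rule bij_betwI[where g = "\<lambda>((i, i'), (j, j')). ((i, j), (i', j'))"]) auto
  ultimately have "bij_betw ((\<lambda>((i, j), (i', j')). ((i, i'), (j, j'))) \<circ> map_prod (\<lambda>k. (f k, g k)) (\<lambda>k. (f' k, g' k)))
      (K \<times> K') ((I \<times> I') \<times> (J \<times> J'))"
    by (rule bij_betw_trans)
  then show ?thesis unfolding splitting_def
    by (rule bij_betw_cong[THEN iffD1, rotated]) auto
qed

text \<open>An output reference must have the form \<open>{..<q}\<close>, so a pair of such
  references is stored as a single number.\<close>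

lemma splitting_div_mod: "splitting {..<a * b} {..<a} {..<b} (\<lambda>z. z div b) (\<lambda>z. z mod b)" for a b :: nat
  unfolding splitting_def
proof (rule bij_betwI[where g = "\<lambda>(x, y). x * b + y"])
  show "(\<lambda>z. (z div b, z mod b)) \<in> {..<a * b} \<rightarrow> {..<a} \<times> {..<b}"
    by (auto simp: less_mult_imp_div_less) (metis mod_less_divisor mult_0_right neq0_conv not_less0)
  show "(\<lambda>(x, y). x * b + y) \<in> {..<a} \<times> {..<b} \<rightarrow> {..<a * b}"
  proof auto
    fix x y assume "x < a" "y < b"
    then have "x * b + y < Suc x * b" by simp
    also have "\<dots> \<le> a * b" using \<open>x < a\<close> by (intro mult_le_mono1) simp
    finally show "x * b + y < a * b" .
  qed
qed auto

text \<open>Both strategies share \<open>\<rho>\<close>, because the composite input must again be a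
  power of one state. \<open>N\<close> is built without reference to \<open>\<Theta>\<close>, so the
  same composite strategy can be run with both superchannels.\<close>

lemma product_output_add:
  fixes q1 q2 :: nat and r :: nat
  assumes fin: "finite A" "finite B" "finite C" "finite D" and \<Theta>: "superchannel A B C D \<Theta>"
    and N: "product_input A B C m r q1 \<rho> N1" "product_input A B C n r q2 \<rho> N2"
  defines "N \<equiv> tens_chan (words A (m + n) \<times> words {..<r} (m + n)) (words B (m + n) \<times> {..<q1 * q2})
      (map_prod (take m) (take m)) (map_prod (drop m) (drop m))
      (map_prod (take m) (\<lambda>z. z div q2)) (map_prod (drop m) (\<lambda>z. z mod q2)) N1 N2"
  shows "product_input A B C (m + n) r (q1 * q2) \<rho> N"
    and "product_output B C (m + n) \<Theta> \<rho> N =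
      tens (words D (m + n) \<times> {..<q1 * q2}) (map_prod (take m) (\<lambda>z. z div q2)) (map_prod (drop m) (\<lambda>z. z mod q2))
        (product_output B C m \<Theta> \<rho> N1) (product_output B C n \<Theta> \<rho> N2)"
proof -
  have st: "state (C \<times> {..<r}) \<rho>" and ch: "channel (words A m \<times> words {..<r} m) (words B m \<times> {..<q1}) N1"
    "channel (words A n \<times> words {..<r} n) (words B n \<times> {..<q2}) N2"
    using N by (auto simp: product_input_def)
  have s1: "splitting (words A (m + n) \<times> words {..<r} (m + n)) (words A m \<times> words {..<r} m) (words A n \<times> words {..<r} n)
      (map_prod (take m) (take m)) (map_prod (drop m) (drop m))"
    by (intro splitting_prod splitting_words_add)
  have s2: "splitting (words B (m + n) \<times> {..<q1 * q2}) (words B m \<times> {..<q1}) (words B n \<times> {..<q2})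
      (map_prod (take m) (\<lambda>z. z div q2)) (map_prod (drop m) (\<lambda>z. z mod q2))"
    by (intro splitting_prod splitting_words_add splitting_div_mod)
  have w: "finite (words A k)" "finite (words B k)" "finite (words {..<r} k)" for k
    using fin by (simp_all add: words_finite)
  have "channel (words A (m + n) \<times> words {..<r} (m + n)) (words B (m + n) \<times> {..<q1 * q2}) N"
    unfolding N_def by (rule channel_tens_chan[OF _ _ _ _ ch s1 s2]) (simp_all add: w)
  then show "product_input A B C (m + n) r (q1 * q2) \<rho> N" using st by (simp add: product_input_def)
  have tN: "tensor_map (words A m \<times> words {..<r} m) (words A n \<times> words {..<r} n)
      (words A (m + n) \<times> words {..<r} (m + n)) (map_prod (take m) (take m)) (map_prod (drop m) (drop m))
      (words B (m + n) \<times> {..<q1 * q2}) (map_prod (take m) (\<lambda>z. z div q2)) (map_prod (drop m) (\<lambda>z. z mod q2)) N1 N2 N"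
    unfolding tensor_map_def N_def by (intro ballI tens_chan_tens[OF _ _ ch s1 s2]) (simp_all add: w)
  have S: "finite (mem \<Theta>)" and E: "channel C (A \<times> mem \<Theta>) (enc \<Theta>)"
    and F: "channel (B \<times> mem \<Theta>) D (dec \<Theta>)" using \<Theta> by (auto simp: superchannel_def system_def)
  have AS: "finite (A \<times> mem \<Theta>)" "finite (B \<times> mem \<Theta>)" using fin S by auto
  have enc: "tensor_map (words C m) (words C n) (words C (m + n)) (take m) (drop m)
      (words A (m + n) \<times> words (mem \<Theta>) (m + n)) (map_prod (take m) (take m)) (map_prod (drop m) (drop m))
      (enc (super_pow B C m \<Theta>)) (enc (super_pow B C n \<Theta>)) (enc (super_pow B C (m + n) \<Theta>))"
    unfolding super_pow_def super.simps
    by (rule tensor_map_comp[OF tensor_map_map_pow[OF fin(3) AS(1) E] tensor_map_unzip])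
      (rule channel_opers[OF channel_map_pow[OF fin(3) AS(1) E]], assumption)+
  have dec: "tensor_map (words B m \<times> mem (super_pow B C m \<Theta>)) (words B n \<times> mem (super_pow B C n \<Theta>))
      (words B (m + n) \<times> words (mem \<Theta>) (m + n)) (map_prod (take m) (take m)) (map_prod (drop m) (drop m))
      (words D (m + n)) (take m) (drop m)
      (dec (super_pow B C m \<Theta>)) (dec (super_pow B C n \<Theta>)) (dec (super_pow B C (m + n) \<Theta>))"
    unfolding super_pow_def super.simps
    by (rule tensor_map_comp[OF tensor_map_zip tensor_map_map_pow[OF AS(2) fin(4) F]])
      (rule channel_opers[OF channel_zip[OF fin(2) S]], assumption)+
  have o: "\<rho> \<in> opers (C \<times> {..<r})" by (rule state_opers[OF st])
  have op: "oper_pow k \<rho> \<in> opers (words (C \<times> {..<r}) k)" for k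
    by (rule state_opers[OF state_oper_pow[OF _ st]]) (use fin in simp)
  have up: "unzip_op (oper_pow k \<rho>) \<in> opers (words C k \<times> words {..<r} k)" for k
    by (rule channel_opers[OF channel_unzip op]) (use fin in simp_all)
  show "product_output B C (m + n) \<Theta> \<rho> N =
      tens (words D (m + n) \<times> {..<q1 * q2}) (map_prod (take m) (\<lambda>z. z div q2)) (map_prod (drop m) (\<lambda>z. z mod q2))
        (product_output B C m \<Theta> \<rho> N1) (product_output B C n \<Theta> \<rho> N2)"
    unfolding product_output_def oper_pow_add[OF o] tensor_mapD[OF tensor_map_unzip op op]
    by (rule super_apply_tens[OF superchannel_pow[OF fin \<Theta>] superchannel_pow[OF fin \<Theta>] ch enc dec tN up up])
qed

subsection \<open>Rates\<close>

text \<open>The input state is a parameter while the channel and its output reference are hidden: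
  only the former has to be shared by strategies composed in parallel.\<close>

definition reach where
  "reach A B C D \<Theta>1 \<Theta>2 r \<rho> n m V \<longleftrightarrow> (\<exists>q N. product_input A B C n r q \<rho> N \<and>
     pair_data (words D n \<times> {..<q}) (product_output B C n \<Theta>1 \<rho> N) (product_output B C n \<Theta>2 \<rho> N) m V)"

lemma reach_add:
  assumes fin: "finite A" "finite B" "finite C" "finite D"
    and \<Theta>: "superchannel A B C D \<Theta>1" "superchannel A B C D \<Theta>2"
    and r: "reach A B C D \<Theta>1 \<Theta>2 r \<rho> n m V" "reach A B C D \<Theta>1 \<Theta>2 r \<rho> n' m' V'"
  shows "reach A B C D \<Theta>1 \<Theta>2 r \<rho> (n + n') (m + m') (V + V')"
proof -
  obtain q N where 1: "product_input A B C n r q \<rho> N"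
     "pair_data (words D n \<times> {..<q}) (product_output B C n \<Theta>1 \<rho> N) (product_output B C n \<Theta>2 \<rho> N) m V"
    using r(1) unfolding reach_def by blast
  obtain q' N' where 2: "product_input A B C n' r q' \<rho> N'"
     "pair_data (words D n' \<times> {..<q'}) (product_output B C n' \<Theta>1 \<rho> N') (product_output B C n' \<Theta>2 \<rho> N') m' V'"
    using r(2) unfolding reach_def by blast
  have s: "splitting (words D (n + n') \<times> {..<q * q'}) (words D n \<times> {..<q}) (words D n' \<times> {..<q'})
      (map_prod (take n) (\<lambda>z. z div q')) (map_prod (drop n) (\<lambda>z. z mod q'))"
    by (intro splitting_prod splitting_words_add splitting_div_mod)
  show ?thesis
    unfolding reach_def
    using product_output_add(1)[OF fin \<Theta>(1) 1(1) 2(1)] pair_data_tens[OF s 1(2) 2(2)]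
    unfolding product_output_add(2)[OF fin \<Theta>(1) 1(1) 2(1), symmetric]
      product_output_add(2)[OF fin \<Theta>(2) 1(1) 2(1), symmetric] by blast
qed

lemma reach_rel_entropy:
  assumes sys: "finite A" "finite B" "finite C" "finite D"
    and \<Theta>: "superchannel A B C D \<Theta>1" "superchannel A B C D \<Theta>2"
    and N: "product_input A B C n r q \<rho> N"
    and x: "ereal x < rel_entropy (words D n \<times> {..<q}) (product_output B C n \<Theta>1 \<rho> N) (product_output B C n \<Theta>2 \<rho> N)"
  obtains m V where "x < m" "reach A B C D \<Theta>1 \<Theta>2 r \<rho> n m V"
proof -
  have "finite (words D n \<times> {..<q})" using sys by (simp add: words_finite)
  from pair_data_exists[OF this state_product_output[OF sys \<Theta>(1) N] state_product_output[OF sys \<Theta>(2) N] x]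
  obtain m V where mV: "x < m"
    "pair_data (words D n \<times> {..<q}) (product_output B C n \<Theta>1 \<rho> N) (product_output B C n \<Theta>2 \<rho> N) m V" .
  have "reach A B C D \<Theta>1 \<Theta>2 r \<rho> n m V" unfolding reach_def using N mV(2) by blast
  with mV(1) show ?thesis by (rule that)
qed

text \<open>Supplies the padding. Any channel will do, since relative entropy is never minus
  infinity and hence exceeds some real; the resulting \<open>m\<close> may be negative.\<close>

lemma reach_exists:
  assumes sys: "system A" "system B" "system C" "system D"
    and \<Theta>: "superchannel A B C D \<Theta>1" "superchannel A B C D \<Theta>2" and st: "state (C \<times> {..<r}) \<rho>"
  shows "\<exists>m V. reach A B C D \<Theta>1 \<Theta>2 r \<rho> n m V"
proof -
  have fin: "finite A" "finite B" "finite C" "finite D" "B \<noteq> {}" using sys by (auto simp: system_def)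
  obtain N where "channel (words A n \<times> words {..<r} n) (words B n \<times> {..<Suc 0}) N"
    using channel_exists[of "words A n \<times> words {..<r} n" "words B n \<times> {..<Suc 0}"] fin
    by (auto simp: words_finite words_nonempty)
  then have N: "product_input A B C n r (Suc 0) \<rho> N" using st by (simp add: product_input_def)
  let ?D = "rel_entropy (words D n \<times> {..<Suc 0}) (product_output B C n \<Theta>1 \<rho> N) (product_output B C n \<Theta>2 \<rho> N)"
  have "?D \<noteq> -\<infinity>" by (simp add: rel_entropy_def)
  then obtain x where "ereal x < ?D" using ereal_dense2[of "-\<infinity>" ?D] by (auto simp: less_le)
  then show ?thesis using reach_rel_entropy[OF fin(1-4) \<Theta> N] by blast
qed

text \<open>The length \<open>n = k n\<^sub>0 + l\<close> with \<open>l < n\<^sub>0\<close> is reached by \<open>k\<close> parallel copies of a strategy of length \<open>n\<^sub>0\<close>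
  and an arbitrary strategy of length \<open>l\<close>, whose contribution is bounded.\<close>

lemma reach_linear:
  assumes sys: "system A" "system B" "system C" "system D"
    and \<Theta>: "superchannel A B C D \<Theta>1" "superchannel A B C D \<Theta>2" and n0: "0 < n0"
    and r: "reach A B C D \<Theta>1 \<Theta>2 r \<rho> n0 m0 V0"
  obtains K where "0 \<le> K" "\<And>n. \<exists>m V. reach A B C D \<Theta>1 \<Theta>2 r \<rho> n m V \<and>
      real n * (m0 / real n0) - K \<le> m \<and> V \<le> K * real n + K"
proof -
  have fin: "finite A" "finite B" "finite C" "finite D" using sys by (auto simp: system_def)
  have "state (C \<times> {..<r}) \<rho>" using r by (auto simp: reach_def product_input_def)
  then obtain a b where ab: "\<And>l. reach A B C D \<Theta>1 \<Theta>2 r \<rho> l (a l) (b l)"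
    using reach_exists[OF sys \<Theta>] by metis
  define \<mu> where "\<mu> = m0 / real n0"
  \<comment> \<open>\<open>K\<close> bounds the shortfall and the variance of every padding strategy
    and the variance of one block. Each block of length \<open>n0\<close> adds exactly
    \<open>n0 * \<mu>\<close> to the mean and at most \<open>K\<close>, hence at most
    \<open>K * n0\<close>, to the variance.\<close>
  define K where "K = (\<Sum>l<n0. \<bar>real l * \<mu> - a l\<bar> + \<bar>b l\<bar>) + \<bar>V0\<bar>"
  have K: "0 \<le> K" "V0 \<le> K" unfolding K_def by (auto simp: sum_nonneg add_nonneg_nonneg intro: order_trans[OF abs_ge_self])
  have Kl: "\<bar>real l * \<mu> - a l\<bar> + \<bar>b l\<bar> \<le> K" if "l < n0" for l
    using member_le_sum[of l "{..<n0}" "\<lambda>l. \<bar>real l * \<mu> - a l\<bar> + \<bar>b l\<bar>"] that by (simp add: K_def)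
  have "\<exists>m V. reach A B C D \<Theta>1 \<Theta>2 r \<rho> n m V \<and> real n * \<mu> - K \<le> m \<and> V \<le> K * real n + K" for n
  proof (induction n rule: less_induct)
    case (less n)
    show ?case
    proof (cases "n < n0")
      case True
      have "0 \<le> K * real n" using K by simp
      then have "real n * \<mu> - K \<le> a n" "b n \<le> K * real n + K" using Kl[OF True] by linarith+
      then show ?thesis using ab by blast
    next
      case False
      then obtain m V where IH: "reach A B C D \<Theta>1 \<Theta>2 r \<rho> (n - n0) m V" "real (n - n0) * \<mu> - K \<le> m"
          "V \<le> K * real (n - n0) + K"
        using less[of "n - n0"] n0 by auto
      have "reach A B C D \<Theta>1 \<Theta>2 r \<rho> ((n - n0) + n0) (m + m0) (V + V0)"
        by (rule reach_add[OF fin \<Theta> IH(1) r])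
      moreover have "real n * \<mu> - K \<le> m + m0"
      proof -
        have "real n * \<mu> = real (n - n0) * \<mu> + real n0 * \<mu>" using False by (simp add: of_nat_diff algebra_simps)
        moreover have "real n0 * \<mu> = m0" using n0 by (simp add: \<mu>_def)
        ultimately show ?thesis using IH(2) by simp
      qed
      moreover have "V + V0 \<le> K * real n + K"
      proof -
        have "K * real n = K * real (n - n0) + K * real n0" using False by (simp add: of_nat_diff algebra_simps)
        moreover have "K * 1 \<le> K * real n0" using n0 K by (intro mult_left_mono) auto
        ultimately show ?thesis using IH(3) K(2) by linarith
      qed
      ultimately show ?thesis using False by auto
    qed
  qed
  then show ?thesis using that K(1) unfolding \<mu>_def by blast
qed

section \<open>From reachable pairs to divergence rates and error exponents\<close>

abbreviation sup_entropy where
  "sup_entropy A B C D \<Theta>1 \<Theta>2 n \<equiv> (SUP (r, q, \<rho>, N) \<in> {(r, q, \<rho>, N). product_input A B C n r q \<rho> N}.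
     rel_entropy (words D n \<times> {..<q}) (product_output B C n \<Theta>1 \<rho> N) (product_output B C n \<Theta>2 \<rho> N))"

lemma reach_le_sup_entropy:
  assumes D: "finite D" and r: "reach A B C D \<Theta>1 \<Theta>2 r \<rho> n m V"
  shows "ereal m \<le> sup_entropy A B C D \<Theta>1 \<Theta>2 n"
proof -
  obtain q N where 1: "product_input A B C n r q \<rho> N"
     "pair_data (words D n \<times> {..<q}) (product_output B C n \<Theta>1 \<rho> N) (product_output B C n \<Theta>2 \<rho> N) m V"
    using r unfolding reach_def by blast
  have "ereal m \<le> rel_entropy (words D n \<times> {..<q}) (product_output B C n \<Theta>1 \<rho> N) (product_output B C n \<Theta>2 \<rho> N)"
    by (rule pair_data_le_rel_entropy[OF _ 1(2)]) (use D in \<open>simp add: words_finite\<close>)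
  also have "\<dots> \<le> sup_entropy A B C D \<Theta>1 \<Theta>2 n"
    by (rule SUP_upper2[where i = "(r, q, \<rho>, N)"]) (use 1(1) in auto)
  finally show ?thesis .
qed

lemma neg_log2_ge:
  assumes "0 \<le> \<beta>" "\<beta> \<le> 2 powr - x"
  shows "ereal x \<le> neg_log2 \<beta>"
proof (cases "\<beta> = 0")
  case False
  then have "log 2 \<beta> \<le> log 2 (2 powr - x)" using assms by (subst log_le_cancel_iff) auto
  then show ?thesis using False by (simp add: neg_log2_def)
qed (simp add: neg_log2_def)

lemma ereal_le_rate:
  assumes "0 < n" "ereal (real n * y) \<le> z"
  shows "ereal y \<le> ereal (1 / real n) * z"
proof -
  have "ereal (1 / real n) * ereal (real n * y) \<le> ereal (1 / real n) * z"
    by (rule ereal_mult_left_mono) (use assms in auto)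
  then show ?thesis using assms(1) by simp
qed

text \<open>The one-shot test pays \<open>2 * \<delta>\<close> in the exponent for a first error of
  at most \<open>2 * V / \<delta>^2\<close>.\<close>

lemma reach_le_zeta:
  assumes D: "finite D" and r: "reach A B C D \<Theta>1 \<Theta>2 r \<rho> n m V" and \<Theta>: "superchannel A B C D \<Theta>1"
    and n: "0 < n" and \<delta>: "0 < \<delta>" and \<epsilon>: "2 * V / \<delta>\<^sup>2 \<le> \<epsilon>" and y: "real n * y \<le> m - 2 * \<delta>"
  shows "ereal y \<le> \<zeta>_cp A B C D n \<epsilon> \<Theta>1 \<Theta>2"
proof -
  obtain q N where 1: "product_input A B C n r q \<rho> N"
     "pair_data (words D n \<times> {..<q}) (product_output B C n \<Theta>1 \<rho> N) (product_output B C n \<Theta>2 \<rho> N) m V"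
    using r unfolding reach_def by blast
  have fin: "finite (words D n \<times> {..<q})" using D by (simp add: words_finite)
  obtain Q1 Q2 where Q: "binary_povm (words D n \<times> {..<q}) Q1 Q2" "\<alpha>_err B C D n \<Theta>1 q \<rho> N Q2 \<le> 2 * V / \<delta>\<^sup>2"
    "0 \<le> \<beta>_err B C D n \<Theta>2 q \<rho> N Q1" "\<beta>_err B C D n \<Theta>2 q \<rho> N Q1 \<le> 2 powr (2 * \<delta> - m)"
    using one_shot_test[OF fin 1(2) \<delta>] unfolding \<alpha>_err_def \<beta>_err_def by blast
  note Q(4)
  also have "2 powr (2 * \<delta> - m) \<le> 2 powr - (real n * y)" using y by simp
  finally have "ereal (real n * y) \<le> neg_log2 (\<beta>_err B C D n \<Theta>2 q \<rho> N Q1)" by (rule neg_log2_ge[OF Q(3)])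
  then have "ereal y \<le> ereal (1 / real n) * neg_log2 (\<beta>_err B C D n \<Theta>2 q \<rho> N Q1)" by (rule ereal_le_rate[OF n])
  also have "\<dots> \<le> \<zeta>_cp A B C D n \<epsilon> \<Theta>1 \<Theta>2"
    unfolding \<zeta>_cp_def
    by (rule SUP_upper2[where i = "(r, q, \<rho>, N, Q1, Q2)"]) (use 1(1) Q(1,2) \<epsilon> in auto)
  finally show ?thesis .
qed

text \<open>Any real \<open>y\<close> below the rate at length \<open>n0\<close> is beaten by one
  strategy, whose padded repetitions keep the rate above \<open>y\<close> at all large lengths.
  Approaching the rate by reals from below also covers an infinite rate.\<close>

lemma rate_le_liminf:
  assumes sys: "system A" "system B" "system C" "system D"
    and \<Theta>: "superchannel A B C D \<Theta>1" "superchannel A B C D \<Theta>2" and n0: "0 < n0" and \<epsilon>: "0 < \<epsilon>"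
  shows "ereal (1 / real n0) * sup_entropy A B C D \<Theta>1 \<Theta>2 n0
      \<le> liminf (\<lambda>n. ereal (1 / real n) * sup_entropy A B C D \<Theta>1 \<Theta>2 n)" (is "?a n0 \<le> liminf ?a")
    and "ereal (1 / real n0) * sup_entropy A B C D \<Theta>1 \<Theta>2 n0 \<le> liminf (\<lambda>n. \<zeta>_cp A B C D n \<epsilon> \<Theta>1 \<Theta>2)"
proof -
  have fin: "finite A" "finite B" "finite C" "finite D" using sys by (auto simp: system_def)
  have main: "(\<forall>\<^sub>F n in sequentially. ereal y \<le> ?a n) \<and> (\<forall>\<^sub>F n in sequentially. ereal y \<le> \<zeta>_cp A B C D n \<epsilon> \<Theta>1 \<Theta>2)"
    if y: "ereal y < ?a n0" for y
  proof -
    have "ereal (real n0 * y) < sup_entropy A B C D \<Theta>1 \<Theta>2 n0"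
    proof (rule ccontr)
      assume "\<not> ?thesis"
      then have "ereal (1 / real n0) * sup_entropy A B C D \<Theta>1 \<Theta>2 n0 \<le> ereal (1 / real n0) * ereal (real n0 * y)"
        by (intro ereal_mult_left_mono) auto
      then show False using y n0 by simp
    qed
    then obtain r q \<rho> N where N: "product_input A B C n0 r q \<rho> N" and
      "ereal (real n0 * y) < rel_entropy (words D n0 \<times> {..<q}) (product_output B C n0 \<Theta>1 \<rho> N) (product_output B C n0 \<Theta>2 \<rho> N)"
      unfolding less_SUP_iff by auto
    from reach_rel_entropy[OF fin \<Theta> this] obtain m0 V0 where m0: "real n0 * y < m0" and
      reach: "reach A B C D \<Theta>1 \<Theta>2 r \<rho> n0 m0 V0" by blast
    obtain K where K: "0 \<le> K" "\<And>n. \<exists>m V. reach A B C D \<Theta>1 \<Theta>2 r \<rho> n m V \<and>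
      real n * (m0 / real n0) - K \<le> m \<and> V \<le> K * real n + K"
      using reach_linear[OF sys \<Theta> n0 reach] by blast
    \<comment> \<open>A third of the gap: one share absorbs the constant loss \<open>K\<close>, the
      other two pay for \<open>2 * \<delta>\<close> with
      \<open>\<delta> = n * \<eta>\<close>.\<close>
    define \<eta> where "\<eta> = (m0 / real n0 - y) / 3"
    have \<eta>: "0 < \<eta>" using m0 n0 by (simp add: \<eta>_def field_simps)
    have \<mu>: "m0 / real n0 = y + 3 * \<eta>"
      unfolding \<eta>_def times_divide_eq_right by (subst nonzero_mult_div_cancel_left) auto
    \<comment> \<open>The first summand ensures \<open>K \<le> n * \<eta>\<close>, the second that
      the first error is at most \<open>\<epsilon>\<close>; the final 1 makes the length
      positive.\<close>
    define n1 where "n1 = nat \<lceil>K / \<eta> + 4 * K / (\<epsilon> * \<eta>\<^sup>2)\<rceil> + 1"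
    have both: "ereal y \<le> ?a n \<and> ereal y \<le> \<zeta>_cp A B C D n \<epsilon> \<Theta>1 \<Theta>2" if n: "n1 \<le> n" for n
    proof -
      have n0': "0 < n" using n by (simp add: n1_def)
      have "K / \<eta> + 4 * K / (\<epsilon> * \<eta>\<^sup>2) \<le> real n" using n unfolding n1_def by linarith
      moreover have "0 \<le> K / \<eta>" "0 \<le> 4 * K / (\<epsilon> * \<eta>\<^sup>2)" using K(1) \<eta> \<epsilon> by simp_all
      ultimately have "K / \<eta> \<le> real n" "4 * K / (\<epsilon> * \<eta>\<^sup>2) \<le> real n" by linarith+
      then have b: "K \<le> real n * \<eta>" "4 * K \<le> real n * (\<epsilon> * \<eta>\<^sup>2)" using \<eta> \<epsilon> by (simp_all add: pos_divide_le_eq)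
      obtain m V where mV: "reach A B C D \<Theta>1 \<Theta>2 r \<rho> n m V" "real n * (m0 / real n0) - K \<le> m" "V \<le> K * real n + K"
        using K(2) by blast
      have m: "real n * y + 2 * (real n * \<eta>) \<le> m" using mV(2) b(1) unfolding \<mu> by (simp add: algebra_simps)
      have "real n * y \<le> m" using m \<eta> by (smt (verit) mult_nonneg_nonneg of_nat_0_le_iff)
      then have "ereal (real n * y) \<le> sup_entropy A B C D \<Theta>1 \<Theta>2 n"
        using reach_le_sup_entropy[OF fin(4) mV(1)] by (meson ereal_less_eq(3) order_trans)
      then have "ereal y \<le> ?a n" by (rule ereal_le_rate[OF n0'])
      moreover have "ereal y \<le> \<zeta>_cp A B C D n \<epsilon> \<Theta>1 \<Theta>2"
      proof (rule reach_le_zeta[OF fin(4) mV(1) \<Theta>(1) n0'])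
        show "0 < real n * \<eta>" using n0' \<eta> by simp
        show "real n * y \<le> m - 2 * (real n * \<eta>)" using m by simp
        \<comment> \<open>As \<open>n \<ge> 1\<close>, the bound \<open>K * n + K\<close> on the
          variance is at most \<open>2 * K * n\<close>.\<close>
        have "K \<le> K * real n" using K(1) n0' by (simp add: mult_le_cancel_left1)
        then have "2 * V \<le> 4 * K * real n" using mV(3) by linarith
        also have "\<dots> \<le> real n * (\<epsilon> * \<eta>\<^sup>2) * real n" using b(2) by (intro mult_right_mono) auto
        finally show "2 * V / (real n * \<eta>)\<^sup>2 \<le> \<epsilon>"
          using n0' \<eta> by (simp add: pos_divide_le_eq power2_eq_square mult_ac)
      qed
      ultimately show ?thesis by blast
    qed
    then show ?thesis unfolding eventually_sequentially by blast
  qed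
  show "?a n0 \<le> liminf ?a"
  proof (rule dense_le)
    fix x assume x: "x < ?a n0"
    show "x \<le> liminf ?a"
    proof (cases x)
      case (real y)
      then show ?thesis using main[of y] x by (intro Liminf_bounded) blast
    qed (use x in auto)
  qed
  show "?a n0 \<le> liminf (\<lambda>n. \<zeta>_cp A B C D n \<epsilon> \<Theta>1 \<Theta>2)"
  proof (rule dense_le)
    fix x assume x: "x < ?a n0"
    show "x \<le> liminf (\<lambda>n. \<zeta>_cp A B C D n \<epsilon> \<Theta>1 \<Theta>2)"
    proof (cases x)
      case (real y)
      then show ?thesis using main[of y] x by (intro Liminf_bounded) blast
    qed (use x in auto)
  qed
qed

theorem lemma5p2:
  fixes A :: "'a set" and B :: "'b set" and C :: "'c set" and D :: "'d set"
    and \<Theta>1 :: "('a, 'b, 'c, 'd, 's) super" and \<Theta>2 :: "('a, 'b, 'c, 'd, 't) super"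
    and \<epsilon> :: real
  assumes "system A" and "system B" and "system C" and "system D"
    and "superchannel A B C D \<Theta>1" and "superchannel A B C D \<Theta>2"
    and "0 < \<epsilon>" and "\<epsilon> < 1"
  shows "liminf (\<lambda>n. \<zeta>_cp A B C D n \<epsilon> \<Theta>1 \<Theta>2) \<ge> D_cinf A B C D \<Theta>1 \<Theta>2"
proof -
  define a where "a n = ereal (1 / real n) * sup_entropy A B C D \<Theta>1 \<Theta>2 n" for n
  \<comment> \<open>Length 0 is left out: there the rate is 0 only through the convention 1 / 0 =
    0.\<close>
  define s where "s = (SUP n\<in>{0<..}. a n)"
  have "s \<le> liminf a"
    unfolding s_def by (rule SUP_least) (use rate_le_liminf(1)[OF assms(1-6) _ assms(7)] in \<open>simp add: a_def[abs_def]\<close>)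
  moreover have "limsup a \<le> s"
    unfolding s_def by (intro Limsup_bounded eventually_mono[OF eventually_gt_at_top[of 0]] SUP_upper) simp
  moreover have "liminf a \<le> limsup a" by (rule Liminf_le_Limsup) simp
  ultimately have "a \<longlonglongrightarrow> s" by (subst tendsto_iff_Liminf_eq_Limsup) auto
  \<comment> \<open>Convergence has to be established first, because \<open>lim\<close> has a
    specified value only for convergent sequences.\<close>
  then have "D_cinf A B C D \<Theta>1 \<Theta>2 = s" unfolding D_cinf_def a_def[abs_def] by (rule limI)
  also have "s \<le> liminf (\<lambda>n. \<zeta>_cp A B C D n \<epsilon> \<Theta>1 \<Theta>2)"
    unfolding s_def by (rule SUP_least) (use rate_le_liminf(2)[OF assms(1-6) _ assms(7)] in \<open>simp add: a_def\<close>)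
  finally show ?thesis .
qed

end
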